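(* Let $k$ be a field with $\mathrm{char}\,k\ne2$ and let $G=\langle\rho\rangle\simeq C_2$ act on the rational function field $k(x_1,x_2,x_3,x_4)$ by the $k$-automorphism $\rho: x_1\mapsto -x_1,\ x_2\mapsto \frac{x_4}{x_2},\ x_3\mapsto\frac{(x_4-1)(x_4-x_1^2)}{x_3},\ x_4\mapsto x_4.$ Then $k(x_1,x_2,x_3,x_4)^G$ is not retract $k$-rational.
   Context: A field $F\supset k$ is retract $k$-rational if there is a $k$-algebra $A\subset F$ with quotient field $F$, a nonzero $f\in k[t_1,\ldots,t_m]$, and $k$-algebra homomorphisms $\varphi:A\to k[t_1,\ldots,t_m][1/f]$, $\psi:k[t_1,\ldots,t_m][1/f]\to A$ with $\psi\circ\varphi=\mathrm{id}_A$. *)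

theory Defs
  imports "HOL-Library.Poly_Mapping" "HOL-Computational_Algebra.Fraction_Field"
begin

text \<open>Polynomials over k in countably many variables t_0, t_1, ... (monomials are
  finitely supported exponent vectors), and their field of fractions. All fields of
  rational functions in finitely many variables used below are realised as subsets of
  this single field.\<close>

type_synonym 'k mpoly = "(nat \<Rightarrow>\<^sub>0 nat) \<Rightarrow>\<^sub>0 'k"
type_synonym 'k ratfun = "'k mpoly fract"

definition cst :: "'k::field \<Rightarrow> 'k ratfun" where
  "cst c = Fract (Poly_Mapping.single 0 c) 1"

definition var :: "nat \<Rightarrow> 'k::field ratfun" where
  "var i = Fract (Poly_Mapping.single (Poly_Mapping.single i 1) 1) 1"

definition polys_in :: "nat \<Rightarrow> 'k::field mpoly set" where
  "polys_in m = {p. \<forall>mon \<in> Poly_Mapping.keys p. Poly_Mapping.keys mon \<subseteq> {..<m}}"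

definition ratfun_field :: "nat \<Rightarrow> 'k::field ratfun set" where
  "ratfun_field m = {Fract p q | p q. p \<in> polys_in m \<and> q \<in> polys_in m \<and> q \<noteq> 0}"

definition localized_poly_ring :: "nat \<Rightarrow> 'k::field mpoly \<Rightarrow> 'k ratfun set" where
  "localized_poly_ring m f = {Fract g (f ^ n) | g n. g \<in> polys_in m}"

definition is_k_subalgebra :: "'k::field ratfun set \<Rightarrow> bool" where
  "is_k_subalgebra A \<longleftrightarrow> (\<forall>c. cst c \<in> A) \<and>
     (\<forall>a\<in>A. \<forall>b\<in>A. a + b \<in> A \<and> a * b \<in> A \<and> a - b \<in> A)"

definition is_k_alg_hom :: "'k::field ratfun set \<Rightarrow> 'k ratfun set \<Rightarrow> ('k ratfun \<Rightarrow> 'k ratfun) \<Rightarrow> bool" where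
  "is_k_alg_hom S T h \<longleftrightarrow> h ` S \<subseteq> T \<and> (\<forall>c. h (cst c) = cst c) \<and>
     (\<forall>a\<in>S. \<forall>b\<in>S. h (a + b) = h a + h b \<and> h (a * b) = h a * h b)"

definition retract_k_rational :: "'k::field ratfun set \<Rightarrow> bool" where
  "retract_k_rational F \<longleftrightarrow>
    (\<exists>A. A \<subseteq> F \<and> is_k_subalgebra A \<and>
         F = {a / b | a b. a \<in> A \<and> b \<in> A \<and> b \<noteq> 0} \<and>
         (\<exists>m f \<phi> \<psi>. f \<in> polys_in m \<and> f \<noteq> 0 \<and>
            is_k_alg_hom A (localized_poly_ring m f) \<phi> \<and>
            is_k_alg_hom (localized_poly_ring m f) A \<psi> \<and>
            (\<forall>a\<in>A. \<psi> (\<phi> a) = a)))"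

end

theory Submission
  imports Defs "HOL-Algebra.Algebraic_Closure_Type"
begin

text \<open>Write x, y, z, d for the variables and put a = x^2. The fixed field K contains u1, w1, u2, w2 with
  d = u1^2 - a w1^2 and (d - 1)(d - a) = u2^2 - a w2^2. These two relations make the quaternion
  algebra (a, d - 1) over K unramified at every discrete valuation when -1 is a square, so
  after passing to an algebraically closed field of constants it is an obstruction to
  retract rationality. It is not split: otherwise d - 1 would be a norm from k(x, y, z, d), and a
  divisor argument, first in z and then in y, would make d - 1 a norm from k(x, d) up to a power
  of d and a power of (d - 1)(d - a), which contradicts the parity of the orders along
  d = 1 and d = a.

  The obstruction is used without Brauer groups. A retraction through the localization at f of
  k[t_1, ..., t_m] sends t_i to an element of K; the line through this point and a constant
  point turns K into a family of elements of K(X) which is the identity at X = 1 and constant at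
  X = 0. An everywhere unramified quaternion algebra over the affine line is constant, by
  Legendre's descent; it splits at X = 0, where all entries are squares, hence also at X = 1.\<close>

text \<open>Since (d - 1)(d - a) is a norm from the extension by a root of a, the algebras (a, d -
  1) and (a, d - a) coincide. Where a has even order and is not a local square, ramification
  therefore needs positive odd order of both d - 1 and d - a; but then a is congruent to 1, hence a
  square in the completion after all. The obstacle is that the entries of the algebra keep changing
  during the descent. Therefore (a, b) is represented only by a set, the values of its pure norm
  form: ramification is defined from this set, and splitting is detected by the value 1. Besides a
  root of -1, the closure of k supplies two things: k may be finite, so that a hypersurface can
  contain every k-rational point, and the value of a at the constant point must have a root. The
  retraction itself stays over k; only K is mapped into the fixed field over the closure, where the
  images of the t_i form the second point of the line.\<close>

hide_const (open) Rat.Fract Polynomials.var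

section \<open>Integer-valued valuations, local squares and local norms\<close>

locale int_valuation =
  fixes v :: "'a::field \<Rightarrow> int"
  assumes v_mult: "x \<noteq> 0 \<Longrightarrow> y \<noteq> 0 \<Longrightarrow> v (x * y) = v x + v y"
    and v_add: "x \<noteq> 0 \<Longrightarrow> y \<noteq> 0 \<Longrightarrow> x + y \<noteq> 0 \<Longrightarrow> min (v x) (v y) \<le> v (x + y)"
begin

lemma v_one [simp]: "v 1 = 0"
  using v_mult[of 1 1] by simp

lemma v_minus_one: "v (- 1) = 0"
  using v_mult[of "- 1" "- 1"] by simp

lemma v_uminus [simp]: "v (- x) = v x"
proof (cases "x = 0")
  case False
  then show ?thesis using v_mult[of "- 1" x] v_minus_one by simp
qed simp

lemma v_divide: "x \<noteq> 0 \<Longrightarrow> y \<noteq> 0 \<Longrightarrow> v (x / y) = v x - v y"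
  using v_mult[of "x / y" y] by simp

lemma v_square: "x \<noteq> 0 \<Longrightarrow> v (x\<^sup>2) = 2 * v x"
  by (simp add: power2_eq_square v_mult)

lemma v_add_dominant:
  assumes "x \<noteq> 0" "y \<noteq> 0" "v x < v y"
  shows "x + y \<noteq> 0" "v (x + y) = v x"
proof -
  show nz: "x + y \<noteq> 0"
  proof
    assume "x + y = 0"
    then have "y = - x" by (simp add: eq_neg_iff_add_eq_0 add.commute)
    then show False using assms by simp
  qed
  have "v x \<le> v (x + y)" using v_add[OF assms(1,2) nz] assms by simp
  moreover have "min (v (x + y)) (v (- y)) \<le> v x"
    using v_add[of "x + y" "- y"] nz assms by simp
  ultimately show "v (x + y) = v x" using assms by simp
qed

text \<open>The principal units, congruent to 1 modulo the maximal ideal. The case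
  \<open>m = 1\<close> is listed separately because \<open>v 0\<close> carries no
  information.\<close>

definition one_unit :: "'a \<Rightarrow> bool" where
  "one_unit m \<longleftrightarrow> m = 1 \<or> (m \<noteq> 0 \<and> v (m - 1) > 0)"

lemma one_unit_nz: "one_unit m \<Longrightarrow> m \<noteq> 0"
  by (auto simp: one_unit_def)

lemma v_one_unit: "one_unit m \<Longrightarrow> v m = 0"
  using v_add_dominant[of 1 "m - 1"] by (cases "m = 1") (auto simp: one_unit_def)

lemma one_unit_mult:
  assumes "one_unit m" "one_unit n" shows "one_unit (m * n)"
proof (cases "m = 1 \<or> n = 1 \<or> m * n = 1")
  case True
  then show ?thesis using assms by (auto simp: one_unit_def)
next
  case False
  have nz: "m \<noteq> 0" "n \<noteq> 0" using assms one_unit_nz by auto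
  have *: "m * n - 1 = m * (n - 1) + (m - 1)" by (simp add: algebra_simps)
  have "v (m * (n - 1)) > 0" using False assms nz v_one_unit[OF assms(1)]
    by (auto simp: v_mult one_unit_def)
  moreover have "v (m - 1) > 0" using False assms by (auto simp: one_unit_def)
  ultimately have "v (m * n - 1) > 0"
    using v_add[of "m * (n - 1)" "m - 1"] False nz unfolding * by (auto simp flip: *)
  then show ?thesis using nz by (simp add: one_unit_def)
qed

lemma one_unit_inverse:
  assumes "one_unit m" shows "one_unit (1 / m)"
proof (cases "m = 1")
  case False
  have nz: "m \<noteq> 0" using assms one_unit_nz by auto
  have *: "1 / m - 1 = - (m - 1) / m" using nz by (simp add: field_simps)
  have "v (1 / m - 1) = v (m - 1)"
    unfolding * using False nz v_one_unit[OF assms] v_uminus[of "m - 1"] by (subst v_divide) auto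
  then show ?thesis using assms False nz by (simp add: one_unit_def)
qed (simp add: one_unit_def)

text \<open>The elements that are squares in the completion (in residue characteristic different
  from 2).\<close>

definition locsq :: "'a \<Rightarrow> bool" where
  "locsq x \<longleftrightarrow> (\<exists>s m. s \<noteq> 0 \<and> one_unit m \<and> x = s\<^sup>2 * m)"

lemma locsq_nz: "locsq x \<Longrightarrow> x \<noteq> 0"
  by (auto simp: locsq_def one_unit_nz)

lemma locsq_square: "s \<noteq> 0 \<Longrightarrow> locsq (s\<^sup>2)"
  unfolding locsq_def by (rule exI[of _ s], rule exI[of _ 1]) (simp add: one_unit_def)

lemma locsq_mult: "locsq x \<Longrightarrow> locsq y \<Longrightarrow> locsq (x * y)"
proof -
  assume "locsq x" "locsq y"
  then obtain s m t n where "s \<noteq> 0" "one_unit m" "x = s\<^sup>2 * m" "t \<noteq> 0" "one_unit n" "y = t\<^sup>2 * n"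
    by (auto simp: locsq_def)
  then show ?thesis unfolding locsq_def
    by (intro exI[of _ "s * t"] exI[of _ "m * n"])
       (auto simp: one_unit_mult power_mult_distrib)
qed

lemma locsq_cancel: "locsq (x * y) \<Longrightarrow> locsq x \<Longrightarrow> locsq y"
proof -
  assume xy: "locsq (x * y)" and x: "locsq x"
  then obtain s m where s: "s \<noteq> 0" "one_unit m" "x = s\<^sup>2 * m"
    by (auto simp: locsq_def)
  have "locsq (1 / x)" unfolding locsq_def
    by (intro exI[of _ "1 / s"] exI[of _ "1 / m"]) (use s one_unit_inverse in \<open>auto simp: power_divide\<close>)
  from locsq_mult[OF xy this] locsq_nz[OF x] show ?thesis by simp
qed

lemma locsq_cancel': "locsq (x * y) \<Longrightarrow> locsq y \<Longrightarrow> locsq x"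
  using locsq_cancel[of y x] by (simp add: mult.commute)

lemma locsq_trans: "locsq (x * y) \<Longrightarrow> locsq (y * z) \<Longrightarrow> locsq (x * z)"
proof -
  assume xy: "locsq (x * y)" and yz: "locsq (y * z)"
  then have "y \<noteq> 0" using locsq_nz by fastforce
  moreover have "locsq (y\<^sup>2 * (x * z))"
    using locsq_mult[OF xy yz] by (simp add: power2_eq_square mult_ac)
  ultimately show ?thesis using locsq_cancel locsq_square by blast
qed

lemma locsq_even: "locsq x \<Longrightarrow> even (v x)"
  unfolding locsq_def by (auto simp: v_mult v_square one_unit_nz v_one_unit)

lemma one_unit_add:
  assumes "x \<noteq> 0" "y = 0 \<or> v x < v y" shows "one_unit ((x + y) / x)"
proof (cases "y = 0")
  case False
  have "x + y \<noteq> 0" using v_add_dominant(1) assms False by blast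
  moreover have "(x + y) / x - 1 = y / x" using assms by (simp add: field_simps)
  ultimately show ?thesis using assms False by (auto simp: one_unit_def v_divide)
qed (use assms in \<open>simp add: one_unit_def\<close>)

text \<open>Terms of higher order do not change the square class, since (x + y) / x is a principal
  unit. Equality of square classes is always expressed by a product being
  \<open>locsq\<close>.\<close>

lemma locsq_near:
  assumes "x \<noteq> 0" "y = 0 \<or> v x < v y" shows "locsq (x * (x + y))"
  unfolding locsq_def using assms one_unit_add[OF assms]
  by (intro exI[of _ x] exI[of _ "(x + y) / x"]) (auto simp: power2_eq_square)

text \<open>In residue characteristic other than 2, a root of such an \<open>a\<close> generates an
  unramified quadratic extension of the completion. An odd order could only come from cancellation
  between x^2 and a y^2, which would make \<open>a\<close> a local square.\<close>

lemma norm_even: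
  assumes a: "a \<noteq> 0" "even (v a)" "\<not> locsq a" and nz: "x\<^sup>2 - a * y\<^sup>2 \<noteq> 0"
  shows "even (v (x\<^sup>2 - a * y\<^sup>2))"
proof (cases "x = 0 \<or> y = 0")
  case True
  then show ?thesis using a nz by (auto simp: v_mult v_square)
next
  case False
  define z where "z = - (a * y\<^sup>2)"
  have x: "x\<^sup>2 \<noteq> 0" and z: "z \<noteq> 0" using False a by (auto simp: z_def)
  have eq: "x\<^sup>2 - a * y\<^sup>2 = x\<^sup>2 + z" by (simp add: z_def)
  have ev: "even (v (x\<^sup>2))" "even (v z)"
    using False a by (auto simp: v_square v_mult z_def)
  consider "v (x\<^sup>2) < v z" | "v z < v (x\<^sup>2)" | "v (x\<^sup>2) = v z" by linarith
  then show ?thesis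
  proof cases
    case 1
    then show ?thesis using v_add_dominant(2)[OF x z] ev unfolding eq by simp
  next
    case 2
    then show ?thesis using v_add_dominant(2)[OF z x] ev unfolding eq by (simp add: add.commute)
  next
    case 3
    have nz': "x\<^sup>2 + z \<noteq> 0" using nz eq by simp
    have ge: "v (x\<^sup>2) \<le> v (x\<^sup>2 + z)" using v_add[OF x z nz'] 3 by simp
    have "\<not> v (x\<^sup>2) < v (x\<^sup>2 + z)"
    proof
      assume "v (x\<^sup>2) < v (x\<^sup>2 + z)"
      then have "locsq (- z * (- z + (x\<^sup>2 + z)))"
        using 3 z by (intro locsq_near) auto
      then have "locsq ((x * y)\<^sup>2 * a)" by (simp add: z_def power_mult_distrib mult_ac)
      then show False using a False locsq_cancel locsq_square[of "x * y"] by auto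
    qed
    then show ?thesis using ge ev unfolding eq by simp
  qed
qed

text \<open>The two terms have orders of opposite parity, so one of them dominates and determines
  the square class: that of x^2, or that of -a y^2.\<close>

lemma norm_odd:
  assumes a: "a \<noteq> 0" "odd (v a)" and nz: "x\<^sup>2 - a * y\<^sup>2 \<noteq> 0"
  shows "locsq (x\<^sup>2 - a * y\<^sup>2) \<or> locsq (- a * (x\<^sup>2 - a * y\<^sup>2))"
proof (cases "x = 0 \<or> y = 0")
  case True
  then have "x\<^sup>2 - a * y\<^sup>2 = x\<^sup>2 \<and> x \<noteq> 0 \<or> - a * (x\<^sup>2 - a * y\<^sup>2) = (a * y)\<^sup>2 \<and> a * y \<noteq> 0"
    using nz by (auto simp: power2_eq_square)
  then show ?thesis using locsq_square by metis
next
  case False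
  define z where "z = - (a * y\<^sup>2)"
  have x: "x\<^sup>2 \<noteq> 0" and z: "z \<noteq> 0" using False a by (auto simp: z_def)
  have eq: "x\<^sup>2 - a * y\<^sup>2 = x\<^sup>2 + z" by (simp add: z_def)
  have "even (v (x\<^sup>2))" "odd (v z)"
    using False a by (auto simp: v_square v_mult z_def)
  then consider "v (x\<^sup>2) < v z" | "v z < v (x\<^sup>2)" by (metis linorder_neqE)
  then show ?thesis
  proof cases
    case 1
    then have "locsq (x\<^sup>2 * (x\<^sup>2 + z))" using x by (intro locsq_near) auto
    then show ?thesis unfolding eq using locsq_cancel locsq_square x by (metis power_not_zero zero_power2)
  next
    case 2
    then have "locsq (z * (z + x\<^sup>2))" using z by (intro locsq_near) auto
    then have "locsq (y\<^sup>2 * (- a * (x\<^sup>2 + z)))" by (simp add: z_def algebra_simps)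
    then show ?thesis unfolding eq using locsq_cancel locsq_square False by blast
  qed
qed

end

text \<open>The values of the norm form of the quaternion algebra (a, b) on pure quaternions, up to
  sign.\<close>

definition pure_values :: "'a::field \<Rightarrow> 'a \<Rightarrow> 'a set" where
  "pure_values a b = {b * r\<^sup>2 + a * (q\<^sup>2 - b * s\<^sup>2) | q r s. True}"

lemma pure_valuesI: "x = b * r\<^sup>2 + a * (q\<^sup>2 - b * s\<^sup>2) \<Longrightarrow> x \<in> pure_values a b"
  unfolding pure_values_def by blast

lemma pure_values_generators:
  "a \<in> pure_values a b" "b \<in> pure_values a b" "- (a * b) \<in> pure_values a b"
  by (rule pure_valuesI[of _ b 0 a 1 0], simp,
      rule pure_valuesI[of _ b 1 a 0 0], simp,
      rule pure_valuesI[of _ b 0 a 0 1], simp)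

section \<open>Ramification at a valuation and the effect of the two norm relations\<close>

context int_valuation
begin

text \<open>Up to equality in the completion, the residue of (a, b) is the nontrivial class of d.
  The definition only mentions the set of pure values, so it is visibly an invariant of the
  quaternion algebra.\<close>

definition ramified :: "'a \<Rightarrow> 'a \<Rightarrow> bool" where
  "ramified a b \<longleftrightarrow> (\<exists>d. d \<noteq> 0 \<and> even (v d) \<and> \<not> locsq d \<and>
     (\<forall>x\<in>pure_values a b. x \<noteq> 0 \<longrightarrow> even (v x) \<longrightarrow> locsq (x * d)))"

text \<open>If \<open>b\<close> were not a local square, it would itself be a ramification class: by
  \<open>norm_even\<close> the part a(q^2 - b s^2) has odd order, so a pure value of even order is
  dominated by b r^2 and lies in the class of \<open>b\<close>.\<close>

lemma unramified_locsq:
  assumes "v a = 1" "v b = 0" "a \<noteq> 0" "b \<noteq> 0" "\<not> ramified a b"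
  shows "locsq b"
proof (rule ccontr)
  assume b: "\<not> locsq b"
  have "locsq (x * b)" if x: "x \<in> pure_values a b" "x \<noteq> 0" "even (v x)" for x
  proof -
    from x obtain q r s where xeq: "x = b * r\<^sup>2 + a * (q\<^sup>2 - b * s\<^sup>2)"
      unfolding pure_values_def by blast
    define n where "n = a * (q\<^sup>2 - b * s\<^sup>2)"
    have n: "odd (v n)" if "n \<noteq> 0"
      using that norm_even[of b q s] assms b by (auto simp: n_def v_mult)
    have r: "r \<noteq> 0" using n x xeq unfolding n_def by auto
    have br: "b * r\<^sup>2 \<noteq> 0" "even (v (b * r\<^sup>2))" using r assms by (auto simp: v_mult v_square)
    have "n = 0 \<or> v (b * r\<^sup>2) < v n"
    proof (rule ccontr)
      assume "\<not> ?thesis"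
      then have n0: "n \<noteq> 0" and "\<not> v (b * r\<^sup>2) < v n" by auto
      moreover have "v (b * r\<^sup>2) \<noteq> v n" using n[OF n0] br by auto
      ultimately have "v (n + b * r\<^sup>2) = v n" using br by (intro v_add_dominant) auto
      then show False using n[OF n0] x xeq unfolding n_def by (simp add: add.commute)
    qed
    then have "locsq (b * r\<^sup>2 * (b * r\<^sup>2 + n))" by (rule locsq_near[OF br(1)])
    then have "locsq (r\<^sup>2 * (x * b))" unfolding xeq n_def by (simp add: mult_ac)
    then show ?thesis using locsq_cancel locsq_square r by blast
  qed
  then have "ramified a b" unfolding ramified_def using assms b by (intro exI[of _ b]) auto
  then show False using assms by blast
qed

text \<open>Put b = d - 1 and f = d - a. As a, b and -ab are pure values, each of them that has even
  order lies in the ramification class \<open>c\<close>; signs do not matter because -1 is a square.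
  For even \<open>v a\<close> the relations act through \<open>norm_even\<close>, as parity
  conditions; for odd \<open>v a\<close> through \<open>norm_odd\<close>, which leaves only the
  classes of 1 and a for d and b f.\<close>

lemma unramified_if_relations:
  assumes i: "(i::'a)\<^sup>2 = - 1" and nz: "a \<noteq> 0" "d \<noteq> 0" "d \<noteq> 1" "d \<noteq> a"
    and d: "d = u1\<^sup>2 - a * w1\<^sup>2" and e: "(d - 1) * (d - a) = u2\<^sup>2 - a * w2\<^sup>2"
  shows "\<not> ramified a (d - 1)"
proof
  assume "ramified a (d - 1)"
  then obtain c where c: "c \<noteq> 0" "even (v c)" "\<not> locsq c"
    and all: "\<And>x. x \<in> pure_values a (d - 1) \<Longrightarrow> x \<noteq> 0 \<Longrightarrow> even (v x) \<Longrightarrow> locsq (x * c)"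
    unfolding ramified_def by blast
  define b where "b = d - 1"
  define f where "f = d - a"
  have bnz: "b \<noteq> 0" and fnz: "f \<noteq> 0" using nz by (auto simp: b_def f_def)
  have m1: "locsq (- 1)" using locsq_square[of i] i by (cases "i = 0") auto
  have neg: "locsq (- x) \<longleftrightarrow> locsq x" for x
    using locsq_mult[OF m1, of x] locsq_mult[OF m1, of "- x"] by auto
  have A: "even (v a) \<Longrightarrow> locsq (a * c)"
    and B: "even (v b) \<Longrightarrow> locsq (b * c)"
    and AB: "even (v (a * b)) \<Longrightarrow> locsq (a * b * c)"
    using all[OF pure_values_generators(1)] all[OF pure_values_generators(2)]
      all[OF pure_values_generators(3)] nz bnz neg[of "a * b * c"] by (auto simp: b_def)
  have vab: "v (a * b) = v a + v b" using nz bnz by (simp add: v_mult)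
  have vbf: "v (b * f) = v b + v f" using fnz bnz by (simp add: v_mult)
  have sums: "- 1 + d = b" "d + - 1 = b" "d + - a = f" "- a + d = f"
    by (simp_all add: b_def f_def)
  have vbd: "v d > 0 \<Longrightarrow> v b = 0" "v d < 0 \<Longrightarrow> v b = v d" "v d = 0 \<Longrightarrow> v b \<ge> 0"
    using v_add_dominant(2)[of "- 1" d] v_add_dominant(2)[of d "- 1"] v_add[of d "- 1"]
      nz(2) bnz unfolding sums by auto
  show False
  proof (cases "even (v a)")
    case True
    have a': "\<not> locsq a" using A[OF True] c locsq_cancel by blast
    \<comment> \<open>Otherwise a, b and their product would all lie in the class \<open>c\<close>;
      but the product of two elements of that class is a local square.\<close>
    have vb: "odd (v b)"
    proof
      assume ev: "even (v b)"
      have "locsq (a * b * c * c)"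
        using locsq_mult[OF A[OF True] B[OF ev]] by (simp add: mult_ac)
      moreover have "locsq (a * b * c)" using AB vab ev True by simp
      ultimately show False using c(3) locsq_cancel by blast
    qed
    have vd: "even (v d)" using norm_even[OF nz(1) True a', of u1 w1] nz(2) unfolding d[symmetric] by simp
    have "even (v (b * f))"
      using norm_even[OF nz(1) True a', of u2 w2] bnz fnz unfolding e[folded b_def f_def, symmetric]
      by simp
    then have vf: "odd (v f)" using vbf vb by auto
    have vd0: "v d = 0" using vbd(1,2) vb vd by (metis even_zero linorder_neqE)
    moreover have "v b \<noteq> 0" using vb by force
    ultimately have vb0: "v b > 0" using vbd(3) by simp
    have "v a = 0"
    proof (rule ccontr)
      assume "v a \<noteq> 0"
      then consider "v (- a) < v d" | "v d < v (- a)" using vd0 by fastforce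
      then have "v f = v a \<or> v f = v d"
        using v_add_dominant(2)[of "- a" d] v_add_dominant(2)[of d "- a"] nz(1,2)
        unfolding sums by cases auto
      then show False using vf True vd by auto
    qed
    then have "v f > 0" using v_add[of d "- a"] nz(1,2) fnz vd0 vf \<open>v a = 0\<close>
      unfolding sums by (cases "v f = 0") auto
    \<comment> \<open>Both \<open>b\<close> and \<open>f\<close> have positive order, so
      \<open>a\<close> is congruent to 1 and hence a local square, against
      \<open>a'\<close>.\<close>
    moreover have eq: "a = 1 + (b + - f)" by (simp add: b_def f_def)
    ultimately have "b + - f = 0 \<or> v 1 < v (b + - f)"
      using v_add[of b "- f"] bnz fnz vb0 by (cases "b = f") (auto simp: min_def split: if_splits)
    then have "locsq (1 * (1 + (b + - f)))" by (intro locsq_near) auto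
    then show False using a' eq by simp
  next
    case False
    have N: "locsq d \<or> locsq (a * d)" "locsq (b * f) \<or> locsq (a * (b * f))"
      using norm_odd[OF nz(1) False, of u1 w1] norm_odd[OF nz(1) False, of u2 w2]
        bnz fnz nz(2) neg[of "a * d"] neg[of "a * (b * f)"]
      unfolding d[symmetric] e[folded b_def f_def, symmetric] by auto
    \<comment> \<open>From here on it suffices to place \<open>b\<close> in the class of 1 or of
      \<open>a\<close>, where \<open>N\<close> already places \<open>d\<close> and
      \<open>b * f\<close>.\<close>
    have bad: "\<not> locsq b" "\<not> locsq (a * b)"
    proof -
      show "\<not> locsq b" using B locsq_even c locsq_cancel by blast
      show "\<not> locsq (a * b)" using AB locsq_even c locsq_cancel by blast
    qed
    consider "v d > 0" | "v d < 0" | "v d = 0" by linarith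
    then show False
    proof cases
      case 1
      then have "locsq (- 1 * (- 1 + d))" by (intro locsq_near) auto
      then show False using bad(1) neg[of b] unfolding sums by simp
    next
      case 2
      then have *: "locsq (d * b)" using locsq_near[of d "- 1"] nz(2) unfolding sums by simp
      then have "locsq d \<Longrightarrow> locsq b" using locsq_cancel by blast
      moreover have "locsq (a * d) \<Longrightarrow> locsq (a * b)" using * locsq_trans by blast
      ultimately show False using N bad by blast
    next
      case 3
      then have "\<not> locsq (a * d)" using locsq_even[of "a * d"] False nz by (auto simp: v_mult)
      then have dsq: "locsq d" using N by blast
      consider "v a > 0" | "v a < 0" using False by (cases "v a = 0") force+
      then have "locsq f \<or> locsq (a * f)"
      proof cases
        case 1
        then have "locsq (d * (d + - a))" using 3 nz by (intro locsq_near) auto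
        then show ?thesis using dsq locsq_cancel sums(3) by metis
      next
        case 2
        then have "locsq (- a * (- a + d))" using 3 nz by (intro locsq_near) auto
        then show ?thesis using neg[of "a * f"] unfolding sums by simp
      qed
      then show False
      proof
        assume "locsq f"
        then have "locsq b \<or> locsq (a * b)"
          using N(2) locsq_cancel'[of b f] locsq_cancel'[of "a * b" f] by (auto simp: mult.assoc)
        then show False using bad by blast
      next
        assume *: "locsq (a * f)"
        have "locsq (b * f) \<Longrightarrow> locsq (a * b)"
          using locsq_trans[OF *, of b] by (simp add: mult.commute)
        moreover have "locsq (a * (b * f)) \<Longrightarrow> locsq b"
          using locsq_cancel'[of b "a * f"] * by (simp add: mult_ac)
        ultimately show False using N bad by blast
      qed
    qed
  qed
qed

end

section \<open>Quaternion algebras over a rational function field\<close>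

lemma pure_values_commute: "pure_values a b = pure_values b a"
proof -
  have "pure_values a b \<subseteq> pure_values b a" for a b :: 'a
  proof
    fix x assume "x \<in> pure_values a b"
    then obtain q r s where "x = b * r\<^sup>2 + a * (q\<^sup>2 - b * s\<^sup>2)"
      unfolding pure_values_def by blast
    then have "x = a * q\<^sup>2 + b * (r\<^sup>2 - a * s\<^sup>2)" by (simp add: algebra_simps)
    then show "x \<in> pure_values b a" by (rule pure_valuesI)
  qed
  then show ?thesis by blast
qed

lemma pure_values_times_square:
  assumes "s \<noteq> 0" shows "pure_values (a * s\<^sup>2) b = pure_values a b"
proof -
  have *: "pure_values (a * t\<^sup>2) b \<subseteq> pure_values a b" for a t
  proof
    fix x assume "x \<in> pure_values (a * t\<^sup>2) b"
    then obtain q r u where "x = b * r\<^sup>2 + a * t\<^sup>2 * (q\<^sup>2 - b * u\<^sup>2)"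
      unfolding pure_values_def by blast
    then have "x = b * r\<^sup>2 + a * ((t * q)\<^sup>2 - b * (t * u)\<^sup>2)"
      by (simp add: power_mult_distrib algebra_simps)
    then show "x \<in> pure_values a b" by (rule pure_valuesI)
  qed
  have eq: "a * s\<^sup>2 * (1 / s)\<^sup>2 = a" using assms by (simp add: power_divide)
  show ?thesis using *[of a s] *[of "a * s\<^sup>2" "1 / s"] unfolding eq by (rule subset_antisym)
qed

text \<open>Norms from the extension by a root of \<open>b\<close> multiply, which gives one
  inclusion. The other follows by applying it to a n, where n is the norm, and dropping the square
  n^2.\<close>

lemma pure_values_times_norm:
  assumes "c\<^sup>2 - b * e\<^sup>2 \<noteq> 0" shows "pure_values (a * (c\<^sup>2 - b * e\<^sup>2)) b = pure_values a b"
proof -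
  define n where "n = c\<^sup>2 - b * e\<^sup>2"
  have *: "pure_values (a * n) b \<subseteq> pure_values a b" for a
  proof
    fix x assume "x \<in> pure_values (a * n) b"
    then obtain q r u where "x = b * r\<^sup>2 + a * n * (q\<^sup>2 - b * u\<^sup>2)"
      unfolding pure_values_def by blast
    then have "x = b * r\<^sup>2 + a * ((c * q + b * e * u)\<^sup>2 - b * (c * u + e * q)\<^sup>2)"
      unfolding n_def by (simp add: power2_eq_square algebra_simps)
    then show "x \<in> pure_values a b" by (rule pure_valuesI)
  qed
  have "pure_values a b = pure_values (a * n * n) b"
    using pure_values_times_square[of n a b] assms by (simp add: n_def power2_eq_square mult_ac)
  then show ?thesis using *[of a] *[of "a * n"] unfolding n_def by auto
qed

text \<open>The form contains the hyperbolic plane a(q^2 - s^2), which represents everything when 2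
  is invertible: solve q - s = 1 and q + s = x / a.\<close>

lemma pure_values_one:
  assumes "(2::'a::field) \<noteq> 0" "a \<noteq> 0" shows "pure_values a (1::'a) = UNIV"
proof -
  have "x \<in> pure_values a 1" for x
  proof -
    define q s where "q = (x / a + 1) / 2" and "s = (x / a - 1) / 2"
    have "q - s = 1" "q + s = x / a"
      using assms(1) by (simp_all add: q_def s_def flip: diff_divide_distrib add_divide_distrib)
    then have "q\<^sup>2 - s\<^sup>2 = x / a" by (metis mult_1 power2_eq_square square_diff_square_factored mult.commute)
    then have "x = 1 * 0\<^sup>2 + a * (q\<^sup>2 - 1 * s\<^sup>2)" using assms(2) by simp
    then show ?thesis by (rule pure_valuesI)
  qed
  then show ?thesis by blast
qed

section \<open>Divisibility and irreducible factors of polynomials over a field\<close>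

lemma irreducible_poly_degree:
  fixes p :: "'a::field poly"
  assumes "irreducible p" shows "p \<noteq> 0" "degree p > 0"
  using assms is_unit_iff_degree[of p] by (auto simp: irreducible_def)

text \<open>A nonzero combination of least degree divides every combination, by division with
  remainder.\<close>

lemma poly_gcd_bezout:
  fixes p q :: "'a::field poly"
  assumes "p \<noteq> 0"
  shows "\<exists>g u w. g = u * p + w * q \<and> g dvd p \<and> g dvd q"
proof -
  define I where "I = {r. r \<noteq> 0 \<and> (\<exists>u w. r = u * p + w * q)}"
  have "p = 1 * p + 0 * q" by simp
  then have pI: "p \<in> I" unfolding I_def using assms by blast
  then obtain g where g: "g \<in> I" "\<And>r. r \<in> I \<Longrightarrow> degree g \<le> degree r"
    using ex_has_least_nat[of "\<lambda>r. r \<in> I" p degree] by blast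
  obtain u w where uw: "g = u * p + w * q" "g \<noteq> 0" using g(1) by (auto simp: I_def)
  have dvd: "g dvd h" if "h = s * p + t * q" for h s t
  proof -
    have "h mod g = (s - (h div g) * u) * p + (t - (h div g) * w) * q"
      using that uw minus_div_mult_eq_mod[of h g] by (simp add: algebra_simps)
    then have "h mod g \<noteq> 0 \<Longrightarrow> h mod g \<in> I" unfolding I_def by blast
    then have "h mod g = 0" using g(2) degree_mod_less[OF uw(2), of h] by fastforce
    then show ?thesis by auto
  qed
  have "g dvd p" "g dvd q" using dvd[of p 1 0] dvd[of q 0 1] by auto
  then show ?thesis using uw by blast
qed

lemma poly_bezout:
  fixes p q :: "'a::field poly"
  assumes "irreducible p" "\<not> p dvd q"
  shows "\<exists>u w. u * p + w * q = 1"
proof -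
  obtain g u w where g: "g = u * p + w * q" "g dvd p" "g dvd q"
    using poly_gcd_bezout irreducible_poly_degree(1)[OF assms(1)] by metis
  have "is_unit g"
  proof -
    obtain h where h: "p = g * h" using \<open>g dvd p\<close> by auto
    have "\<not> is_unit h"
    proof
      assume "is_unit h"
      then have "p dvd g" unfolding h by simp
      then show False using \<open>g dvd q\<close> assms(2) dvd_trans by blast
    qed
    then show ?thesis using irreducibleD[OF assms(1) h] by blast
  qed
  then obtain k where "1 = g * k" by (auto elim: dvdE)
  then have "(k * u) * p + (k * w) * q = 1" unfolding g by (simp add: algebra_simps)
  then show ?thesis by blast
qed

lemma poly_irreducible_factor:
  fixes p :: "'a::field poly"
  assumes "degree p > 0"
  shows "\<exists>q. irreducible q \<and> q dvd p"
proof -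
  obtain q where q: "degree q > 0" "q dvd p"
    "\<And>r. degree r > 0 \<and> r dvd p \<Longrightarrow> degree q \<le> degree r"
    using ex_has_least_nat[of "\<lambda>q. degree q > 0 \<and> q dvd p" p degree] assms by auto
  have "irreducible q"
  proof (rule irreducibleI)
    show "q \<noteq> 0" using q(1) by auto
    then show "\<not> is_unit q" using q(1) is_unit_iff_degree[of q] by simp
    fix a b assume ab: "q = a * b"
    have nz: "a \<noteq> 0" "b \<noteq> 0" using ab q(1) by auto
    have "a dvd p" "b dvd p" using ab q(2) by (auto intro: dvd_trans)
    then have "degree a > 0 \<Longrightarrow> degree q \<le> degree a" "degree b > 0 \<Longrightarrow> degree q \<le> degree b"
      using q(3) by auto
    moreover have "degree q = degree a + degree b" using ab nz by (simp add: degree_mult_eq)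
    ultimately have "degree a = 0 \<or> degree b = 0" by auto
    then show "is_unit a \<or> is_unit b" using nz by (auto simp: is_unit_iff_degree)
  qed
  then show ?thesis using q by blast
qed

lemma poly_split_off:
  fixes \<pi> p :: "'a::field poly"
  assumes "irreducible \<pi>" "p \<noteq> 0"
  shows "\<exists>n q. p = \<pi> ^ n * q \<and> \<not> \<pi> dvd q"
  using assms(2)
proof (induction "degree p" arbitrary: p rule: less_induct)
  case less
  show ?case
  proof (cases "\<pi> dvd p")
    case True
    then obtain r where r: "p = \<pi> * r" by auto
    have "degree \<pi> > 0" "\<pi> \<noteq> 0" using irreducible_poly_degree[OF assms(1)] by auto
    then have "degree r < degree p" using r less.prems by (auto simp: degree_mult_eq)
    then obtain n q where "r = \<pi> ^ n * q" "\<not> \<pi> dvd q" using less r by force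
    then show ?thesis using r by (intro exI[of _ "Suc n"] exI[of _ q]) (simp add: mult_ac)
  next
    case False
    then have "p = \<pi> ^ 0 * p \<and> \<not> \<pi> dvd p" by simp
    then show ?thesis by blast
  qed
qed

section \<open>The valuation belonging to an irreducible polynomial\<close>

definition pmult :: "'a::field poly \<Rightarrow> 'a poly \<Rightarrow> nat" where
  "pmult \<pi> p = (THE n. \<pi> ^ n dvd p \<and> \<not> \<pi> ^ Suc n dvd p)"

lemma pmult_split_off:
  fixes \<pi> :: "'a::field poly"
  assumes "irreducible \<pi>" "\<not> \<pi> dvd q"
  shows "pmult \<pi> (\<pi> ^ n * q) = n"
  unfolding pmult_def
proof (rule the_equality)
  have *: "\<not> \<pi> ^ Suc n dvd \<pi> ^ n * q"
    using assms by (auto simp: irreducible_def)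
  then show "\<pi> ^ n dvd \<pi> ^ n * q \<and> \<not> \<pi> ^ Suc n dvd \<pi> ^ n * q" by simp
  fix m assume m: "\<pi> ^ m dvd \<pi> ^ n * q \<and> \<not> \<pi> ^ Suc m dvd \<pi> ^ n * q"
  have "\<not> m < n" using m by (meson Suc_leI dvd_mult2 le_imp_power_dvd)
  moreover have "\<not> n < m" using m * by (meson Suc_leI dvd_trans le_imp_power_dvd)
  ultimately show "m = n" by simp
qed

lemma pmult_mult:
  fixes \<pi> p q :: "'a::field poly"
  assumes "irreducible \<pi>" "p \<noteq> 0" "q \<noteq> 0"
  shows "pmult \<pi> (p * q) = pmult \<pi> p + pmult \<pi> q"
proof -
  obtain m p' n q' where *: "p = \<pi> ^ m * p'" "\<not> \<pi> dvd p'" "q = \<pi> ^ n * q'" "\<not> \<pi> dvd q'"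
    using poly_split_off[OF assms(1,2)] poly_split_off[OF assms(1,3)] by blast
  have "\<not> \<pi> dvd p' * q'"
    using * field_poly_irreducible_imp_prime[OF assms(1)] prime_elem_dvd_mult_iff by blast
  moreover have "p * q = \<pi> ^ (m + n) * (p' * q')" using * by (simp add: power_add mult_ac)
  ultimately show ?thesis using * assms(1) pmult_split_off by metis
qed

lemma pmult_ge:
  fixes \<pi> p :: "'a::field poly"
  assumes "irreducible \<pi>" "p \<noteq> 0" "\<pi> ^ n dvd p"
  shows "n \<le> pmult \<pi> p"
proof -
  obtain m q where *: "p = \<pi> ^ m * q" "\<not> \<pi> dvd q"
    using poly_split_off[OF assms(1,2)] by blast
  have "n \<le> m"
  proof (rule ccontr)
    assume "\<not> n \<le> m"
    then have "\<pi> ^ Suc m dvd p" using assms(3) power_le_dvd by (metis not_less_eq_eq)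
    then show False using * assms(1) by (auto simp: irreducible_def)
  qed
  then show ?thesis using * assms(1) pmult_split_off by metis
qed

lemma pmult_dvd:
  fixes \<pi> p :: "'a::field poly"
  assumes "irreducible \<pi>" "p \<noteq> 0"
  shows "\<pi> ^ pmult \<pi> p dvd p"
  using poly_split_off[OF assms] pmult_split_off[OF assms(1)] by force

text \<open>The value at 0 is unspecified, here and in the locale of valuations.\<close>

definition fval :: "'a::field poly \<Rightarrow> 'a poly fract \<Rightarrow> int" where
  "fval \<pi> z = (SOME n. \<exists>p q. p \<noteq> 0 \<and> q \<noteq> 0 \<and> z = Fract p q \<and>
     n = int (pmult \<pi> p) - int (pmult \<pi> q))"

lemma fval_Fract:
  assumes \<pi>: "irreducible \<pi>" and nz: "p \<noteq> 0" "q \<noteq> 0"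
  shows "fval \<pi> (Fract p q) = int (pmult \<pi> p) - int (pmult \<pi> q)"
  unfolding fval_def
proof (rule some_equality)
  fix n assume "\<exists>p' q'. p' \<noteq> 0 \<and> q' \<noteq> 0 \<and> Fract p q = Fract p' q' \<and>
     n = int (pmult \<pi> p') - int (pmult \<pi> q')"
  then obtain p' q' where *: "p' \<noteq> 0" "q' \<noteq> 0" "Fract p q = Fract p' q'"
     "n = int (pmult \<pi> p') - int (pmult \<pi> q')" by blast
  then have "p * q' = p' * q" using nz by (simp add: eq_fract)
  then have "pmult \<pi> p + pmult \<pi> q' = pmult \<pi> p' + pmult \<pi> q"
    using pmult_mult[OF \<pi>] nz * by metis
  then show "n = int (pmult \<pi> p) - int (pmult \<pi> q)" using * by linarith
qed (use nz in blast)

lemma nonzero_Fract: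
  fixes z :: "'a::idom fract"
  assumes "z \<noteq> 0" obtains p q where "p \<noteq> 0" "q \<noteq> 0" "z = Fract p q"
  using assms by (cases z rule: Fract_cases_nonzero) auto

lemma pmult_one: "irreducible \<pi> \<Longrightarrow> pmult \<pi> 1 = 0"
  using pmult_split_off[of \<pi> 1 0] by (simp add: irreducible_def)

lemma int_valuation_fval:
  assumes \<pi>: "irreducible \<pi>" shows "int_valuation (fval \<pi>)"
proof
  fix x y :: "'a poly fract" assume nz: "x \<noteq> 0" "y \<noteq> 0"
  obtain p q where x: "p \<noteq> 0" "q \<noteq> 0" "x = Fract p q" using nonzero_Fract[OF nz(1)] .
  obtain r s where y: "r \<noteq> 0" "s \<noteq> 0" "y = Fract r s" using nonzero_Fract[OF nz(2)] .
  show "fval \<pi> (x * y) = fval \<pi> x + fval \<pi> y"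
    using x y \<pi> by (simp add: fval_Fract pmult_mult)
  assume "x + y \<noteq> 0"
  moreover have xy: "x + y = Fract (p * s + r * q) (q * s)" using x y by simp
  ultimately have nz': "p * s + r * q \<noteq> 0" by (auto simp: Zero_fract_def eq_fract)
  let ?m = "pmult \<pi>"
  have "\<pi> ^ min (?m (p * s)) (?m (r * q)) dvd p * s"
     "\<pi> ^ min (?m (p * s)) (?m (r * q)) dvd r * q"
    by (rule dvd_trans[OF le_imp_power_dvd pmult_dvd], use \<pi> x y in auto)+
  then have "min (?m (p * s)) (?m (r * q)) \<le> ?m (p * s + r * q)"
    by (intro pmult_ge \<pi> nz') simp
  then show "min (fval \<pi> x) (fval \<pi> y) \<le> fval \<pi> (x + y)"
    unfolding xy unfolding x y using x y nz' \<pi>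
    by (simp add: fval_Fract pmult_mult)
qed

text \<open>A unit that is a local square is a square in the residue field: writing the root as p /
  q with both parts prime to \<pi>, a root of \<open>b\<close> modulo \<pi> is p times an inverse of
  q.\<close>

lemma fval_locsq_imp_residue_square:
  fixes b :: "'a::field poly"
  assumes \<pi>: "irreducible \<pi>" and b: "\<not> \<pi> dvd b"
    and sq: "int_valuation.locsq (fval \<pi>) (to_fract b)"
  shows "\<exists>c. \<pi> dvd c\<^sup>2 - b"
proof -
  interpret int_valuation "fval \<pi>" using int_valuation_fval[OF \<pi>] .
  have bnz: "b \<noteq> 0" using b by auto
  have m0: "\<not> \<pi> dvd p \<Longrightarrow> pmult \<pi> p = 0" for p
    using pmult_split_off[OF \<pi>, of p 0] by simp
  from sq obtain s m where sm: "s \<noteq> 0" "one_unit m" "to_fract b = s\<^sup>2 * m"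
    unfolding locsq_def by blast
  have "fval \<pi> (to_fract b) = 0" using bnz m0[OF b] \<pi>
    by (simp add: to_fract_def fval_Fract pmult_one)
  then have vs: "fval \<pi> s = 0"
    using sm one_unit_nz v_one_unit by (simp add: v_mult v_square)
  obtain p' q' where "p' \<noteq> 0" "q' \<noteq> 0" and s': "s = Fract p' q'" using nonzero_Fract[OF sm(1)] .
  then obtain j p k q where *: "p' = \<pi> ^ j * p" "\<not> \<pi> dvd p" "q' = \<pi> ^ k * q" "\<not> \<pi> dvd q"
    using poly_split_off[OF \<pi>] by metis
  have nz: "p \<noteq> 0" "q \<noteq> 0" using * by auto
  have "j = k" using vs \<open>p' \<noteq> 0\<close> \<open>q' \<noteq> 0\<close> s' * \<pi>
    by (simp add: fval_Fract pmult_split_off)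
  then have s: "s = Fract p q" using s' * \<pi> \<open>q' \<noteq> 0\<close> by (auto simp: eq_fract)
  have m: "m = Fract (b * q\<^sup>2) (p\<^sup>2)"
  proof -
    have "m = to_fract b / s\<^sup>2" using sm by simp
    then show ?thesis using nz unfolding s by (simp add: to_fract_def power2_eq_square)
  qed
  have m1: "m - 1 = Fract (b * q\<^sup>2 - p\<^sup>2) (p\<^sup>2)"
    using nz unfolding m by (simp add: One_fract_def eq_fract)
  have "\<pi> dvd b * q\<^sup>2 - p\<^sup>2"
  proof (cases "m = 1")
    case True
    then have "b * q\<^sup>2 - p\<^sup>2 = 0" using m1 nz by (simp add: Zero_fract_def eq_fract)
    then show ?thesis by simp
  next
    case False
    have ne: "b * q\<^sup>2 - p\<^sup>2 \<noteq> 0"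
    proof
      assume "b * q\<^sup>2 - p\<^sup>2 = 0"
      then have "m - 1 = 0" unfolding m1 using nz by (simp add: Zero_fract_def eq_fract)
      then show False using False by simp
    qed
    have "fval \<pi> (m - 1) > 0" using sm(2) False unfolding one_unit_def by blast
    moreover have "fval \<pi> (m - 1) = int (pmult \<pi> (b * q\<^sup>2 - p\<^sup>2)) - int (pmult \<pi> (p\<^sup>2))"
      unfolding m1 by (rule fval_Fract[OF \<pi> ne]) (use nz in simp)
    ultimately have "pmult \<pi> (b * q\<^sup>2 - p\<^sup>2) \<noteq> 0" by linarith
    then show ?thesis using m0[of "b * q\<^sup>2 - p\<^sup>2"] by argo
  qed
  moreover obtain u w where uw: "u * \<pi> + w * q = 1" using poly_bezout[OF \<pi> *(4)] by blast
  ultimately obtain h where h: "b * q\<^sup>2 - p\<^sup>2 = \<pi> * h" by auto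
  have wq: "w * q = 1 - u * \<pi>" using uw by (simp add: algebra_simps)
  have "(w * p)\<^sup>2 - b = b * ((w * q)\<^sup>2 - 1) - w\<^sup>2 * (b * q\<^sup>2 - p\<^sup>2)"
    by (simp add: power2_eq_square algebra_simps)
  also have "\<dots> = \<pi> * (b * (u\<^sup>2 * \<pi> - 2 * u) - w\<^sup>2 * h)"
    unfolding wq h by (simp add: power2_eq_square algebra_simps)
  finally show ?thesis by (metis dvd_triv_left)
qed

section \<open>Legendre's descent on the degrees of the entries\<close>

lemma squarefree_square_mod:
  fixes a b :: "'a::field poly"
  assumes "a \<noteq> 0" "\<And>\<pi>. irreducible \<pi> \<Longrightarrow> \<not> \<pi>\<^sup>2 dvd a"
    "\<And>\<pi>. irreducible \<pi> \<Longrightarrow> \<pi> dvd a \<Longrightarrow> \<exists>c. \<pi> dvd c\<^sup>2 - b"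
  shows "\<exists>c. a dvd c\<^sup>2 - b"
  using assms
proof (induction "degree a" arbitrary: a rule: less_induct)
  case less
  show ?case
  proof (cases "degree a = 0")
    case True
    then have "is_unit a" using less.prems by (simp add: is_unit_iff_degree)
    then show ?thesis by (meson unit_imp_dvd)
  next
    case False
    then obtain \<pi> where \<pi>: "irreducible \<pi>" "\<pi> dvd a" using poly_irreducible_factor by blast
    then obtain a' where a: "a = \<pi> * a'" by auto
    have nd: "\<not> \<pi> dvd a'" using less.prems(2)[OF \<pi>(1)] a by (auto simp: power2_eq_square)
    have nz: "a' \<noteq> 0" using nd by auto
    have "degree \<pi> > 0" "\<pi> \<noteq> 0" using irreducible_poly_degree[OF \<pi>(1)] by auto
    then have "degree a' < degree a" using a nz \<pi>(1) by (auto simp: degree_mult_eq)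
    then obtain c2 where c2: "a' dvd c2\<^sup>2 - b"
      using less.hyps[of a'] less.prems(2,3) nz unfolding a by (meson dvd_mult)
    obtain c1 where c1: "\<pi> dvd c1\<^sup>2 - b" using less.prems(3)[OF \<pi>] by blast
    obtain u w where uw: "u * \<pi> + w * a' = 1" using poly_bezout[OF \<pi>(1) nd] by blast
    \<comment> \<open>The Chinese remainder combination, congruent to \<open>c1\<close> modulo \<pi>
      and to \<open>c2\<close> modulo \<open>a'\<close>.\<close>
    define c where "c = c2 * (u * \<pi>) + c1 * (w * a')"
    have "c = c1 + \<pi> * (u * (c2 - c1))" "c = c2 + a' * (w * (c1 - c2))"
    proof -
      have *: "w * a' = 1 - u * \<pi>" using uw by (simp add: algebra_simps)
      show "c = c1 + \<pi> * (u * (c2 - c1))" unfolding c_def * by (simp add: algebra_simps)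
      have *: "u * \<pi> = 1 - w * a'" using uw by (simp add: algebra_simps)
      show "c = c2 + a' * (w * (c1 - c2))" unfolding c_def * by (simp add: algebra_simps)
    qed
    moreover have "p dvd (e + p * t)\<^sup>2 - b" if "p dvd e\<^sup>2 - b" for p e t :: "'a poly"
    proof -
      have "(e + p * t)\<^sup>2 - b = (e\<^sup>2 - b) + p * (2 * e * t + p * t\<^sup>2)"
        by (simp add: power2_eq_square algebra_simps)
      then show ?thesis using dvd_add[OF that dvd_triv_left] by metis
    qed
    ultimately have "\<pi> dvd c\<^sup>2 - b" "a' dvd c\<^sup>2 - b" using c1 c2 by metis+
    then have "\<pi> * a' dvd (c\<^sup>2 - b) * (u * \<pi> + w * a')"
      unfolding distrib_left
      by (intro dvd_add) (auto simp: mult_ac intro: mult_dvd_mono dvd_mult)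
    then show ?thesis unfolding uw a by auto
  qed
qed

text \<open>The Legendre descent: a pair of polynomials of minimal total degree among those with
  given pure values is constant, since the larger one, say a, is squarefree, b is a square
  modulo a, and a may be replaced by its cofactor in c^2 - b.\<close>

lemma unramified_pure_values_constant:
  fixes A B :: "'a::field poly fract"
  assumes two: "(2::'a) \<noteq> 0" and nz: "A \<noteq> 0" "B \<noteq> 0"
    and unr: "\<And>\<pi>. irreducible \<pi> \<Longrightarrow> \<not> int_valuation.ramified (fval \<pi>) A B"
  shows "\<exists>\<alpha> \<beta>. \<alpha> \<noteq> 0 \<and> \<beta> \<noteq> 0 \<and> pure_values A B = pure_values (to_fract [:\<alpha>:]) (to_fract [:\<beta>:])"
proof -
  define P where "P = (\<lambda>(a, b). a \<noteq> 0 \<and> b \<noteq> 0 \<and>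
    pure_values (to_fract a) (to_fract b) = pure_values A B)"
  \<comment> \<open>Entries matter only up to squares, so multiplying a fraction by the square of
    its denominator makes it a polynomial entry.\<close>
  have Fract_times: "Fract p q * (to_fract q)\<^sup>2 = to_fract (p * q)" if "q \<noteq> 0" for p q :: "'a poly"
    using that by (simp add: to_fract_def power2_eq_square eq_fract)
  obtain p q where pq: "p \<noteq> 0" "q \<noteq> 0" "A = Fract p q" using nonzero_Fract[OF nz(1)] .
  obtain r s where rs: "r \<noteq> 0" "s \<noteq> 0" "B = Fract r s" using nonzero_Fract[OF nz(2)] .
  have "pure_values A B = pure_values (to_fract (p * q)) (to_fract (r * s))"
    using pure_values_times_square[of "to_fract q" A B] pure_values_times_square[of "to_fract s" B]
      Fract_times[OF pq(2)] Fract_times[OF rs(2)] pq rs by (metis pure_values_commute to_fract_eq_0_iff)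
  then have "P (p * q, r * s)" unfolding P_def using pq rs by simp
  then obtain ab where ab: "P ab" "\<And>x. P x \<Longrightarrow> degree (fst ab) + degree (snd ab) \<le> degree (fst x) + degree (snd x)"
    using ex_has_least_nat[of P _ "\<lambda>x. degree (fst x) + degree (snd x)"] by blast
  have two': "(2::'a poly fract) \<noteq> 0"
  proof -
    have "(2::'a poly fract) = to_fract [:2:]" by (metis numeral_poly of_nat_fract of_nat_numeral of_nat_poly to_fract_def)
    moreover have "([:2:]::'a poly) \<noteq> 0" using two by simp
    ultimately show ?thesis by (metis to_fract_eq_0_iff)
  qed
  \<comment> \<open>Only the entry of larger degree has to be treated; the roles are exchanged by
    \<open>pure_values_commute\<close>.\<close>
  have key: "degree a = 0" if ba: "degree b \<le> degree a" and Pab: "P (a, b)"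
    and min: "\<And>a' b'. P (a', b') \<Longrightarrow> degree a + degree b \<le> degree a' + degree b'" for a b
  proof (rule ccontr)
    assume deg: "degree a \<noteq> 0"
    have ab_nz: "a \<noteq> 0" "b \<noteq> 0" and pv: "pure_values (to_fract a) (to_fract b) = pure_values A B"
      using Pab by (auto simp: P_def)
    have sqfree: "\<not> \<pi>\<^sup>2 dvd a" if \<pi>: "irreducible \<pi>" for \<pi>
    proof
      assume "\<pi>\<^sup>2 dvd a"
      then obtain a' where a': "a = a' * \<pi>\<^sup>2" by (metis dvdE mult.commute)
      have pz: "\<pi> \<noteq> 0" "degree \<pi> > 0" using irreducible_poly_degree[OF \<pi>] by auto
      then have "pure_values (to_fract a) (to_fract b) = pure_values (to_fract a') (to_fract b)"
        unfolding a' using pure_values_times_square[of "to_fract \<pi>"] by (simp add: power2_eq_square)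
      then have "P (a', b)" using ab_nz pv a' by (auto simp: P_def)
      from min[OF this] show False using a' ab_nz pz by (auto simp: degree_mult_eq degree_power_eq)
    qed
    have "\<exists>c. a dvd c\<^sup>2 - b"
    proof (rule squarefree_square_mod[OF ab_nz(1) sqfree])
      fix \<pi> assume \<pi>: "irreducible \<pi>" "\<pi> dvd a"
      interpret int_valuation "fval \<pi>" using int_valuation_fval[OF \<pi>(1)] .
      show "\<exists>c. \<pi> dvd c\<^sup>2 - b"
      proof (cases "\<pi> dvd b")
        case True
        then show ?thesis by (intro exI[of _ 0]) simp
      next
        case False
        obtain a' where a': "a = \<pi> ^ 1 * a'" using \<pi>(2) by auto
        moreover have "\<not> \<pi> dvd a'" using sqfree[OF \<pi>(1)] a' by (auto simp: power2_eq_square)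
        ultimately have "pmult \<pi> a = 1" using pmult_split_off[OF \<pi>(1)] by metis
        moreover have "pmult \<pi> b = 0" using pmult_split_off[OF \<pi>(1) False, of 0] by simp
        ultimately have "fval \<pi> (to_fract a) = 1" "fval \<pi> (to_fract b) = 0"
          using ab_nz \<pi>(1) by (auto simp: to_fract_def fval_Fract pmult_one)
        \<comment> \<open>\<open>ramified\<close> depends on the entries only through their set of
          pure values, so the hypothesis on \<open>A\<close> and \<open>B\<close> passes to the
          current pair.\<close>
        moreover have "\<not> ramified (to_fract a) (to_fract b)"
          using unr[OF \<pi>(1)] unfolding ramified_def pv .
        ultimately have "locsq (to_fract b)"
          using ab_nz by (intro unramified_locsq[of "to_fract a"]) auto
        then show ?thesis by (rule fval_locsq_imp_residue_square[OF \<pi>(1) False])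
      qed
    qed
    then obtain c0 where c0: "a dvd c0\<^sup>2 - b" by blast
    \<comment> \<open>Reduction modulo \<open>a\<close> brings c^2 - b below twice the degree of
      \<open>a\<close>, so the cofactor of \<open>a\<close> in it has smaller degree than
      \<open>a\<close>.\<close>
    define c where "c = c0 mod a"
    have "a dvd c\<^sup>2 - b"
    proof -
      have "a dvd c0 - c" unfolding c_def by (simp add: dvd_minus_mod)
      then have "a dvd (c0\<^sup>2 - b) - (c0 - c) * (c0 + c)" by (rule dvd_diff[OF c0 dvd_mult2])
      also have "(c0\<^sup>2 - b) - (c0 - c) * (c0 + c) = c\<^sup>2 - b"
        by (simp add: power2_eq_square algebra_simps)
      finally show ?thesis .
    qed
    then obtain a' where a': "c\<^sup>2 - b = a * a'" by auto
    have degc: "degree c < degree a" using deg ab_nz degree_mod_less[of a c0] by (auto simp: c_def)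
    show False
    proof (cases "a' = 0")
      \<comment> \<open>The norm c^2 - b vanishes, so \<open>b\<close> is a square, the algebra is
        split, and (1, 1) is a smaller pair.\<close>
      case True
      then have b: "b = 1 * c\<^sup>2" using a' by simp
      then have "c \<noteq> 0" using ab_nz by auto
      then have "pure_values (to_fract b) (to_fract a) = pure_values 1 (to_fract a)"
        unfolding b using pure_values_times_square[of "to_fract c" 1 "to_fract a"] by (simp add: power2_eq_square)
      then have "pure_values (to_fract a) (to_fract b) = UNIV"
        using pure_values_one[OF two', of "to_fract a"] ab_nz pure_values_commute by (metis to_fract_eq_0_iff)
      moreover have "pure_values (to_fract 1) (to_fract (1::'a poly)) = UNIV"
        using pure_values_one[OF two', of 1] by simp
      ultimately have "P (1, 1)" using pv by (simp add: P_def)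
      from min[OF this] show False using deg by simp
    next
      case False
      have "degree (c\<^sup>2 - b) \<le> max (degree (c\<^sup>2)) (degree b)" by (rule degree_diff_le_max)
      moreover have "degree (c\<^sup>2) \<le> 2 * degree c"
        using degree_power_le[of c 2] by (simp add: mult.commute)
      moreover have "degree (c\<^sup>2 - b) = degree a + degree a'"
        unfolding a' using ab_nz(1) False by (rule degree_mult_eq)
      ultimately have "degree a + degree a' < 2 * degree a" using degc ba deg by linarith
      then have lt: "degree a' < degree a" by simp
      have n: "(to_fract c)\<^sup>2 - to_fract b * 1\<^sup>2 = to_fract a * to_fract a'"
        using arg_cong[OF a', of to_fract] by (simp add: power2_eq_square)
      \<comment> \<open>Multiplying \<open>a\<close> by the norm c^2 - b = a a' gives a^2 a', and
        the square drops out.\<close>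
      have "pure_values (to_fract a) (to_fract b)
        = pure_values (to_fract a * (to_fract a * to_fract a')) (to_fract b)"
        using pure_values_times_norm[of "to_fract c" "to_fract b" 1 "to_fract a"] ab_nz False
        unfolding n by simp
      also have "\<dots> = pure_values (to_fract a') (to_fract b)"
        using pure_values_times_square[of "to_fract a" "to_fract a'" "to_fract b"] ab_nz
        by (simp add: power2_eq_square mult_ac)
      finally have "P (a', b)" using pv ab_nz False by (simp add: P_def)
      from min[OF this] lt show False by simp
    qed
  qed
  obtain a b where [simp]: "ab = (a, b)" by (cases ab)
  have min: "degree a + degree b \<le> degree a' + degree b'" if "P (a', b')" for a' b'
    using ab(2)[OF that] by simp
  have P_commute: "P (b', a')" if "P (a', b')" for a' b'
    using that pure_values_commute by (auto simp: P_def)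
  have "degree a = 0 \<and> degree b = 0"
  proof (cases "degree b \<le> degree a")
    case True
    then show ?thesis using key[OF True] ab(1) min by auto
  next
    case False
    then have "degree b = 0" using key[of a b] P_commute[of a b] ab(1) min P_commute
      by (metis \<open>ab = (a, b)\<close> add.commute nat_le_linear)
    then show ?thesis using False by simp
  qed
  then obtain \<alpha> \<beta> where "a = [:\<alpha>:]" "b = [:\<beta>:]" by (meson degree_eq_zeroE)
  then have "P ([:\<alpha>:], [:\<beta>:])" using ab(1) by simp
  then have "\<alpha> \<noteq> 0 \<and> \<beta> \<noteq> 0 \<and> pure_values A B = pure_values (to_fract [:\<alpha>:]) (to_fract [:\<beta>:])"
    unfolding P_def by simp
  then show ?thesis by blast
qed

text \<open>Isotropy of the two-fold Pfister form, the reduced norm form of the quaternion algebra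
  (a, b); it means that the algebra splits. In this shape it says that \<open>b\<close> is a
  quotient of two norms unless both sides vanish.\<close>

definition pfister_isotropic :: "'a::field \<Rightarrow> 'a \<Rightarrow> bool" where
  "pfister_isotropic a b \<longleftrightarrow> (\<exists>p q r s. (p \<noteq> 0 \<or> q \<noteq> 0 \<or> r \<noteq> 0 \<or> s \<noteq> 0) \<and>
     p\<^sup>2 - a * q\<^sup>2 = b * (r\<^sup>2 - a * s\<^sup>2))"

lemma pfister_isotropicI:
  assumes "h \<noteq> 0 \<or> q \<noteq> 0 \<or> r \<noteq> 0 \<or> s \<noteq> 0" "h\<^sup>2 = b * r\<^sup>2 + a * (q\<^sup>2 - b * s\<^sup>2)"
  shows "pfister_isotropic a b"
proof -
  have "h\<^sup>2 - a * q\<^sup>2 = b * (r\<^sup>2 - a * s\<^sup>2)" using assms(2) by (simp add: algebra_simps)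
  then show ?thesis unfolding pfister_isotropic_def using assms(1) by blast
qed

text \<open>An isotropic vector makes \<open>b\<close> a norm x^2 - a y^2, and dividing by x^2
  represents 1. For x = 0 the form contains the hyperbolic plane a(g^2 - h^2). If the norm on the
  right vanishes, \<open>a\<close> is a square and represents 1 alone.\<close>

lemma pfister_isotropic_imp_one:
  fixes a b :: "'a::field"
  assumes two: "(2::'a) \<noteq> 0" and a: "a \<noteq> 0" and b: "b \<noteq> 0" and iso: "pfister_isotropic a b"
  shows "1 \<in> pure_values a b"
proof -
  obtain p q r s where nz: "p \<noteq> 0 \<or> q \<noteq> 0 \<or> r \<noteq> 0 \<or> s \<noteq> 0"
    and eq: "p\<^sup>2 - a * q\<^sup>2 = b * (r\<^sup>2 - a * s\<^sup>2)"
    using iso unfolding pfister_isotropic_def by blast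
  show ?thesis
  proof (cases "r\<^sup>2 - a * s\<^sup>2 = 0")
    case True
    have "\<exists>t. a = t\<^sup>2" if "x\<^sup>2 - a * y\<^sup>2 = 0" "x \<noteq> 0 \<or> y \<noteq> 0" for x y
    proof -
      have "y \<noteq> 0" using that by auto
      then have "a = (x / y)\<^sup>2" using that(1) by (simp add: power_divide field_simps)
      then show ?thesis by blast
    qed
    then obtain t where t: "a = t\<^sup>2" using True eq nz by (metis mult_zero_right)
    have "1 = b * 0\<^sup>2 + a * ((1 / t)\<^sup>2 - b * 0\<^sup>2)" using a t by (simp add: power_divide)
    then show ?thesis by (rule pure_valuesI)
  next
    case False
    define n where "n = r\<^sup>2 - a * s\<^sup>2"
    \<comment> \<open>x + y sqrt(a) is the quotient of p + q sqrt(a) by r - s sqrt(a), so its norm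
      is \<open>b\<close>.\<close>
    define x y where "x = (p * r + a * q * s) / n" and "y = (p * s + q * r) / n"
    have n: "n \<noteq> 0" using False by (simp add: n_def)
    have "(p * r + a * q * s)\<^sup>2 - a * (p * s + q * r)\<^sup>2 = (p\<^sup>2 - a * q\<^sup>2) * n"
      by (simp add: n_def power2_eq_square algebra_simps)
    also have "\<dots> = b * n\<^sup>2" unfolding eq n_def[symmetric] by (simp add: power2_eq_square)
    finally have bxy: "b = x\<^sup>2 - a * y\<^sup>2"
      using n by (simp add: x_def y_def power_divide field_simps)
    show ?thesis
    proof (cases "x = 0")
      case False
      have "1 = b * (1 / x)\<^sup>2 + a * ((y / x)\<^sup>2 - b * 0\<^sup>2)"
        unfolding bxy using False by (simp add: power_divide field_simps)
      then show ?thesis by (rule pure_valuesI)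
    next
      case True
      then have bb: "b = - (a * y\<^sup>2)" using bxy by simp
      then have y: "y \<noteq> 0" using b by auto
      define g h where "g = (1 / a + 1) / 2" and "h = (1 / a - 1) / 2"
      have "g - h = 1" "g + h = 1 / a"
        using two by (simp_all add: g_def h_def flip: diff_divide_distrib add_divide_distrib)
      then have "g\<^sup>2 - h\<^sup>2 = 1 / a" by (metis mult_1 power2_eq_square square_diff_square_factored mult.commute)
      then have "1 = a * (g\<^sup>2 - h\<^sup>2)" using a by simp
      then have "1 = b * (h / y)\<^sup>2 + a * (g\<^sup>2 - b * 0\<^sup>2)"
        unfolding bb using y by (simp add: power_divide algebra_simps)
      then show ?thesis by (rule pure_valuesI)
    qed
  qed
qed

lemma pure_values_to_fract_const:
  assumes "x \<in> pure_values a b"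
  shows "to_fract [:x:] \<in> pure_values (to_fract [:a:]) (to_fract [:b:])"
proof -
  obtain q r s where x: "x = b * r\<^sup>2 + a * (q\<^sup>2 - b * s\<^sup>2)"
    using assms unfolding pure_values_def by blast
  have "[:x:] = [:b:] * [:r:]\<^sup>2 + [:a:] * ([:q:]\<^sup>2 - [:b:] * [:s:]\<^sup>2)"
    unfolding x by (simp add: power2_eq_square)
  then have "to_fract [:x:] = to_fract [:b:] * (to_fract [:r:])\<^sup>2 +
    to_fract [:a:] * ((to_fract [:q:])\<^sup>2 - to_fract [:b:] * (to_fract [:s:])\<^sup>2)"
    by (simp only: power2_eq_square to_fract_mult to_fract_add to_fract_diff)
  then show ?thesis by (rule pure_valuesI)
qed

text \<open>Cancelling the common power of the linear factor at \<open>c\<close> is what keeps a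
  vector nontrivial under evaluation at \<open>c\<close>.\<close>

lemma primitive_at:
  fixes f1 f2 f3 f4 :: "'a::field poly"
  assumes "f1 \<noteq> 0"
  shows "\<exists>g g1 g2 g3 g4. g \<noteq> 0 \<and> f1 = g * g1 \<and> f2 = g * g2 \<and> f3 = g * g3 \<and> f4 = g * g4 \<and>
    (poly g1 c \<noteq> 0 \<or> poly g2 c \<noteq> 0 \<or> poly g3 c \<noteq> 0 \<or> poly g4 c \<noteq> 0)"
  using assms
proof (induction "degree f1" arbitrary: f1 f2 f3 f4 rule: less_induct)
  case less
  show ?case
  proof (cases "poly f1 c \<noteq> 0 \<or> poly f2 c \<noteq> 0 \<or> poly f3 c \<noteq> 0 \<or> poly f4 c \<noteq> 0")
    case True
    moreover have "f1 = 1 * f1" "f2 = 1 * f2" "f3 = 1 * f3" "f4 = 1 * f4" by simp_all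
    ultimately show ?thesis using one_neq_zero by blast
  next
    case False
    then obtain h1 h2 h3 h4 where h: "f1 = [:- c, 1:] * h1" "f2 = [:- c, 1:] * h2"
      "f3 = [:- c, 1:] * h3" "f4 = [:- c, 1:] * h4"
      by (auto simp: poly_eq_0_iff_dvd elim!: dvdE)
    have "h1 \<noteq> 0" using h less.prems by auto
    moreover from this have "degree h1 < degree f1" unfolding h by (subst degree_mult_eq) auto
    ultimately obtain g g1 g2 g3 g4 where *: "g \<noteq> 0" "h1 = g * g1" "h2 = g * g2" "h3 = g * g3" "h4 = g * g4"
      "poly g1 c \<noteq> 0 \<or> poly g2 c \<noteq> 0 \<or> poly g3 c \<noteq> 0 \<or> poly g4 c \<noteq> 0"
      using less.hyps[of h1 h2 h3 h4] by blast
    have "[:- c, 1:] * g \<noteq> 0" using *(1) by (intro no_zero_divisors) auto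
    moreover have "f1 = [:- c, 1:] * g * g1" "f2 = [:- c, 1:] * g * g2"
      "f3 = [:- c, 1:] * g * g3" "f4 = [:- c, 1:] * g * g4"
      unfolding h using *(2-5) by (simp_all only: mult.assoc)
    ultimately show ?thesis using *(6) by blast
  qed
qed

text \<open>The denominator of the coordinates may vanish at \<open>c\<close>. It is therefore kept
  as a further coordinate \<open>h\<close>, and \<open>primitive_at\<close> ensures that the four
  coordinates do not all vanish there.\<close>

lemma pure_values_specialize:
  fixes A B Y E :: "'a::field poly"
  assumes "to_fract Y / to_fract E \<in> pure_values (to_fract A / to_fract E) (to_fract B / to_fract E)"
    and "poly E c \<noteq> 0"
  defines "val \<equiv> \<lambda>P. poly P c / poly E c"
  shows "\<exists>h q r s. (h \<noteq> 0 \<or> q \<noteq> 0 \<or> r \<noteq> 0 \<or> s \<noteq> 0) \<and>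
    val Y * h\<^sup>2 = val B * r\<^sup>2 + val A * (q\<^sup>2 - val B * s\<^sup>2)"
proof -
  have E: "E \<noteq> 0" using assms(2) by auto
  obtain q r s where eq: "to_fract Y / to_fract E = to_fract B / to_fract E * r\<^sup>2 +
    to_fract A / to_fract E * (q\<^sup>2 - to_fract B / to_fract E * s\<^sup>2)"
    using assms(1) unfolding pure_values_def by blast
  obtain q1 q2 where q: "q2 \<noteq> 0" "q = to_fract q1 / to_fract q2"
    by (cases q rule: Fract_cases) (auto simp: Fract_conv_to_fract)
  obtain r1 r2 where r: "r2 \<noteq> 0" "r = to_fract r1 / to_fract r2"
    by (cases r rule: Fract_cases) (auto simp: Fract_conv_to_fract)
  obtain s1 s2 where s: "s2 \<noteq> 0" "s = to_fract s1 / to_fract s2"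
    by (cases s rule: Fract_cases) (auto simp: Fract_conv_to_fract)
  define H where "H = q2 * r2 * s2"
  define Q where "Q = q1 * r2 * s2"
  define R where "R = r1 * q2 * s2"
  define S where "S = s1 * q2 * r2"
  have H: "H \<noteq> 0" using q r s by (simp add: H_def)
  have qrs: "q = to_fract Q / to_fract H" "r = to_fract R / to_fract H" "s = to_fract S / to_fract H"
    using q r s by (simp_all add: Q_def R_def S_def H_def)
  have "to_fract (Y * E * H\<^sup>2) = to_fract (B * E * R\<^sup>2 + A * (E * Q\<^sup>2 - B * S\<^sup>2))"
    using eq E H unfolding qrs by (simp add: power2_eq_square field_simps)
  then have poly_eq: "Y * E * H\<^sup>2 = B * E * R\<^sup>2 + A * (E * Q\<^sup>2 - B * S\<^sup>2)" by (simp only: to_fract_eq_iff)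
  obtain g h' q' r' s' where g: "g \<noteq> 0" "H = g * h'" "Q = g * q'" "R = g * r'" "S = g * s'"
    "poly h' c \<noteq> 0 \<or> poly q' c \<noteq> 0 \<or> poly r' c \<noteq> 0 \<or> poly s' c \<noteq> 0"
    using primitive_at[OF H] by metis
  have "g\<^sup>2 * (Y * E * h'\<^sup>2) = g\<^sup>2 * (B * E * r'\<^sup>2 + A * (E * q'\<^sup>2 - B * s'\<^sup>2))"
    using poly_eq unfolding g by (simp add: power_mult_distrib algebra_simps)
  then have "Y * E * h'\<^sup>2 = B * E * r'\<^sup>2 + A * (E * q'\<^sup>2 - B * s'\<^sup>2)" using g(1) by simp
  from arg_cong[OF this, of "\<lambda>p. poly p c"]
  have "val Y * (poly h' c)\<^sup>2 = val B * (poly r' c)\<^sup>2 + val A * ((poly q' c)\<^sup>2 - val B * (poly s' c)\<^sup>2)"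
    using assms(2) unfolding val_def by (simp add: power2_eq_square field_simps)
  then show ?thesis using g(6) by blast
qed

text \<open>Everywhere unramified over the affine line means constant, so splitting at the point 0
  forces splitting at the point 1.\<close>

theorem pfister_isotropic_specialize:
  fixes i :: "'a::field" and A D E :: "'a poly"
  defines "a \<equiv> to_fract A / to_fract E" and "d \<equiv> to_fract D / to_fract E"
  assumes two: "(2::'a) \<noteq> 0" and i: "i\<^sup>2 = - 1"
    and d: "d = u1\<^sup>2 - a * w1\<^sup>2" and e: "(d - 1) * (d - a) = u2\<^sup>2 - a * w2\<^sup>2"
    and nz: "d \<noteq> 0" "d \<noteq> a"
    and at0: "poly E 0 \<noteq> 0" "poly A 0 = t\<^sup>2 * poly E 0" "t \<noteq> 0" "poly D 0 \<noteq> poly E 0"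
    and at1: "poly E 1 \<noteq> 0" "poly A 1 \<noteq> 0" "poly D 1 \<noteq> poly E 1"
  shows "pfister_isotropic (poly A 1 / poly E 1) (poly D 1 / poly E 1 - 1)"
proof -
  have EA: "E \<noteq> 0" "A \<noteq> 0" "D - E \<noteq> 0" using at1 by auto
  have d1: "d - 1 = to_fract (D - E) / to_fract E" using EA by (simp add: d_def diff_divide_distrib)
  have a0: "a \<noteq> 0" "d - 1 \<noteq> 0" unfolding d1 using EA by (simp_all add: a_def del: to_fract_diff)
  have i': "(to_fract [:i:])\<^sup>2 = - 1"
  proof -
    have "[:i:]\<^sup>2 = - 1" using i by (simp add: power2_eq_square one_pCons)
    from arg_cong[OF this, of to_fract] show ?thesis
      by (simp only: power2_eq_square to_fract_mult to_fract_uminus to_fract_1)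
  qed
  have "\<exists>\<alpha> \<beta>. \<alpha> \<noteq> 0 \<and> \<beta> \<noteq> 0 \<and> pure_values a (d - 1) = pure_values (to_fract [:\<alpha>:]) (to_fract [:\<beta>:])"
  proof (rule unramified_pure_values_constant[OF two a0])
    fix \<pi> :: "'a poly" assume "irreducible \<pi>"
    then interpret int_valuation "fval \<pi>" by (rule int_valuation_fval)
    show "\<not> ramified a (d - 1)"
      using a0 by (intro unramified_if_relations[OF i' a0(1) nz(1) _ nz(2) d e]) auto
  qed
  then obtain \<alpha> \<beta> where \<alpha>\<beta>: "\<alpha> \<noteq> 0" "\<beta> \<noteq> 0"
    and pv: "pure_values a (d - 1) = pure_values (to_fract [:\<alpha>:]) (to_fract [:\<beta>:])" by blast
  \<comment> \<open>The entry \<open>a\<close> is itself a pure value of the constant algebra. Its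
    value at 0 is the square t^2, which yields an isotropic vector for the constants.\<close>
  have "a \<in> pure_values (to_fract [:\<alpha>:]) (to_fract [:\<beta>:])"
    using pure_values_generators(1)[of a "d - 1"] unfolding pv .
  moreover have "to_fract [:\<alpha>:] = to_fract ([:\<alpha>:] * E) / to_fract E"
    "to_fract [:\<beta>:] = to_fract ([:\<beta>:] * E) / to_fract E" using EA by (simp_all only: to_fract_mult) auto
  ultimately have "to_fract A / to_fract E \<in> pure_values (to_fract ([:\<alpha>:] * E) / to_fract E)
    (to_fract ([:\<beta>:] * E) / to_fract E)" unfolding a_def by metis
  from pure_values_specialize[OF this at0(1)] obtain h q r s
    where hqrs: "h \<noteq> 0 \<or> q \<noteq> 0 \<or> r \<noteq> 0 \<or> s \<noteq> 0" "t\<^sup>2 * h\<^sup>2 = \<beta> * r\<^sup>2 + \<alpha> * (q\<^sup>2 - \<beta> * s\<^sup>2)"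
    using at0 by auto
  have "pfister_isotropic \<alpha> \<beta>"
    by (rule pfister_isotropicI[of "t * h" q r s]) (use hqrs at0(3) in \<open>auto simp: power_mult_distrib\<close>)
  then have "to_fract [:1:] \<in> pure_values (to_fract [:\<alpha>:]) (to_fract [:\<beta>:])"
    by (intro pure_values_to_fract_const pfister_isotropic_imp_one two \<alpha>\<beta>)
  \<comment> \<open>The value 1 is written as E / E to share the denominator of the entries, as
    specialization requires.\<close>
  then have "to_fract E / to_fract E \<in> pure_values (to_fract A / to_fract E) (to_fract (D - E) / to_fract E)"
    using EA pv unfolding d1 a_def by (simp flip: one_pCons)
  from pure_values_specialize[OF this at1(1)] obtain h q r s
    where hqrs: "h \<noteq> 0 \<or> q \<noteq> 0 \<or> r \<noteq> 0 \<or> s \<noteq> 0"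
      "h\<^sup>2 = (poly D 1 / poly E 1 - 1) * r\<^sup>2 + poly A 1 / poly E 1 * (q\<^sup>2 - (poly D 1 / poly E 1 - 1) * s\<^sup>2)"
    using at1(1) by (auto simp: diff_divide_distrib)
  then show ?thesis by (rule pfister_isotropicI)
qed

section \<open>Involutions of rational function fields and norms\<close>

locale rhom =
  fixes h :: "'a::comm_ring_1 \<Rightarrow> 'b::comm_ring_1"
  assumes one [simp]: "h 1 = 1"
    and add: "h (x + y) = h x + h y"
    and mult: "h (x * y) = h x * h y"
begin

lemma zero [simp]: "h 0 = 0"
  using add[of 0 0] by simp

lemma uminus: "h (- x) = - h x"
  using add[of x "- x"] by (simp add: eq_neg_iff_add_eq_0 add.commute)

lemma diff: "h (x - y) = h x - h y"
  using add[of x "- y"] uminus by simp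

lemma power: "h (x ^ n) = h x ^ n"
  by (induction n) (simp_all add: mult)

lemma sum: "h (sum f A) = sum (\<lambda>x. h (f x)) A"
  by (induction A rule: infinite_finite_induct) (simp_all add: add)

end

lemma rhom_comp: "rhom f \<Longrightarrow> rhom g \<Longrightarrow> rhom (\<lambda>x. f (g x))"
  by (simp add: rhom_def)

lemma rhom_id: "rhom (\<lambda>x. x)"
  by (simp add: rhom_def)

lemma rhom_to_fract: "rhom to_fract"
  by (simp add: rhom_def)

lemma rhom_const_poly: "rhom (\<lambda>c. [:c:])"
  by (simp add: rhom_def one_pCons)

lemma rhom_field_nz:
  fixes h :: "'a::field \<Rightarrow> 'b::field"
  assumes "rhom h" "x \<noteq> 0" shows "h x \<noteq> 0"
proof
  interpret rhom h by fact
  assume "h x = 0"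
  then have "h (x * inverse x) = 0" by (simp only: mult) simp
  then show False using assms(2) by simp
qed

lemma rhom_field_divide:
  fixes h :: "'a::field \<Rightarrow> 'b::field"
  assumes "rhom h" shows "h (x / y) = h x / h y"
proof (cases "y = 0")
  case True
  interpret rhom h by fact
  show ?thesis using True by simp
next
  case False
  interpret rhom h by fact
  have "h (x / y) * h y = h x" using False by (simp flip: mult)
  then show ?thesis using rhom_field_nz[OF assms False] by (simp add: field_simps)
qed

lemma map_poly_rhom_add: "rhom h \<Longrightarrow> map_poly h (p + q) = map_poly h p + map_poly h q"
  by (rule poly_eqI) (simp add: coeff_map_poly rhom.zero rhom.add)

lemma map_poly_rhom_mult:
  assumes "rhom h" shows "map_poly h (p * q) = map_poly h p * map_poly h q"
proof -
  interpret rhom h by fact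
  show ?thesis by (rule poly_eqI) (simp add: coeff_map_poly coeff_mult sum mult)
qed

lemma rhom_map_poly: "rhom h \<Longrightarrow> rhom (map_poly h)"
  by (simp add: rhom_def[of "map_poly h"] map_poly_rhom_add map_poly_rhom_mult rhom.one rhom.zero)

lemma rhom_poly: "rhom (\<lambda>p. poly p w)"
  by (simp add: rhom_def)

lemma rhom_poly_map_poly: "rhom h \<Longrightarrow> rhom (\<lambda>p. poly (map_poly h p) w)"
  using rhom_comp[OF rhom_poly rhom_map_poly] .

lemma rhom_poly_eqI:
  assumes "rhom f" "rhom g" "\<And>c. f [:c:] = g [:c:]" "f [:0, 1:] = g [:0, 1:]"
  shows "f p = g p"
proof (induction p)
  case (pCons a p)
  interpret f: rhom f by fact
  interpret g: rhom g by fact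
  have "pCons a p = [:a:] + [:0, 1:] * p" by simp
  then show ?case using pCons assms by (metis f.add f.mult g.add g.mult)
qed (simp add: assms rhom.zero)

definition fract_lift :: "('a::idom \<Rightarrow> 'b::field) \<Rightarrow> 'a fract \<Rightarrow> 'b" where
  "fract_lift h z = (SOME w. \<exists>p q. q \<noteq> 0 \<and> z = Fract p q \<and> w = h p / h q)"

lemma fract_lift_Fract:
  assumes "rhom h" and nz: "\<And>p. p \<noteq> 0 \<Longrightarrow> h p \<noteq> 0" and "q \<noteq> 0"
  shows "fract_lift h (Fract p q) = h p / h q"
  unfolding fract_lift_def
proof (rule some_equality)
  interpret rhom h by fact
  fix w assume "\<exists>p' q'. q' \<noteq> 0 \<and> Fract p q = Fract p' q' \<and> w = h p' / h q'"
  then obtain p' q' where *: "q' \<noteq> 0" "Fract p q = Fract p' q'" "w = h p' / h q'" by blast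
  then have "h p * h q' = h p' * h q" using assms(3) by (simp add: eq_fract flip: mult)
  then show "w = h p / h q" using *(3) nz[OF *(1)] nz[OF assms(3)] by (simp add: frac_eq_eq)
qed (use assms(3) in blast)

lemma fract_lift_to_fract:
  assumes "rhom h" "\<And>p. p \<noteq> 0 \<Longrightarrow> h p \<noteq> 0"
  shows "fract_lift h (to_fract p) = h p"
  using fract_lift_Fract[OF assms, of 1 p] assms(1) by (simp add: to_fract_def rhom.one)

lemma rhom_fract_lift:
  assumes "rhom h" and nz: "\<And>p. p \<noteq> 0 \<Longrightarrow> h p \<noteq> 0"
  shows "rhom (fract_lift h)"
proof
  interpret rhom h by fact
  note lift = fract_lift_Fract[OF assms]
  show "fract_lift h 1 = 1" by (simp add: One_fract_def lift)
  fix x y :: "'a fract"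
  obtain p q where x: "q \<noteq> 0" "x = Fract p q" by (cases x rule: Fract_cases)
  obtain r s where y: "s \<noteq> 0" "y = Fract r s" by (cases y rule: Fract_cases)
  show "fract_lift h (x * y) = fract_lift h x * fract_lift h y"
    using x y by (simp add: lift mult)
  show "fract_lift h (x + y) = fract_lift h x + fract_lift h y"
    using x y nz[OF x(1)] nz[OF y(1)] by (simp add: lift mult add add_frac_eq)
qed

lemma fract_cases_to_fract:
  fixes z :: "'a::idom fract"
  obtains p q where "q \<noteq> 0" "z = to_fract p / to_fract q"
  by (cases z rule: Fract_cases) (auto simp: Fract_conv_to_fract)

lemma rhom_fract_eqI:
  fixes f g :: "'a::idom fract \<Rightarrow> 'b::field"
  assumes "rhom f" "rhom g" "\<And>p. f (to_fract p) = g (to_fract p)"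
  shows "f z = g z"
proof -
  obtain p q where z: "z = to_fract p / to_fract q" by (rule fract_cases_to_fract)
  show ?thesis unfolding z rhom_field_divide[OF assms(1)] rhom_field_divide[OF assms(2)] by (simp add: assms(3))
qed

definition cfract :: "'a::field \<Rightarrow> 'a poly fract" where
  "cfract c = to_fract [:c:]"

definition xfract :: "'a::field poly fract" where
  "xfract = to_fract [:0, 1:]"

lemma rhom_cfract: "rhom cfract"
  unfolding cfract_def by (rule rhom_comp[OF rhom_to_fract rhom_const_poly])

interpretation cfract: rhom cfract by (rule rhom_cfract)

lemma cfract_eq_iff [simp]: "cfract x = cfract y \<longleftrightarrow> x = y"
  by (simp add: cfract_def)

lemma cfract_eq_0_iff [simp]: "cfract x = 0 \<longleftrightarrow> x = 0"
  by (simp add: cfract_def)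

lemma xfract_nz [simp]: "xfract \<noteq> 0"
  by (simp add: xfract_def)

lemma rhom_cpoly_fract_eqI:
  fixes f g :: "'a::field poly fract \<Rightarrow> 'b::field"
  assumes f: "rhom f" and g: "rhom g" and "\<And>c. f (cfract c) = g (cfract c)" "f xfract = g xfract"
  shows "f z = g z"
proof (rule rhom_fract_eqI[OF f g])
  fix p
  show "f (to_fract p) = g (to_fract p)"
    by (rule rhom_poly_eqI[of "\<lambda>p. f (to_fract p)" "\<lambda>p. g (to_fract p)"])
      (use assms rhom_comp[OF f rhom_to_fract] rhom_comp[OF g rhom_to_fract] in
        \<open>simp_all add: cfract_def xfract_def\<close>)
qed

definition extend_poly :: "('a::field \<Rightarrow> 'a) \<Rightarrow> 'a poly fract \<Rightarrow> 'a poly \<Rightarrow> 'a poly fract" where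
  "extend_poly s w p = poly (map_poly (\<lambda>c. cfract (s c)) p) w"

definition extend_fract :: "('a::field \<Rightarrow> 'a) \<Rightarrow> 'a poly fract \<Rightarrow> 'a poly fract \<Rightarrow> 'a poly fract" where
  "extend_fract s w = fract_lift (extend_poly s w)"

text \<open>Moves a factor \<open>e\<close> of the substituted element into the polynomial, see
  \<open>extend_poly_scale\<close>; what remains to be substituted is the variable or its
  inverse.\<close>

definition scale :: "('a::field \<Rightarrow> 'a) \<Rightarrow> 'a \<Rightarrow> 'a poly \<Rightarrow> 'a poly" where
  "scale s e p = pcompose (map_poly s p) [:0, e:]"

lemma poly_map_poly_cfract: "poly (map_poly cfract p) xfract = to_fract p"
proof (induction p)
  case (pCons a p)
  have "to_fract (pCons a p) = to_fract [:a:] + to_fract [:0, 1:] * to_fract p"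
    by (simp flip: to_fract_mult to_fract_add)
  then show ?case using pCons by (simp add: map_poly_pCons cfract_def xfract_def)
qed simp

locale fract_endo = rhom s for s :: "'a::field \<Rightarrow> 'a"
begin

lemma nz: "x \<noteq> 0 \<Longrightarrow> s x \<noteq> 0"
  by (rule rhom_field_nz[OF rhom_axioms])

lemma eq_0_iff: "s x = 0 \<longleftrightarrow> x = 0"
  using nz[of x] zero by metis

lemma rhom_cs: "rhom (\<lambda>c. cfract (s c))"
  by (rule rhom_comp[OF rhom_cfract rhom_axioms])

lemma rhom_extend_poly: "rhom (extend_poly s w)"
  unfolding extend_poly_def by (rule rhom_poly_map_poly[OF rhom_cs])

lemma extend_poly_scale: "extend_poly s (cfract e * w) p = poly (map_poly cfract (scale s e p)) w"
  unfolding extend_poly_def scale_def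
proof (induction p)
  case (pCons a p)
  then show ?case
    by (simp add: map_poly_pCons pcompose_pCons map_poly_rhom_add[OF rhom_cfract]
        map_poly_rhom_mult[OF rhom_cfract] map_poly_smult cfract.mult algebra_simps)
qed simp

lemma degree_map_s: "degree (map_poly s p) = degree p"
  by (cases "p = 0") (simp_all add: map_poly_degree_eq nz)

lemma map_s_nz: "p \<noteq> 0 \<Longrightarrow> map_poly s p \<noteq> 0"
  by (simp add: map_poly_eq_0_iff eq_0_iff)

lemma scale_nz: "e \<noteq> 0 \<Longrightarrow> p \<noteq> 0 \<Longrightarrow> scale s e p \<noteq> 0"
  unfolding scale_def using map_s_nz pcompose_eq_0[of "map_poly s p" "[:0, e:]"] by auto

lemma degree_scale: "e \<noteq> 0 \<Longrightarrow> degree (scale s e p) = degree p"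
  unfolding scale_def by (simp add: degree_pcompose degree_map_s)

lemma coeff_0_scale: "coeff (scale s e p) 0 = s (coeff p 0)"
  unfolding scale_def by (simp add: pcompose_coeff_0 coeff_map_poly poly_0_coeff_0)

lemma extend_poly_linear_nz:
  assumes "e \<noteq> 0" "p \<noteq> 0" shows "extend_poly s (cfract e * xfract) p \<noteq> 0"
  unfolding extend_poly_scale poly_map_poly_cfract using scale_nz[OF assms] by simp

lemma reflect_map_poly_cfract: "reflect_poly (map_poly cfract p) = map_poly cfract (reflect_poly p)"
  by (rule poly_eqI) (simp add: coeff_map_poly coeff_reflect_poly degree_map_poly)

text \<open>Substituting e / y is, up to the power of y that clears denominators, a rescaling
  followed by reversal of the coefficients. Hence it kills no nonzero polynomial, and the reversal
  is the polynomial \<open>R\<close> of the norm descent.\<close>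

lemma extend_poly_reciprocal:
  assumes "e \<noteq> 0"
  shows "xfract ^ degree p * extend_poly s (cfract e / xfract) p = to_fract (reflect_poly (scale s e p))"
proof -
  have "xfract ^ degree p * extend_poly s (cfract e * inverse xfract) p
    = xfract ^ degree (map_poly cfract (scale s e p)) * poly (map_poly cfract (scale s e p)) (inverse xfract)"
    unfolding extend_poly_scale by (simp add: degree_map_poly degree_scale[OF assms])
  also have "\<dots> = poly (reflect_poly (map_poly cfract (scale s e p))) xfract"
    by (rule poly_reflect_poly_nz[symmetric]) simp
  also have "\<dots> = to_fract (reflect_poly (scale s e p))"
    by (simp add: reflect_map_poly_cfract poly_map_poly_cfract)
  finally show ?thesis by (simp add: divide_inverse)
qed

lemma extend_poly_reciprocal_nz:
  assumes "e \<noteq> 0" "p \<noteq> 0" shows "extend_poly s (cfract e / xfract) p \<noteq> 0"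
  using extend_poly_reciprocal[OF assms(1), of p] scale_nz[OF assms] by auto

lemma extend_facts:
  assumes "\<And>p. p \<noteq> 0 \<Longrightarrow> extend_poly s w p \<noteq> 0"
  shows "rhom (extend_fract s w)" "extend_fract s w (to_fract p) = extend_poly s w p"
    "extend_fract s w (cfract c) = cfract (s c)" "extend_fract s w xfract = w"
proof -
  show "rhom (extend_fract s w)" unfolding extend_fract_def by (rule rhom_fract_lift[OF rhom_extend_poly assms])
  show *: "extend_fract s w (to_fract p) = extend_poly s w p" for p
    unfolding extend_fract_def by (rule fract_lift_to_fract[OF rhom_extend_poly assms])
  show "extend_fract s w (cfract c) = cfract (s c)"
    unfolding cfract_def[of c] * extend_poly_def by (simp add: map_poly_pCons)
  show "extend_fract s w xfract = w"
    unfolding xfract_def * extend_poly_def by (simp add: map_poly_pCons)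
qed

lemma extend_involution:
  assumes "\<And>p. p \<noteq> 0 \<Longrightarrow> extend_poly s w p \<noteq> 0" "\<And>c. s (s c) = c" "extend_fract s w w = xfract"
  shows "extend_fract s w (extend_fract s w z) = z"
  by (rule rhom_cpoly_fract_eqI[OF rhom_comp rhom_id])
    (use extend_facts[OF assms(1)] assms(2,3) in simp_all)

end

text \<open>One level of the tower: an involution \<open>s\<close> of the base, extended by y -> e /
  y. As \<open>e\<close> is fixed, the extension is again an involution, and \<open>e\<close> is the
  norm of the new variable. It is used for y with e = d and for z with e = (d - 1)(d - a).\<close>

locale fract_invol = fract_endo s for s :: "'a::field \<Rightarrow> 'a" +
  fixes e :: 'a
  assumes invol: "s (s x) = x" and e: "e \<noteq> 0" "s e = e"
begin

definition S :: "'a poly fract \<Rightarrow> 'a poly fract" where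
  "S = extend_fract s (cfract e / xfract)"

lemma S_facts:
  shows "rhom S" and "S (to_fract p) = extend_poly s (cfract e / xfract) p"
    and "S (cfract c) = cfract (s c)" and "S xfract = cfract e / xfract"
  unfolding S_def by (rule extend_facts, erule extend_poly_reciprocal_nz[OF e(1)])+

lemma S_involution: "S (S z) = z"
proof -
  have "S (cfract e / xfract) = xfract" by (simp add: rhom_field_divide[OF S_facts(1)] S_facts e)
  then show ?thesis
    unfolding S_def by (intro extend_involution extend_poly_reciprocal_nz[OF e(1)] invol)
qed

definition R :: "'a poly \<Rightarrow> 'a poly" where
  "R p = reflect_poly (scale s e p)"

lemma S_R: "xfract ^ degree p * S (to_fract p) = to_fract (R p)"
  unfolding R_def S_facts(2) by (rule extend_poly_reciprocal[OF e(1)])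

lemma R_coeff_0: "p \<noteq> 0 \<Longrightarrow> coeff (R p) 0 \<noteq> 0"
  unfolding R_def using scale_nz[OF e(1)] by simp

lemma R_nz: "p \<noteq> 0 \<Longrightarrow> R p \<noteq> 0"
  using R_coeff_0 by fastforce

lemma degree_R: "coeff p 0 \<noteq> 0 \<Longrightarrow> degree (R p) = degree p"
  unfolding R_def using nz by (simp add: coeff_0_scale degree_scale[OF e(1)])

text \<open>If P and Q are coprime and prime to the variable y, and P S(P) = b Q S(Q), then P divides
  the reversal of Q and has the same degree, so S(Q) is P up to a constant and a power of y.\<close>

lemma norm_coprime:
  assumes nz': "coeff P 0 \<noteq> 0" "coeff Q 0 \<noteq> 0" and cop: "u * P + v * Q = 1" and b: "b \<noteq> 0"
    and eq: "to_fract P * S (to_fract P) = cfract b * (to_fract Q * S (to_fract Q))"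
  shows "\<exists>c n. c \<noteq> 0 \<and> b * (c * s c) = e ^ n"
proof -
  let ?x = "[:0, 1::'a:]"
  have PQ: "P \<noteq> 0" "Q \<noteq> 0" using nz' by auto
  \<comment> \<open>The power deg P + deg Q of the variable turns both conjugates into reversals,
    hence the norm equation into a polynomial identity.\<close>
  have "to_fract (?x ^ degree Q * (P * R P)) = to_fract ([:b:] * (?x ^ degree P * (Q * R Q)))"
  proof -
    have "to_fract (?x ^ degree Q * (P * R P)) = xfract ^ degree Q * (to_fract P * to_fract (R P))"
      by (simp add: xfract_def rhom.power[OF rhom_to_fract] del: mult_pCons_left)
    also have "\<dots> = xfract ^ degree Q * xfract ^ degree P * (to_fract P * S (to_fract P))"
      by (simp flip: S_R)
    also have "\<dots> = cfract b * (xfract ^ degree P * (to_fract Q * (xfract ^ degree Q * S (to_fract Q))))"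
      unfolding eq by simp
    also have "\<dots> = to_fract ([:b:] * (?x ^ degree P * (Q * R Q)))"
      unfolding S_R
      by (simp add: xfract_def cfract_def rhom.power[OF rhom_to_fract] del: mult_pCons_left)
    finally show ?thesis .
  qed
  then have main: "?x ^ degree Q * (P * R P) = [:b:] * (?x ^ degree P * (Q * R Q))"
    by (simp only: to_fract_eq_iff)
  have c1: "coeff (P * R P) 0 \<noteq> 0" "coeff ([:b:] * (Q * R Q)) 0 \<noteq> 0"
    using nz' R_coeff_0 PQ b by (simp_all add: coeff_mult_0)
  have xpow: "?x ^ k = monom 1 k" for k by (simp add: monom_altdef)
  have "monom 1 (degree Q) * (P * R P) = monom 1 (degree P) * ([:b:] * (Q * R Q))"
    using main by (simp only: xpow mult.left_commute)
  then have m: "coeff (monom 1 (degree Q) * (P * R P)) k = coeff (monom 1 (degree P) * ([:b:] * (Q * R Q))) k" for k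
    by (rule arg_cong)
  \<comment> \<open>P R(P) and b Q R(Q) have nonzero constant terms, so the lowest terms of the two
    sides sit in degrees deg Q and deg P.\<close>
  have deg: "degree P = degree Q"
    using m[of "degree Q"] m[of "degree P"] c1 unfolding coeff_monom_mult
    by (cases "degree P" "degree Q" rule: linorder_cases) auto
  have "?x ^ degree Q * (P * R P) = ?x ^ degree Q * ([:b:] * (Q * R Q))"
    using main unfolding deg by (simp only: mult.left_commute)
  then have eq2: "P * R P = [:b:] * (Q * R Q)" by (rule mult_left_cancel[THEN iffD1, rotated]) simp
  have "P dvd R Q"
  proof -
    have "R Q = (u * P + v * Q) * R Q" using cop by simp
    also have "\<dots> = P * (u * R Q) + v * (Q * R Q)" by (simp add: algebra_simps)
    also have "Q * R Q = P * ([:1 / b:] * R P)"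
    proof -
      have "[:1 / b:] * [:b:] = 1" using b by (simp add: one_pCons)
      then have "Q * R Q = [:1 / b:] * ([:b:] * (Q * R Q))" by (metis mult.assoc mult_1)
      then show ?thesis unfolding eq2[symmetric] by (simp only: mult.left_commute)
    qed
    finally show ?thesis by (metis dvd_add dvd_mult dvd_triv_left)
  qed
  then obtain t where t: "R Q = P * t" by auto
  have "t \<noteq> 0" using t R_nz[OF PQ(2)] by fastforce
  moreover have "degree (R Q) = degree P" using degree_R[OF nz'(2)] deg by simp
  ultimately have "degree t = 0" using degree_mult_eq[OF PQ(1), of t] unfolding t by linarith
  then obtain c where c: "t = [:c:]" by (meson degree_eq_zeroE)
  have cnz: "c \<noteq> 0" using \<open>t \<noteq> 0\<close> c by simp
  define n where "n = degree Q"
  have SQ: "xfract ^ n * S (to_fract Q) = to_fract P * cfract c"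
    unfolding n_def S_R t c by (simp add: cfract_def del: mult_pCons_left mult_pCons_right)
  interpret S: rhom S by (rule S_facts(1))
  \<comment> \<open>Conjugating the formula for S(Q) expresses Q through S(P). Multiplying both
    formulas gives back the norm equation with the extra factors \<open>c * s c\<close> and
    e^n.\<close>
  have "S (xfract ^ n * S (to_fract Q)) = S (to_fract P) * cfract (s c)"
    unfolding SQ by (simp only: S.mult S_facts)
  then have *: "S xfract ^ n * to_fract Q = S (to_fract P) * cfract (s c)"
    by (simp only: S.mult S.power S_involution)
  have **: "xfract ^ n * S xfract ^ n = cfract (e ^ n)"
    by (simp add: S_facts cfract.power power_divide)
  have SP: "cfract (e ^ n) * to_fract Q = xfract ^ n * S (to_fract P) * cfract (s c)"
    by (simp only: **[symmetric] mult.assoc *)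
  have QS: "to_fract Q * S (to_fract Q) \<noteq> 0"
    using PQ rhom_field_nz[OF S_facts(1), of "to_fract Q"] by simp
  have "cfract (e ^ n) * (to_fract Q * S (to_fract Q)) = S (to_fract P) * cfract (s c) * (xfract ^ n * S (to_fract Q))"
    using SP by (simp add: mult_ac)
  also have "\<dots> = cfract (c * s c) * (to_fract P * S (to_fract P))"
    unfolding SQ by (simp add: cfract.mult mult_ac)
  also have "\<dots> = cfract (b * (c * s c)) * (to_fract Q * S (to_fract Q))"
    unfolding eq by (simp add: cfract.mult mult_ac)
  finally have "e ^ n = b * (c * s c)" using QS by simp
  then show ?thesis using cnz by metis
qed

lemma split_off_x:
  fixes p :: "'a poly"
  assumes "p \<noteq> 0" shows "\<exists>k q. p = [:0, 1:] ^ k * q \<and> coeff q 0 \<noteq> 0"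
proof -
  have "irreducible [:0, 1::'a:]" by (rule irreducible_linear_field_poly) simp
  from poly_split_off[OF this assms] obtain k q where "p = [:0, 1:] ^ k * q" "\<not> [:0, 1:] dvd q" by blast
  moreover from this have "coeff q 0 \<noteq> 0" using poly_eq_0_iff_dvd[of q 0] by (simp add: poly_0_coeff_0)
  ultimately show ?thesis by blast
qed

text \<open>Powers of the variable have powers of \<open>e\<close> as norms, and the coprime rest
  falls under \<open>norm_coprime\<close>; so \<open>b\<close> is a norm from the base times a power
  of \<open>e\<close>. Even powers of \<open>e\<close> are norms because \<open>s\<close> fixes
  \<open>e\<close>, which leaves two cases.\<close>

theorem norm_descent:
  assumes b: "b \<noteq> 0" and w: "w * S w = cfract b"
  shows "\<exists>c. c \<noteq> 0 \<and> (b = c * s c \<or> b * e = c * s c)"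
proof -
  interpret S: rhom S by (rule S_facts(1))
  have "w \<noteq> 0" using w b by auto
  then obtain p q where pq: "p \<noteq> 0" "q \<noteq> 0" "w = to_fract p / to_fract q"
    using nonzero_Fract[of w] by (metis Fract_conv_to_fract)
  obtain i p' where p': "p = [:0, 1:] ^ i * p'" "coeff p' 0 \<noteq> 0" using split_off_x[OF pq(1)] by blast
  obtain j q' where q': "q = [:0, 1:] ^ j * q'" "coeff q' 0 \<noteq> 0" using split_off_x[OF pq(2)] by blast
  have "p' \<noteq> 0" using p' by auto
  then obtain g u v where g: "g = u * p' + v * q'" "g dvd p'" "g dvd q'" using poly_gcd_bezout by blast
  obtain P Q where PQ: "p' = g * P" "q' = g * Q" using g(2,3) unfolding dvd_def by blast
  have gnz: "g \<noteq> 0" using PQ(1) \<open>p' \<noteq> 0\<close> by (metis mult_zero_left)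
  have "g * (u * P + v * Q) = g * 1" using g(1) unfolding PQ by (simp add: algebra_simps)
  then have cop: "u * P + v * Q = 1" using gnz by simp
  have PQ0: "coeff P 0 \<noteq> 0" "coeff Q 0 \<noteq> 0" using p'(2) q'(2) unfolding PQ by (simp_all add: coeff_mult_0)
  then have PQnz: "to_fract P \<noteq> 0" "to_fract Q \<noteq> 0" by auto
  have weq: "w = xfract ^ i / xfract ^ j * (to_fract P / to_fract Q)"
    using gnz unfolding pq(3) p'(1) q'(1) PQ
    by (simp add: xfract_def rhom.power[OF rhom_to_fract] del: mult_pCons_left)
  have SPQ: "S (to_fract Q) \<noteq> 0" using PQnz rhom_field_nz[OF S_facts(1)] by blast
  have "S w = (cfract (e ^ i) / xfract ^ i) / (cfract (e ^ j) / xfract ^ j) * (S (to_fract P) / S (to_fract Q))"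
    unfolding weq by (simp add: S.mult rhom_field_divide[OF S_facts(1)] S.power S_facts(3,4) power_divide cfract.power mult_ac)
  then have "w * S w = cfract (e ^ i) / cfract (e ^ j) * (to_fract P * S (to_fract P) / (to_fract Q * S (to_fract Q)))"
    unfolding weq by (simp add: mult_ac)
  then have "cfract (e ^ i) * (to_fract P * S (to_fract P)) = cfract b * cfract (e ^ j) * (to_fract Q * S (to_fract Q))"
    unfolding w using PQnz SPQ e by (simp add: field_simps)
  then have "to_fract P * S (to_fract P) = cfract b * cfract (e ^ j) / cfract (e ^ i) * (to_fract Q * S (to_fract Q))"
    using e by (simp add: field_simps)
  also have "cfract b * cfract (e ^ j) / cfract (e ^ i) = cfract (b * e ^ j / e ^ i)"
    by (simp add: rhom_field_divide[OF rhom_cfract] cfract.mult)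
  finally obtain c n where c: "c \<noteq> 0" "b * e ^ j / e ^ i * (c * s c) = e ^ n"
    using norm_coprime[OF PQ0 cop, of "b * e ^ j / e ^ i"] b e(1) by auto
  \<comment> \<open>Absorbing e^j into \<open>c\<close> contributes e^(2j) to the norm, so all
    exponents stay nonnegative.\<close>
  define m where "m = n + i + j"
  have main: "b * (e ^ j * c) * s (e ^ j * c) = e ^ m"
    using c(2) e by (simp add: m_def power_add mult power field_simps)
  define c' where "c' = e ^ j * c"
  have c': "c' \<noteq> 0" "s c' \<noteq> 0" using c e nz[of "e ^ j * c"] by (simp_all add: c'_def)
  have dd: "s (x / c') = s x / s c'" for x by (rule rhom_field_divide[OF rhom_axioms])
  show ?thesis
  proof (cases "even m")
    case True
    then obtain l where "m = 2 * l" by auto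
    then have "b * c' * s c' = e ^ l * e ^ l" using main by (simp add: c'_def mult_2 power_add)
    then have "b = (e ^ l / c') * s (e ^ l / c')" using c' by (simp add: dd power e field_simps)
    then show ?thesis using c' e by (intro exI[of _ "e ^ l / c'"]) auto
  next
    case False
    then obtain l where "m = Suc (2 * l)" by (auto elim: oddE)
    then have "e ^ m * e = e ^ Suc l * e ^ Suc l" by (simp add: mult_2 power_add)
    then have "b * e * c' * s c' = e ^ Suc l * e ^ Suc l"
      using main[folded c'_def] by (metis mult.assoc mult.commute)
    then have "b * e = (e ^ Suc l / c') * s (e ^ Suc l / c')"
      using c' by (simp add: dd power e mult field_simps)
    then show ?thesis using c' e by (intro exI[of _ "e ^ Suc l / c'"]) auto
  qed
qed

end


text \<open>In the tower k(x), k(x, d), k(x, d, y), k(x, d, y, z) the letters x, y, z, d stand for the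
  paper's x1, x2, x3, x4: in this order each level is stable under the involution.\<close>

type_synonym 'c kx = "'c poly fract"
type_synonym 'c kxd = "'c kx poly fract"
type_synonym 'c kxdy = "'c kxd poly fract"
type_synonym 'c kxdyz = "'c kxdy poly fract"

section \<open>The tower over k(x), its involution, and an element that is not a norm\<close>

definition invol1 :: "'c::field kx \<Rightarrow> 'c kx" where
  "invol1 = extend_fract (\<lambda>c. c) (- xfract)"

definition invol2 :: "'c::field kxd \<Rightarrow> 'c kxd" where
  "invol2 = extend_fract invol1 xfract"

definition norm_y :: "'c::field kxd" where
  "norm_y = xfract"

definition norm_z :: "'c::field kxd" where
  "norm_z = (xfract - 1) * (xfract - (cfract xfract)\<^sup>2)"

definition invol3 :: "'c::field kxdy \<Rightarrow> 'c kxdy" where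
  "invol3 = extend_fract invol2 (cfract norm_y / xfract)"

definition invol :: "'c::field kxdyz \<Rightarrow> 'c kxdyz" where
  "invol = extend_fract invol3 (cfract (cfract norm_z) / xfract)"

lemma fract_endo_id: "fract_endo (\<lambda>c. c)"
  unfolding fract_endo_def by (rule rhom_id)

lemma invol1_facts:
  fixes z :: "'c::field kx"
  shows "rhom (invol1 :: 'c kx \<Rightarrow> _)" and "invol1 (cfract c) = cfract (c :: 'c)"
    and "invol1 xfract = - (xfract :: 'c kx)" and "invol1 (invol1 z) = z"
proof -
  let ?w = "- xfract :: 'c kx"
  have eq: "?w = cfract (- 1) * xfract" by (simp add: cfract.uminus)
  have nz: "extend_poly (\<lambda>c. c) ?w p \<noteq> 0" if "p \<noteq> 0" for p
    unfolding eq using that by (intro fract_endo.extend_poly_linear_nz[OF fract_endo_id]) auto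
  show *: "rhom (invol1 :: 'c kx \<Rightarrow> _)" "invol1 (cfract c) = cfract c" "invol1 xfract = ?w" for c :: 'c
    unfolding invol1_def by (rule fract_endo.extend_facts[OF fract_endo_id]; erule nz)+
  have "extend_fract (\<lambda>c. c) ?w ?w = xfract"
    using *(3) rhom.uminus[OF *(1), of xfract] by (simp add: invol1_def)
  then show "invol1 (invol1 z) = z"
    unfolding invol1_def by (intro fract_endo.extend_involution[OF fract_endo_id] nz) auto
qed

lemma invol2_facts:
  fixes z :: "'c::field kxd"
  shows "rhom (invol2 :: 'c kxd \<Rightarrow> _)" and "invol2 (cfract c) = cfract (invol1 c :: 'c kx)"
    and "invol2 xfract = (xfract :: 'c kxd)"
    and "invol2 (invol2 z) = z" and "invol2 (to_fract p) = to_fract (map_poly invol1 (p :: 'c kx poly))"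
proof -
  interpret fract_endo "invol1 :: 'c kx \<Rightarrow> _" unfolding fract_endo_def by (rule invol1_facts)
  let ?w = "xfract :: 'c kxd"
  have nz: "extend_poly invol1 ?w p \<noteq> 0" if "p \<noteq> 0" for p
    using extend_poly_linear_nz[of 1 p] that by simp
  show *: "rhom (invol2 :: 'c kxd \<Rightarrow> _)" "invol2 (cfract c) = cfract (invol1 c)" "invol2 ?w = ?w"
    for c :: "'c kx"
    unfolding invol2_def by (rule extend_facts; erule nz)+
  have **: "invol2 (to_fract p) = extend_poly invol1 ?w p"
    unfolding invol2_def by (rule extend_facts; erule nz)
  have "map_poly invol1 p = pcompose (map_poly invol1 p) [:0, 1:]" by simp
  then show "invol2 (to_fract p) = to_fract (map_poly invol1 p)"
    unfolding ** using extend_poly_scale[of 1 ?w p] by (simp add: poly_map_poly_cfract scale_def)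
  show "invol2 (invol2 z) = z"
    unfolding invol2_def
    by (intro extend_involution nz) (use *(3) invol1_facts(4) in \<open>auto simp: invol2_def\<close>)
qed

lemma linear_nz: "xfract - cfract c \<noteq> 0" "xfract - cfract c = to_fract [:- c, 1:]"
proof -
  show *: "xfract - cfract c = to_fract [:- c, 1:]"
    unfolding xfract_def cfract_def by (simp flip: to_fract_diff)
  show "xfract - cfract c \<noteq> 0" unfolding * by simp
qed

lemma norm_z_altdef: "norm_z = (xfract - cfract 1) * (xfract - cfract (xfract\<^sup>2))"
  unfolding norm_z_def by (simp add: cfract.power)

lemma fract_invol3: "fract_invol (invol2 :: 'c::field kxd \<Rightarrow> _) norm_y"
proof -
  interpret fract_endo "invol2 :: 'c kxd \<Rightarrow> _" unfolding fract_endo_def by (rule invol2_facts)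
  show ?thesis by unfold_locales (simp_all add: invol2_facts norm_y_def)
qed

lemma invol3_facts:
  fixes z :: "'c::field kxdy"
  shows "rhom (invol3 :: 'c kxdy \<Rightarrow> _)" and "invol3 (cfract c) = cfract (invol2 c :: 'c kxd)"
    and "invol3 xfract = cfract norm_y / (xfract :: 'c kxdy)" and "invol3 (invol3 z) = z"
proof -
  interpret fract_invol "invol2 :: 'c kxd \<Rightarrow> _" norm_y by (rule fract_invol3)
  have "S = (invol3 :: 'c kxdy \<Rightarrow> _)" by (simp only: S_def invol3_def)
  then show "rhom (invol3 :: 'c kxdy \<Rightarrow> _)" and "invol3 (cfract c) = cfract (invol2 c :: 'c kxd)"
    and "invol3 xfract = cfract norm_y / (xfract :: 'c kxdy)" and "invol3 (invol3 z) = z"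
    using S_facts(1) S_facts(3)[of c] S_facts(4) S_involution[of z] by metis+
qed

lemma invol2_norm_z: "invol2 norm_z = norm_z"
  by (simp add: norm_z_def rhom.mult[OF invol2_facts(1)] rhom.diff[OF invol2_facts(1)]
      rhom.power[OF invol2_facts(1)] rhom.one[OF invol2_facts(1)] invol2_facts invol1_facts cfract.uminus)

lemma norm_z_nz: "norm_z \<noteq> 0"
  unfolding norm_z_altdef using linear_nz(1) by (intro no_zero_divisors)

lemma fract_invol4: "fract_invol (invol3 :: 'c::field kxdy \<Rightarrow> _) (cfract norm_z)"
proof -
  interpret fract_endo "invol3 :: 'c kxdy \<Rightarrow> _" unfolding fract_endo_def by (rule invol3_facts)
  show ?thesis by unfold_locales (simp_all add: invol3_facts norm_z_nz invol2_norm_z)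
qed

lemma invol_facts:
  fixes z :: "'c::field kxdyz"
  shows "rhom (invol :: 'c kxdyz \<Rightarrow> _)" and "invol (cfract c) = cfract (invol3 c :: 'c kxdy)"
    and "invol xfract = cfract (cfract norm_z) / (xfract :: 'c kxdyz)" and "invol (invol z) = z"
proof -
  interpret fract_invol "invol3 :: 'c kxdy \<Rightarrow> _" "cfract norm_z" by (rule fract_invol4)
  have "S = (invol :: 'c kxdyz \<Rightarrow> _)" by (simp only: S_def invol_def)
  then show "rhom (invol :: 'c kxdyz \<Rightarrow> _)" and "invol (cfract c) = cfract (invol3 c :: 'c kxdy)"
    and "invol xfract = cfract (cfract norm_z) / (xfract :: 'c kxdyz)" and "invol (invol z) = z"
    using S_facts(1) S_facts(3)[of c] S_facts(4) S_involution[of z] by metis+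
qed

text \<open>Applying \<open>s\<close> once more carries a divisor \<pi> of the image of the cofactor
  back to the cofactor, because \<pi> is fixed coefficientwise.\<close>

lemma fval_cong_map_poly:
  assumes \<pi>: "irreducible \<pi>" "map_poly s \<pi> = \<pi>" and s: "rhom s" "\<And>c. s (s c) = c" and p: "p \<noteq> 0"
  shows "pmult \<pi> (map_poly s p) = pmult \<pi> p"
proof -
  interpret m: rhom "map_poly s" by (rule rhom_map_poly[OF s(1)])
  obtain n q where nq: "p = \<pi> ^ n * q" "\<not> \<pi> dvd q" using poly_split_off[OF \<pi>(1) p] by blast
  have "\<not> \<pi> dvd map_poly s q"
  proof
    assume "\<pi> dvd map_poly s q"
    then obtain t where "map_poly s q = \<pi> * t" by auto
    then have "map_poly s (map_poly s q) = \<pi> * map_poly s t" using \<pi>(2) m.mult by simp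
    moreover have "map_poly s (map_poly s q) = q"
      by (rule poly_eqI) (simp add: coeff_map_poly rhom.zero[OF s(1)] s(2))
    ultimately show False using nq(2) by simp
  qed
  then show ?thesis using nq pmult_split_off[OF \<pi>(1)] \<pi>(2) by (simp add: m.mult m.power)
qed

lemma fval_invol2:
  fixes z :: "'a::field kxd"
  assumes \<pi>: "irreducible \<pi>" "map_poly invol1 \<pi> = \<pi>" and z: "z \<noteq> 0"
  shows "fval \<pi> (invol2 z) = fval \<pi> z"
proof -
  obtain p q where pq: "p \<noteq> 0" "q \<noteq> 0" "z = Fract p q" using nonzero_Fract[OF z] .
  have nz: "map_poly invol1 p \<noteq> 0" if "p \<noteq> 0" for p :: "'a kx poly"
    using fract_endo.map_s_nz[unfolded fract_endo_def, OF invol1_facts(1) that] .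
  have "invol2 z = Fract (map_poly invol1 p) (map_poly invol1 q)"
    unfolding pq(3) Fract_conv_to_fract by (simp add: rhom_field_divide[OF invol2_facts(1)] invol2_facts)
  then show ?thesis using pq nz fval_cong_map_poly[OF \<pi> invol1_facts(1,4)] by (simp add: fval_Fract[OF \<pi>(1)])
qed

text \<open>The divisor where d equals \<open>c\<close> is stable under the involution, so
  \<open>z\<close> and its conjugate have the same order along it.\<close>

lemma even_fval_norm:
  fixes z :: "'a::field kxd"
  assumes c: "invol1 c = c" and b: "b \<noteq> 0" "b = z * invol2 z"
  shows "even (fval [:- c, 1:] b)"
proof -
  have \<pi>: "irreducible [:- c, 1:]" by (rule irreducible_linear_field_poly) simp
  interpret int_valuation "fval [:- c, 1:]" by (rule int_valuation_fval[OF \<pi>])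
  have z: "z \<noteq> 0" "invol2 z \<noteq> 0" using b by auto
  have "map_poly invol1 [:- c, 1:] = [:- c, 1:]"
    by (simp add: c map_poly_pCons rhom.zero[OF invol1_facts(1)] rhom.uminus[OF invol1_facts(1)]
        rhom.one[OF invol1_facts(1)])
  then have "fval [:- c, 1:] b = 2 * fval [:- c, 1:] z"
    unfolding b(2) v_mult[OF z] using fval_invol2[OF \<pi> _ z(1)] by simp
  then show ?thesis by simp
qed

lemma fval_linear:
  "fval [:- c, 1:] (xfract - cfract c) = 1"
  "c \<noteq> c' \<Longrightarrow> fval [:- c, 1:] (xfract - cfract c') = 0"
proof -
  have \<pi>: "irreducible [:- c, 1:]" by (rule irreducible_linear_field_poly) simp
  have 0: "pmult [:- c, 1:] p = 0" if "\<not> [:- c, 1:] dvd p" for p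
    using pmult_split_off[OF \<pi> that, of 0] by simp
  have p1: "pmult [:- c, 1:] 1 = 0" by (rule pmult_one[OF \<pi>])
  have "\<not> [:- c, 1:] dvd 1" using poly_eq_0_iff_dvd[of 1 c] by simp
  from pmult_split_off[OF \<pi> this, of 1] p1 show "fval [:- c, 1:] (xfract - cfract c) = 1"
    unfolding linear_nz(2) by (simp add: to_fract_def fval_Fract[OF \<pi>])
  assume "c \<noteq> c'"
  then have "\<not> [:- c, 1:] dvd [:- c', 1:]" using poly_eq_0_iff_dvd[of "[:- c', 1:]" c] by auto
  from 0[OF this] p1 show "fval [:- c, 1:] (xfract - cfract c') = 0"
    unfolding linear_nz(2) by (simp add: to_fract_def fval_Fract[OF \<pi>])
qed

lemma xfract_not_const: "xfract \<noteq> cfract c"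
  using linear_nz(1)[of c] by auto

text \<open>d - 1 has order 1 along d = 1, and (d - 1)^2 (d - x^2) has order 1 along d = x^2. The
  extra factor d has order 0 along both, so every candidate has an odd order, whereas norms have
  even ones.\<close>

lemma not_norm_level2:
  fixes b :: "'c::field kxd"
  assumes b: "b = xfract - 1 \<or> b = (xfract - 1) * norm_z"
  shows "b \<noteq> z * invol2 z" "b * norm_y \<noteq> z * invol2 z"
proof -
  let ?x = "xfract :: 'c kx"
  let ?f = "xfract - cfract 1 :: 'c kxd"
  let ?g = "xfract - cfract (xfract\<^sup>2) :: 'c kxd"
  let ?h = "xfract - cfract 0 :: 'c kxd"
  have x1: "?x\<^sup>2 \<noteq> 1"
  proof
    assume "?x\<^sup>2 = 1"
    then have "?x = cfract 1 \<or> ?x = cfract (- 1)" by (simp add: power2_eq_1_iff cfract.uminus)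
    then show False using xfract_not_const by blast
  qed
  have nz: "?f \<noteq> 0" "?g \<noteq> 0" "?h \<noteq> 0" by (rule linear_nz(1))+
  have inv: "invol1 1 = (1 :: 'c kx)" "invol1 (?x\<^sup>2) = ?x\<^sup>2"
    by (simp_all add: rhom.one[OF invol1_facts(1)] rhom.power[OF invol1_facts(1)] invol1_facts)
  have irr: "irreducible [:- c, 1:]" for c :: "'c kx"
    by (rule irreducible_linear_field_poly) simp
  have h: "norm_y = ?h" by (simp add: norm_y_def)
  have odd1: "odd (fval [:- 1, 1:] ?f)" "odd (fval [:- 1, 1:] (?f * ?h))"
  proof -
    interpret int_valuation "fval [:- 1 :: 'c kx, 1:]" by (rule int_valuation_fval[OF irr])
    show "odd (fval [:- 1, 1:] ?f)" "odd (fval [:- 1, 1:] (?f * ?h))"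
      unfolding v_mult[OF nz(1) nz(3)] fval_linear(1) using fval_linear(2)[of "1 :: 'c kx" 0] by simp_all
  qed
  have odd2: "odd (fval [:- (?x\<^sup>2), 1:] (?f * (?f * ?g)))" "odd (fval [:- (?x\<^sup>2), 1:] (?f * (?f * ?g) * ?h))"
  proof -
    interpret int_valuation "fval [:- (?x\<^sup>2), 1:]" by (rule int_valuation_fval[OF irr])
    have "fval [:- (?x\<^sup>2), 1:] ?f = 0" "fval [:- (?x\<^sup>2), 1:] ?h = 0"
      using fval_linear(2)[OF x1] fval_linear(2)[of "?x\<^sup>2" 0] by simp_all
    moreover have "fval [:- (?x\<^sup>2), 1:] ?g = 1" by (rule fval_linear(1))
    moreover have fg: "?f * ?g \<noteq> 0" "?f * (?f * ?g) \<noteq> 0" using nz by (metis no_zero_divisors)+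
    ultimately have *: "fval [:- (?x\<^sup>2), 1:] (?f * (?f * ?g)) = 1"
      "fval [:- (?x\<^sup>2), 1:] (?f * (?f * ?g) * ?h) = 1"
      using v_mult[OF nz(1,2)] v_mult[OF nz(1) fg(1)] v_mult[OF fg(2) nz(3)] by linarith+
    show "odd (fval [:- (?x\<^sup>2), 1:] (?f * (?f * ?g)))"
      "odd (fval [:- (?x\<^sup>2), 1:] (?f * (?f * ?g) * ?h))"
      unfolding * by simp_all
  qed
  have fg: "?f * (?f * ?g) \<noteq> 0" "?f * (?f * ?g) * ?h \<noteq> 0" "?f * ?h \<noteq> 0"
    using nz by (metis no_zero_divisors)+
  have b': "b = ?f \<or> b = ?f * (?f * ?g)" using b unfolding norm_z_altdef by simp
  show "b \<noteq> z * invol2 z"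
    using b' odd1(1) odd2(1) even_fval_norm[OF inv(1) nz(1)] even_fval_norm[OF inv(2) fg(1)] by metis
  show "b * norm_y \<noteq> z * invol2 z"
    unfolding h using b' odd1(2) odd2(2) even_fval_norm[OF inv(1) fg(3)] even_fval_norm[OF inv(2) fg(2)] by metis
qed

theorem not_norm:
  fixes w :: "'a::field kxdyz"
  shows "w * invol w \<noteq> cfract (cfract (xfract - 1))"
proof
  assume w: "w * invol w = cfract (cfract (xfract - 1))"
  have f: "xfract - 1 \<noteq> (0 :: 'a kxd)" using linear_nz(1)[of 1] by simp
  obtain c :: "'a kxdy" where c: "c \<noteq> 0" "cfract (xfract - 1) = c * invol3 c \<or>
    cfract (xfract - 1) * cfract norm_z = c * invol3 c"
  proof -
    interpret fract_invol "invol3 :: 'a kxdy \<Rightarrow> _" "cfract norm_z" by (rule fract_invol4)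
    have "S = (invol :: 'a kxdyz \<Rightarrow> _)" by (simp only: S_def invol_def)
    moreover have "cfract (xfract - 1) \<noteq> (0 :: 'a kxdy)" using f by (simp only: cfract_eq_0_iff not_False_eq_True)
    ultimately show ?thesis using norm_descent[of "cfract (xfract - 1)" w] w that by auto
  qed
  then obtain b where b: "b = xfract - 1 \<or> b = (xfract - 1) * norm_z" "c * invol3 c = cfract b"
    by (metis cfract.mult)
  have "b \<noteq> 0" using b(1) f norm_z_nz by auto
  interpret fract_invol "invol2 :: 'a kxd \<Rightarrow> _" norm_y by (rule fract_invol3)
  obtain z where "b = z * invol2 z \<or> b * norm_y = z * invol2 z"
    using norm_descent[OF \<open>b \<noteq> 0\<close>, of c] b(2) unfolding S_def invol3_def by metis
  then show False using not_norm_level2[OF b(1)] by metis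
qed

text \<open>The arguments on pure values and isotropy concern types of class \<open>field\<close>,
  so the fixed field is made a type.\<close>

typedef (overloaded) ('c::field) fixfield = "{z :: 'c kxdyz. invol z = z}"
  by (rule exI[of _ 0]) (simp add: rhom.zero[OF invol_facts(1)])

setup_lifting type_definition_fixfield

instantiation fixfield :: (field) field
begin

lift_definition zero_fixfield :: "'a fixfield" is 0
  by (rule rhom.zero[OF invol_facts(1)])

lift_definition one_fixfield :: "'a fixfield" is 1
  by (rule rhom.one[OF invol_facts(1)])

lift_definition plus_fixfield :: "'a fixfield \<Rightarrow> 'a fixfield \<Rightarrow> 'a fixfield" is "(+)"
  by (simp add: rhom.add[OF invol_facts(1)])

lift_definition uminus_fixfield :: "'a fixfield \<Rightarrow> 'a fixfield" is uminus
  by (simp add: rhom.uminus[OF invol_facts(1)])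

lift_definition minus_fixfield :: "'a fixfield \<Rightarrow> 'a fixfield \<Rightarrow> 'a fixfield" is "(-)"
  by (simp add: rhom.diff[OF invol_facts(1)])

lift_definition times_fixfield :: "'a fixfield \<Rightarrow> 'a fixfield \<Rightarrow> 'a fixfield" is "(*)"
  by (simp add: rhom.mult[OF invol_facts(1)])

lift_definition inverse_fixfield :: "'a fixfield \<Rightarrow> 'a fixfield" is inverse
  by (simp add: inverse_eq_divide rhom_field_divide[OF invol_facts(1)] rhom.one[OF invol_facts(1)])

lift_definition divide_fixfield :: "'a fixfield \<Rightarrow> 'a fixfield \<Rightarrow> 'a fixfield" is "(/)"
  by (simp add: rhom_field_divide[OF invol_facts(1)])

instance
  by standard (transfer; simp add: algebra_simps divide_inverse)+

end

lemma rhom_Rep_fixfield: "rhom Rep_fixfield"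
  by (simp add: rhom_def one_fixfield.rep_eq plus_fixfield.rep_eq times_fixfield.rep_eq)

lemma invol_Rep_fixfield [simp]: "invol (Rep_fixfield z) = Rep_fixfield z"
  using Rep_fixfield[of z] by simp

text \<open>The involution negates the root x of \<open>a\<close>, so u^2 - a v^2 is the product of
  u + x v with its conjugate. An isotropic vector would make \<open>b\<close> the norm of a quotient
  of such elements, against \<open>not_norm\<close>.\<close>

lemma not_pfister_isotropic_fixfield:
  fixes a b :: "'c::field fixfield"
  assumes two: "(2 :: 'c) \<noteq> 0" and a: "Rep_fixfield a = (cfract (cfract (cfract xfract)))\<^sup>2"
    and b: "Rep_fixfield b = cfract (cfract (xfract - 1))"
  shows "\<not> pfister_isotropic a b"
proof
  assume "pfister_isotropic a b"
  then obtain p q r s where nz: "p \<noteq> 0 \<or> q \<noteq> 0 \<or> r \<noteq> 0 \<or> s \<noteq> 0"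
    and eq: "p\<^sup>2 - a * q\<^sup>2 = b * (r\<^sup>2 - a * s\<^sup>2)" unfolding pfister_isotropic_def by blast
  interpret R: rhom "Rep_fixfield :: 'c fixfield \<Rightarrow> _" by (rule rhom_Rep_fixfield)
  interpret I: rhom "invol :: 'c kxdyz \<Rightarrow> _" by (rule invol_facts(1))
  define x :: "'c kxdyz" where "x = cfract (cfract (cfract xfract))"
  have x: "invol x = - x" "x \<noteq> 0"
    by (simp_all add: x_def invol_facts invol3_facts invol2_facts invol1_facts cfract.uminus)
  have two': "(2 :: 'c kxdyz) \<noteq> 0"
  proof -
    have "(2 :: 'c kxdyz) = cfract (cfract (cfract (cfract (1 + 1))))"
      by (simp only: cfract.add cfract.one) simp
    moreover have "cfract (cfract (cfract (cfract (1 + 1 :: 'c)))) \<noteq> 0"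
      using two by (simp only: cfract_eq_0_iff one_add_one not_False_eq_True)
    ultimately show ?thesis by metis
  qed
  have Rep_0: "Rep_fixfield u = 0 \<longleftrightarrow> u = 0" for u :: "'c fixfield"
    using Rep_fixfield_inject[of u 0] R.zero by simp
  \<comment> \<open>1 and x are independent over the fixed field, since conjugation changes the sign
    of x and 2 is invertible.\<close>
  have sep: "Rep_fixfield u + x * Rep_fixfield v \<noteq> 0" if "u \<noteq> 0 \<or> v \<noteq> 0" for u v :: "'c fixfield"
  proof
    assume 0: "Rep_fixfield u + x * Rep_fixfield v = 0"
    have "Rep_fixfield u - x * Rep_fixfield v = 0"
      using arg_cong[OF 0, of invol] x by (simp add: I.add I.mult)
    with 0 have "2 * (x * Rep_fixfield v) = 0" by (simp add: algebra_simps)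
    then have "Rep_fixfield v = 0" using x two' by simp
    moreover from this have "Rep_fixfield u = 0" using 0 by simp
    ultimately show False using that Rep_0 by simp
  qed
  define N where "N = (\<lambda>u v. Rep_fixfield u + x * Rep_fixfield v)"
  have norm: "Rep_fixfield (u\<^sup>2 - a * v\<^sup>2) = N u v * invol (N u v)" for u v
    by (simp add: N_def R.diff R.mult R.power a x_def[symmetric] I.add I.mult x power2_eq_square algebra_simps)
  have eq': "N p q * invol (N p q) = Rep_fixfield b * (N r s * invol (N r s))"
    using arg_cong[OF eq, of Rep_fixfield] unfolding R.mult norm .
  have "r \<noteq> 0 \<or> s \<noteq> 0"
  proof (rule ccontr)
    assume rs: "\<not> (r \<noteq> 0 \<or> s \<noteq> 0)"
    then have "N p q * invol (N p q) = 0" using eq' by (simp add: N_def)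
    then have "N p q = 0" using rhom_field_nz[OF invol_facts(1)] by auto
    then show False using sep[of p q] nz rs by (auto simp: N_def)
  qed
  then have rs: "N r s \<noteq> 0" "invol (N r s) \<noteq> 0"
    using sep rhom_field_nz[OF invol_facts(1)] by (auto simp: N_def)
  have "(N p q / N r s) * invol (N p q / N r s) = Rep_fixfield b"
    using eq' rs by (simp add: rhom_field_divide[OF invol_facts(1)])
  then show False using not_norm unfolding b by blast
qed

section \<open>Evaluation of multivariate polynomials\<close>

definition mono_eval :: "(nat \<Rightarrow> 'b::comm_ring_1) \<Rightarrow> (nat \<Rightarrow>\<^sub>0 nat) \<Rightarrow> 'b" where
  "mono_eval s m = (\<Prod>i\<in>Poly_Mapping.keys m. s i ^ Poly_Mapping.lookup m i)"

definition mpoly_eval :: "('k::field \<Rightarrow> 'b::comm_ring_1) \<Rightarrow> (nat \<Rightarrow> 'b) \<Rightarrow> 'k mpoly \<Rightarrow> 'b" where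
  "mpoly_eval h s p = (\<Sum>m\<in>Poly_Mapping.keys p. h (Poly_Mapping.lookup p m) * mono_eval s m)"

abbreviation mconst :: "'k::field \<Rightarrow> 'k mpoly" where
  "mconst c \<equiv> Poly_Mapping.single 0 c"

definition mvar :: "nat \<Rightarrow> 'k::field mpoly" where
  "mvar i = Poly_Mapping.single (Poly_Mapping.single i 1) 1"

lemma poly_mapping_sum_single: "(\<Sum>m\<in>Poly_Mapping.keys p. Poly_Mapping.single m (Poly_Mapping.lookup p m)) = p"
proof (rule poly_mapping_eqI)
  fix k
  have "(\<Sum>m\<in>Poly_Mapping.keys p. Poly_Mapping.lookup (Poly_Mapping.single m (Poly_Mapping.lookup p m)) k)
    = (\<Sum>m\<in>Poly_Mapping.keys p. if m = k then Poly_Mapping.lookup p m else 0)"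
    by (intro sum.cong) (auto simp: lookup_single when_def)
  also have "\<dots> = Poly_Mapping.lookup p k" by (simp add: in_keys_iff)
  finally show "Poly_Mapping.lookup (\<Sum>m\<in>Poly_Mapping.keys p. Poly_Mapping.single m (Poly_Mapping.lookup p m)) k
    = Poly_Mapping.lookup p k" by (simp add: lookup_sum)
qed

lemma mono_eval_superset:
  assumes "finite A" "Poly_Mapping.keys m \<subseteq> A"
  shows "mono_eval s m = (\<Prod>i\<in>A. s i ^ Poly_Mapping.lookup m i)"
  unfolding mono_eval_def using assms by (intro prod.mono_neutral_left) (auto simp: in_keys_iff)

lemma mono_eval_add: "mono_eval s (m + n) = mono_eval s m * mono_eval s n"
proof -
  let ?A = "Poly_Mapping.keys m \<union> Poly_Mapping.keys n"
  have "mono_eval s (m + n) = (\<Prod>i\<in>?A. s i ^ Poly_Mapping.lookup (m + n) i)"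
    by (rule mono_eval_superset) (auto simp: Poly_Mapping.keys_add)
  also have "\<dots> = (\<Prod>i\<in>?A. s i ^ Poly_Mapping.lookup m i) * (\<Prod>i\<in>?A. s i ^ Poly_Mapping.lookup n i)"
    by (simp add: lookup_add power_add prod.distrib)
  also have "\<dots> = mono_eval s m * mono_eval s n"
    by (simp add: mono_eval_superset[of ?A])
  finally show ?thesis .
qed

lemma mpoly_eval_superset:
  assumes "h 0 = 0" "finite A" "Poly_Mapping.keys p \<subseteq> A"
  shows "mpoly_eval h s p = (\<Sum>m\<in>A. h (Poly_Mapping.lookup p m) * mono_eval s m)"
  unfolding mpoly_eval_def using assms by (intro sum.mono_neutral_left) (auto simp: in_keys_iff)

lemma mpoly_eval_single: "h 0 = 0 \<Longrightarrow> mpoly_eval h s (Poly_Mapping.single m c) = h c * mono_eval s m"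
  using mpoly_eval_superset[of h "{m}" "Poly_Mapping.single m c" s] by simp

lemma rhom_mpoly_eval:
  assumes "rhom h" shows "rhom (mpoly_eval h s)"
proof
  interpret rhom h by fact
  have m0: "mono_eval s 0 = 1" by (simp add: mono_eval_def)
  show "mpoly_eval h s 1 = 1"
    using mpoly_eval_single[of h s 0 1] by (simp add: m0)
  fix p q :: "'a mpoly"
  have padd: "mpoly_eval h s (p + q) = mpoly_eval h s p + mpoly_eval h s q" for p q
  proof -
    let ?A = "Poly_Mapping.keys p \<union> Poly_Mapping.keys q"
    have "mpoly_eval h s (p + q) = (\<Sum>m\<in>?A. h (Poly_Mapping.lookup (p + q) m) * mono_eval s m)"
      by (rule mpoly_eval_superset) (auto simp: Poly_Mapping.keys_add)
    then show ?thesis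
      by (simp add: lookup_add add distrib_right sum.distrib mpoly_eval_superset[of h ?A])
  qed
  then show "mpoly_eval h s (p + q) = mpoly_eval h s p + mpoly_eval h s q" .
  have p0: "mpoly_eval h s 0 = 0" by (simp add: mpoly_eval_def)
  have psum: "mpoly_eval h s (\<Sum>x\<in>A. f x) = (\<Sum>x\<in>A. mpoly_eval h s (f x))"
    for f :: "(nat \<Rightarrow>\<^sub>0 nat) \<Rightarrow> 'a mpoly" and A
    by (induction A rule: infinite_finite_induct) (simp_all add: padd p0)
  let ?s = "Poly_Mapping.single" and ?l = "Poly_Mapping.lookup"
  have "p * q = (\<Sum>m\<in>Poly_Mapping.keys p. ?s m (?l p m)) * (\<Sum>n\<in>Poly_Mapping.keys q. ?s n (?l q n))"
    by (simp only: poly_mapping_sum_single)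
  also have "\<dots> = (\<Sum>m\<in>Poly_Mapping.keys p. \<Sum>n\<in>Poly_Mapping.keys q. ?s (m + n) (?l p m * ?l q n))"
    by (simp add: sum_product mult_single)
  finally have "mpoly_eval h s (p * q) =
    (\<Sum>m\<in>Poly_Mapping.keys p. \<Sum>n\<in>Poly_Mapping.keys q. (h (?l p m) * mono_eval s m) * (h (?l q n) * mono_eval s n))"
    by (simp add: psum mpoly_eval_single mult mono_eval_add mult_ac)
  then show "mpoly_eval h s (p * q) = mpoly_eval h s p * mpoly_eval h s q"
    by (simp add: mpoly_eval_def sum_product)
qed

lemma mpoly_eval_const: "rhom h \<Longrightarrow> mpoly_eval h s (mconst c) = h c"
  by (simp add: mpoly_eval_single rhom.zero mono_eval_def)

lemma mpoly_eval_var: "rhom h \<Longrightarrow> mpoly_eval h s (mvar i) = s i"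
  by (simp add: mvar_def mpoly_eval_single rhom.zero rhom.one mono_eval_def)

text \<open>Variables from an arbitrary set, so that inductions can add one variable at a
  time.\<close>

definition mpolys :: "nat set \<Rightarrow> 'k::field mpoly set" where
  "mpolys V = {p. \<forall>m \<in> Poly_Mapping.keys p. Poly_Mapping.keys m \<subseteq> V}"

lemma polys_in_eq: "polys_in n = mpolys {..<n}"
  by (simp add: polys_in_def mpolys_def)

lemma mpolys_const: "mconst c \<in> mpolys V"
  by (simp add: mpolys_def)

lemma mpolys_0: "0 \<in> mpolys V"
  by (simp add: mpolys_def)

lemma mpolys_1: "1 \<in> mpolys V"
  using mpolys_const[of 1 V] by simp

lemma mpolys_var: "i \<in> V \<Longrightarrow> mvar i \<in> mpolys V"
  by (simp add: mpolys_def mvar_def)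

lemma mpolys_add: "p \<in> mpolys V \<Longrightarrow> q \<in> mpolys V \<Longrightarrow> p + q \<in> mpolys V"
  unfolding mpolys_def using Poly_Mapping.keys_add[of p q] by auto

lemma mpolys_mult: "p \<in> mpolys V \<Longrightarrow> q \<in> mpolys V \<Longrightarrow> p * q \<in> mpolys V"
proof -
  assume p: "p \<in> mpolys V" and q: "q \<in> mpolys V"
  show "p * q \<in> mpolys V"
    unfolding mpolys_def
  proof safe
    fix m i assume "m \<in> Poly_Mapping.keys (p * q)" "i \<in> Poly_Mapping.keys m"
    moreover from this obtain a b where "m = a + b" "a \<in> Poly_Mapping.keys p" "b \<in> Poly_Mapping.keys q"
      using keys_mult[of p q] by blast
    ultimately show "i \<in> V" using p q Poly_Mapping.keys_add[of a b] unfolding mpolys_def by blast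
  qed
qed

lemma mpolys_sum: "(\<And>x. x \<in> A \<Longrightarrow> f x \<in> mpolys V) \<Longrightarrow> sum f A \<in> mpolys V"
  by (induction A rule: infinite_finite_induct) (simp_all add: mpolys_0 mpolys_add)

lemma mpolys_power: "p \<in> mpolys V \<Longrightarrow> p ^ n \<in> mpolys V"
  by (induction n) (simp_all add: mpolys_1 mpolys_mult)

lemma mpoly_induct [consumes 1, case_names const var add mult]:
  assumes p: "p \<in> mpolys V" and const: "\<And>c. P (mconst c)" and var: "\<And>i. i \<in> V \<Longrightarrow> P (mvar i)"
    and add: "\<And>p q. P p \<Longrightarrow> P q \<Longrightarrow> P (p + q)" and mult: "\<And>p q. P p \<Longrightarrow> P q \<Longrightarrow> P (p * q)"
  shows "P p"
proof -
  have P1: "P 1" using const[of 1] by simp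
  have P0: "P 0" using const[of 0] by simp
  have Psum: "(\<And>x. x \<in> A \<Longrightarrow> P (f x)) \<Longrightarrow> P (sum f A)" for f :: "(nat \<Rightarrow>\<^sub>0 nat) \<Rightarrow> 'a mpoly" and A
    by (induction A rule: infinite_finite_induct) (simp_all add: P0 add)
  have Pprod: "(\<And>x. x \<in> A \<Longrightarrow> P (f x)) \<Longrightarrow> P (prod f A)" for f :: "nat \<Rightarrow> 'a mpoly" and A
    by (induction A rule: infinite_finite_induct) (simp_all add: P1 mult)
  have Ppow: "P q \<Longrightarrow> P (q ^ n)" for q n
    by (induction n) (simp_all add: P1 mult)
  have pow: "(mvar i :: 'a mpoly) ^ n = Poly_Mapping.single (Poly_Mapping.single i n) 1" for i n
    by (induction n) (simp_all add: mvar_def mult_single flip: single_add)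
  have prod: "finite A \<Longrightarrow> (\<Prod>i\<in>A. (mvar i :: 'a mpoly) ^ f i) = Poly_Mapping.single (\<Sum>i\<in>A. Poly_Mapping.single i (f i)) 1"
    for A f
    by (induction A rule: finite_induct) (simp_all add: pow mult_single)
  have "P (Poly_Mapping.single m (Poly_Mapping.lookup p m))" if m: "m \<in> Poly_Mapping.keys p" for m
  proof -
    have "(\<Prod>i\<in>Poly_Mapping.keys m. (mvar i :: 'a mpoly) ^ Poly_Mapping.lookup m i) = Poly_Mapping.single m 1"
      by (simp add: prod poly_mapping_sum_single)
    moreover have "P (\<Prod>i\<in>Poly_Mapping.keys m. mvar i ^ Poly_Mapping.lookup m i)"
      using p m by (intro Pprod Ppow var) (auto simp: mpolys_def)
    ultimately have "P (mconst (Poly_Mapping.lookup p m) * Poly_Mapping.single m 1)"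
      using mult const by metis
    then show ?thesis by (simp add: mult_single)
  qed
  then have "P (\<Sum>m\<in>Poly_Mapping.keys p. Poly_Mapping.single m (Poly_Mapping.lookup p m))" by (rule Psum)
  then show ?thesis by (simp only: poly_mapping_sum_single)
qed

lemma rhom_mpoly_eqI:
  assumes "rhom f" "rhom g" "\<And>c. f (mconst c) = g (mconst c)" "\<And>i. i \<in> V \<Longrightarrow> f (mvar i) = g (mvar i)"
    and "p \<in> mpolys V"
  shows "f p = g p"
  using assms(5) by (induction rule: mpoly_induct)
    (simp_all add: assms(3,4) rhom.add[OF assms(1)] rhom.add[OF assms(2)] rhom.mult[OF assms(1)] rhom.mult[OF assms(2)])

lemma rhom_mpoly_eqI_UNIV:
  assumes "rhom f" "rhom g" "\<And>c. f (mconst c) = g (mconst c)" "\<And>i. f (mvar i) = g (mvar i)"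
  shows "f p = g p"
  by (rule rhom_mpoly_eqI[OF assms, of _ UNIV]) (simp_all add: mpolys_def)

lemma rhom_mpoly_eval_comp:
  assumes "rhom g" "rhom h"
  shows "g (mpoly_eval h s p) = mpoly_eval (\<lambda>c. g (h c)) (\<lambda>i. g (s i)) p"
  by (rule rhom_mpoly_eqI_UNIV[OF rhom_comp[OF assms(1) rhom_mpoly_eval[OF assms(2)]]
        rhom_mpoly_eval[OF rhom_comp[OF assms]]])
    (simp_all add: mpoly_eval_const mpoly_eval_var assms rhom_comp[OF assms])

text \<open>The polynomial read as univariate in variable \<open>v\<close>. The coefficients keep
  the same type, but no longer involve that variable (\<open>coeff_slice\<close>).\<close>

definition slice :: "nat \<Rightarrow> 'k::field mpoly \<Rightarrow> 'k mpoly poly" where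
  "slice v = mpoly_eval (\<lambda>c. [:mconst c:]) (\<lambda>i. if i = v then [:0, 1:] else [:mvar i:])"

lemma rhom_mconst: "rhom mconst"
  by (simp add: rhom_def single_add mult_single)

lemma rhom_mconst_poly: "rhom (\<lambda>c. [:mconst c:])"
  by (rule rhom_comp[OF rhom_const_poly rhom_mconst])

lemma rhom_slice: "rhom (slice v)"
  unfolding slice_def by (rule rhom_mpoly_eval[OF rhom_mconst_poly])

lemma slice_const: "slice v (mconst c) = [:mconst c:]"
  unfolding slice_def by (rule mpoly_eval_const[OF rhom_mconst_poly])

lemma slice_var: "slice v (mvar i) = (if i = v then [:0, 1:] else [:mvar i:])"
  unfolding slice_def by (rule mpoly_eval_var[OF rhom_mconst_poly])

lemma poly_slice: "poly (slice v p) (mvar v) = p"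
  by (rule rhom_mpoly_eqI_UNIV[OF rhom_comp[OF rhom_poly rhom_slice] rhom_id])
    (simp_all add: slice_const slice_var)

lemma coeff_slice: "p \<in> mpolys (insert v V) \<Longrightarrow> coeff (slice v p) n \<in> mpolys V"
proof (induction p arbitrary: n rule: mpoly_induct)
  case (const c)
  then show ?case by (cases n) (simp_all add: slice_const mpolys_const mpolys_0)
next
  case (var i)
  then show ?case
    by (auto simp: slice_var coeff_pCons mpolys_0 mpolys_1 mpolys_var split: nat.split)
next
  case (add p q)
  then show ?case by (simp add: rhom.add[OF rhom_slice] mpolys_add)
next
  case (mult p q)
  then show ?case by (simp add: rhom.mult[OF rhom_slice] coeff_mult mpolys_sum mpolys_mult)
qed

lemma map_poly_slice:
  assumes "rhom h"
  shows "map_poly (mpoly_eval h s) (slice v p) =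
    mpoly_eval (\<lambda>c. [:h c:]) (\<lambda>i. if i = v then [:0, 1:] else [:s i:]) p"
  unfolding slice_def
  using rhom_mpoly_eval[OF assms, of s]
  by (subst rhom_mpoly_eval_comp[OF rhom_map_poly rhom_mconst_poly])
    (simp_all add: map_poly_pCons rhom.zero rhom.one mpoly_eval_const[OF assms] mpoly_eval_var[OF assms]
      if_distrib cong: if_cong)

text \<open>Substituting a new transcendental for variable \<open>v\<close> evaluates the
  coefficients of the slice separately, and a nonzero coefficient survives by
  \<open>inj\<close>.\<close>

lemma mpoly_eval_transcendental_step:
  fixes h :: "'k::field \<Rightarrow> 'b::field"
  assumes h: "rhom h" and inj: "\<And>p. p \<in> mpolys V \<Longrightarrow> p \<noteq> 0 \<Longrightarrow> mpoly_eval h s p \<noteq> 0"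
    and p: "p \<in> mpolys (insert v V)" "p \<noteq> 0"
  shows "mpoly_eval (\<lambda>c. cfract (h c)) (\<lambda>i. if i = v then xfract else cfract (s i)) p \<noteq> 0"
proof -
  have hc: "rhom (\<lambda>c. [:h c:])" by (rule rhom_comp[OF rhom_const_poly h])
  have "slice v p \<noteq> 0" using poly_slice[of v p] p(2) by auto
  then obtain n where "coeff (slice v p) n \<noteq> 0" by (meson leading_coeff_neq_0)
  then have "mpoly_eval h s (coeff (slice v p) n) \<noteq> 0" using inj coeff_slice[OF p(1)] by blast
  then have "coeff (map_poly (mpoly_eval h s) (slice v p)) n \<noteq> 0"
    by (simp add: coeff_map_poly rhom.zero[OF rhom_mpoly_eval[OF h]])
  then have "map_poly (mpoly_eval h s) (slice v p) \<noteq> 0" by auto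
  then have "to_fract (mpoly_eval (\<lambda>c. [:h c:]) (\<lambda>i. if i = v then [:0, 1:] else [:s i:]) p) \<noteq> 0"
    unfolding map_poly_slice[OF h] by simp
  then show ?thesis
    unfolding rhom_mpoly_eval_comp[OF rhom_to_fract hc]
    by (simp add: cfract_def xfract_def if_distrib cong: if_cong)
qed

text \<open>Otherwise X p + 1 would have positive degree and take only the value 1.\<close>

lemma alg_closed_poly_nonroot:
  fixes p :: "'a::alg_closed_field poly"
  assumes "p \<noteq> 0" shows "\<exists>x. poly p x \<noteq> 0"
proof (rule ccontr)
  assume "\<not> ?thesis"
  then have 0: "poly p x = 0" for x by simp
  have "degree ([:0, 1:] * p + 1) = Suc (degree p)"
    using assms by (subst degree_add_eq_left) (simp_all)
  then obtain x where "poly ([:0, 1:] * p + 1) x = 0"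
    using alg_closed_imp_poly_has_root[of "[:0, 1:] * p + 1"] by auto
  then show False using 0 by simp
qed

text \<open>The induction picks coordinates one at a time, each avoiding the finitely many roots of
  a slice. With values in a finite field this would fail.\<close>

lemma mpoly_nonroot:
  fixes h :: "'k::field \<Rightarrow> 'b::alg_closed_field"
  assumes "finite V" and h: "rhom h"
  shows "p \<in> mpolys V \<Longrightarrow> p \<noteq> 0 \<Longrightarrow> \<exists>s. mpoly_eval h s p \<noteq> 0"
  using assms(1)
proof (induction V arbitrary: p rule: finite_induct)
  case empty
  have "m = 0" if "m \<in> Poly_Mapping.keys p" for m
    using empty(1) that by (auto simp: mpolys_def)
  then have "Poly_Mapping.keys p \<subseteq> {0}" by auto
  then have "p = mconst (Poly_Mapping.lookup p 0)"
    by (intro poly_mapping_eqI) (auto simp: lookup_single when_def in_keys_iff)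
  moreover from this have "Poly_Mapping.lookup p 0 \<noteq> 0" using empty(2) by auto
  ultimately show ?case using mpoly_eval_const[OF h] rhom_field_nz[OF h] by metis
next
  case (insert v V)
  have "slice v p \<noteq> 0" using poly_slice[of v p] insert.prems(2) by auto
  then obtain n where "coeff (slice v p) n \<noteq> 0" by (meson leading_coeff_neq_0)
  then obtain s where "mpoly_eval h s (coeff (slice v p) n) \<noteq> 0"
    using insert.IH coeff_slice[OF insert.prems(1)] by blast
  then have "coeff (map_poly (mpoly_eval h s) (slice v p)) n \<noteq> 0"
    by (simp add: coeff_map_poly rhom.zero[OF rhom_mpoly_eval[OF h]])
  then have "map_poly (mpoly_eval h s) (slice v p) \<noteq> 0" by auto
  then obtain x where x: "poly (map_poly (mpoly_eval h s) (slice v p)) x \<noteq> 0"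
    using alg_closed_poly_nonroot by blast
  have hc: "rhom (\<lambda>c. [:h c:])" by (rule rhom_comp[OF rhom_const_poly h])
  have "poly (map_poly (mpoly_eval h s) (slice v p)) x = mpoly_eval h (\<lambda>i. if i = v then x else s i) p"
    unfolding map_poly_slice[OF h] rhom_mpoly_eval_comp[OF rhom_poly hc]
    by (simp add: if_distrib[of "\<lambda>q. poly q x"] cong: if_cong)
  then show ?case using x by metis
qed

section \<open>Retractions\<close>

definition subfield_set :: "'a::field set \<Rightarrow> bool" where
  "subfield_set K \<longleftrightarrow> 1 \<in> K \<and> (\<forall>a\<in>K. \<forall>b\<in>K. a + b \<in> K \<and> a - b \<in> K \<and> a * b \<in> K \<and> a / b \<in> K)"

locale hom_on =
  fixes S :: "'a::comm_ring_1 set" and h :: "'a \<Rightarrow> 'b::comm_ring_1"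
  assumes hom_one: "h 1 = 1"
    and hom_add: "a \<in> S \<Longrightarrow> b \<in> S \<Longrightarrow> h (a + b) = h a + h b"
    and hom_mult: "a \<in> S \<Longrightarrow> b \<in> S \<Longrightarrow> h (a * b) = h a * h b"
begin

lemma hom_diff: "a \<in> S \<Longrightarrow> b \<in> S \<Longrightarrow> a - b \<in> S \<Longrightarrow> h (a - b) = h a - h b"
  using hom_add[of "a - b" b] by simp

end

lemma hom_on_nz:
  fixes h :: "'a::field \<Rightarrow> 'b::field"
  assumes "hom_on S h" "subfield_set S" "z \<in> S" "z \<noteq> 0"
  shows "h z \<noteq> 0"
proof
  interpret hom_on S h by fact
  assume "h z = 0"
  moreover have "1 / z \<in> S" using assms by (simp add: subfield_set_def)
  ultimately have "h (z * (1 / z)) = 0"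
    using hom_mult[OF assms(3), of "1 / z"] by (metis mult_zero_left)
  then show False using assms(4) hom_one by simp
qed

lemma hom_on_divide:
  fixes h :: "'a::field \<Rightarrow> 'b::field"
  assumes "hom_on S h" "subfield_set S" "a \<in> S" "b \<in> S" "b \<noteq> 0"
  shows "h (a / b) = h a / h b"
proof -
  interpret hom_on S h by fact
  have "a / b \<in> S" using assms by (simp add: subfield_set_def)
  from hom_mult[OF this assms(4)] have "h a = h (a / b) * h b" using assms(5) by simp
  then show ?thesis using hom_on_nz[OF assms(1,2,4,5)] by simp
qed

lemma cst_1: "cst 1 = 1"
  by (simp add: cst_def One_fract_def)

lemma cst_eq_to_fract: "cst c = to_fract (mconst c)"
  by (simp add: cst_def to_fract_def)

lemma var_eq_to_fract: "var i = to_fract (mvar i)"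
  by (simp add: Defs.var_def to_fract_def mvar_def)

text \<open>The induction carries membership in \<open>mpolys V\<close> along, because
  \<open>h\<close> is additive and multiplicative only on \<open>S\<close>.\<close>

lemma hom_on_mpolys_eval:
  fixes h :: "'k::field ratfun \<Rightarrow> 'b::comm_ring_1"
  assumes "hom_on S h" and S: "to_fract ` mpolys V \<subseteq> S" and g: "rhom g" "\<And>c. h (cst c) = g c"
    and p: "p \<in> mpolys V"
  shows "h (to_fract p) = mpoly_eval g (\<lambda>i. h (var i)) p"
proof -
  interpret hom_on S h by fact
  let ?P = "\<lambda>p. p \<in> mpolys V \<and> h (to_fract p) = mpoly_eval g (\<lambda>i. h (var i)) p"
  have "?P p" using p
  proof (induction rule: mpoly_induct)
    case (const c)
    then show ?case using g by (simp add: mpolys_const mpoly_eval_const flip: cst_eq_to_fract)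
  next
    case (var i)
    then show ?case using g by (simp add: mpolys_var mpoly_eval_var flip: var_eq_to_fract)
  next
    case (add p q)
    then have "to_fract p \<in> S" "to_fract q \<in> S" using S by blast+
    then show ?case using add by (simp add: mpolys_add hom_add rhom.add[OF rhom_mpoly_eval[OF g(1)]])
  next
    case (mult p q)
    then have "to_fract p \<in> S" "to_fract q \<in> S" using S by blast+
    then show ?case using mult by (simp add: mpolys_mult hom_mult rhom.mult[OF rhom_mpoly_eval[OF g(1)]])
  qed
  then show ?thesis by blast
qed

text \<open>The retraction maps are controlled on \<open>A\<close> only, while the elements of
  interest lie in its field of quotients.\<close>

lemma finite_common_denominator:
  assumes A: "is_k_subalgebra A" and S: "finite S" "S \<subseteq> {a / b | a b. a \<in> A \<and> b \<in> A \<and> b \<noteq> 0}"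
  shows "\<exists>D\<in>A. D \<noteq> 0 \<and> (\<forall>z\<in>S. z * D \<in> A)"
  using S
proof (induction S rule: finite_induct)
  case empty
  have "1 \<in> A" using A cst_1 unfolding is_k_subalgebra_def by metis
  then show ?case by (intro bexI[of _ 1]) auto
next
  case (insert z S)
  then obtain D where D: "D \<in> A" "D \<noteq> 0" "\<forall>w\<in>S. w * D \<in> A" by auto
  obtain a b where ab: "a \<in> A" "b \<in> A" "b \<noteq> 0" "z = a / b" using insert.prems by blast
  have mult: "x * y \<in> A" if "x \<in> A" "y \<in> A" for x y using A that unfolding is_k_subalgebra_def by blast
  have "z * (D * b) = a * D" using ab by simp
  moreover have "w * (D * b) = (w * D) * b" for w by simp
  ultimately have "\<forall>w\<in>insert z S. w * (D * b) \<in> A" using D ab mult by (metis insert_iff)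
  then show ?case using D ab mult by (intro bexI[of _ "D * b"]) auto
qed

lemma finite_common_exponent:
  assumes f: "f \<in> polys_in m" "f \<noteq> 0" and S: "finite S" "g ` S \<subseteq> localized_poly_ring m f"
  shows "\<exists>N. \<forall>z\<in>S. \<exists>p\<in>polys_in m. g z = to_fract p / to_fract (f ^ N)"
  using S
proof (induction S rule: finite_induct)
  case (insert z S)
  then obtain N where N: "\<forall>w\<in>S. \<exists>p\<in>polys_in m. g w = to_fract p / to_fract (f ^ N)" by auto
  obtain p n where p: "p \<in> polys_in m" "g z = to_fract p / to_fract (f ^ n)"
    using insert.prems unfolding localized_poly_ring_def Fract_conv_to_fract by auto
  have shift: "to_fract q / to_fract (f ^ i) = to_fract (q * f ^ j) / to_fract (f ^ (i + j))" for q i j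
    using f(2) by (simp add: power_add)
  have pow: "q * f ^ j \<in> polys_in m" if "q \<in> polys_in m" for q j
    using that f(1) unfolding polys_in_eq by (intro mpolys_mult mpolys_power)
  have "\<exists>q\<in>polys_in m. g w = to_fract q / to_fract (f ^ (N + n))" if "w \<in> insert z S" for w
  proof (cases "w = z")
    case True
    have "g w = to_fract (p * f ^ N) / to_fract (f ^ (N + n))"
      unfolding True p(2) shift[of p n N] by (simp only: add.commute)
    then show ?thesis using pow[OF p(1)] by blast
  next
    case False
    then have "w \<in> S" using that by simp
    from bspec[OF N this] obtain q where q: "q \<in> polys_in m" "g w = to_fract q / to_fract (f ^ N)" ..
    have "g w = to_fract (q * f ^ n) / to_fract (f ^ (N + n))" unfolding q(2) by (rule shift)
    then show ?thesis using pow[OF q(1)] by blast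
  qed
  then show ?case by blast
qed simp

lemma alg_closed_sqrt: "\<exists>y :: 'a::alg_closed_field. y\<^sup>2 = x"
  using nth_root_exists[of 2 x] by auto

lemma rhom_to_ac: "rhom to_ac"
  by (simp add: rhom_def)

text \<open>Only ratios of the polynomials attached to elements of the fixed field are meaningful,
  so both relations are carried along as cubic forms, with \<open>e\<close> in the place of
  1.\<close>

lemma dehomogenize:
  fixes a d e u w :: "'a::field"
  assumes "e \<noteq> 0"
  shows "d * e * e = u * u * e - a * w * w \<Longrightarrow> d / e = (u / e)\<^sup>2 - a / e * (w / e)\<^sup>2"
    and "(d - e) * (d - a) * e = u * u * e - a * w * w \<Longrightarrow>
      (d / e - 1) * (d / e - a / e) = (u / e)\<^sup>2 - a / e * (w / e)\<^sup>2"
proof -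
  have rhs: "(u / e)\<^sup>2 - a / e * (w / e)\<^sup>2 = (u * u * e - a * w * w) / (e * e * e)"
    using assms by (simp add: power2_eq_square field_simps)
  show "d / e = (u / e)\<^sup>2 - a / e * (w / e)\<^sup>2" if "d * e * e = u * u * e - a * w * w"
    unfolding rhs that[symmetric] using assms by simp
  have "(d / e - 1) * (d / e - a / e) = (d - e) / e * ((d - a) / e)"
    using assms by (simp add: diff_divide_distrib)
  also have "\<dots> = (d - e) * (d - a) * e / (e * e * e)" using assms by simp
  finally show "(d / e - 1) * (d / e - a / e) = (u / e)\<^sup>2 - a / e * (w / e)\<^sup>2"
    if "(d - e) * (d - a) * e = u * u * e - a * w * w"
    unfolding rhs that[symmetric] .
qed

text \<open>A retraction puts the generic point of K on the image of a generic line through a geometric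
  point c of the affine space: the line through c and the images of the coordinates.\<close>

theorem retract_imp_pfister_isotropic:
  fixes K :: "'k::field ratfun set" and j :: "'k ratfun \<Rightarrow> 'l::field" and kL :: "'k alg_closure \<Rightarrow> 'l"
  assumes K: "subfield_set K" and j: "hom_on K j" and retract: "retract_k_rational K"
    and kL: "rhom kL" "\<And>c. j (cst c) = kL (to_ac c)" and two: "(2 :: 'l) \<noteq> 0"
    and mem: "a \<in> K" "d \<in> K" "u1 \<in> K" "w1 \<in> K" "u2 \<in> K" "w2 \<in> K"
    and nz: "a \<noteq> 0" "d \<noteq> 0" "d \<noteq> 1" "d \<noteq> a"
    and rel1: "d = u1\<^sup>2 - a * w1\<^sup>2" and rel2: "(d - 1) * (d - a) = u2\<^sup>2 - a * w2\<^sup>2"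
  shows "pfister_isotropic (j a) (j d - 1)"
proof -
  obtain A m f \<phi> \<psi> where A: "A \<subseteq> K" "is_k_subalgebra A" "K = {a / b | a b. a \<in> A \<and> b \<in> A \<and> b \<noteq> 0}"
    and f: "f \<in> polys_in m" "f \<noteq> 0"
    and \<phi>: "is_k_alg_hom A (localized_poly_ring m f) \<phi>"
    and \<psi>: "is_k_alg_hom (localized_poly_ring m f) A \<psi>"
    and \<psi>\<phi>: "\<And>a. a \<in> A \<Longrightarrow> \<psi> (\<phi> a) = a"
    using retract unfolding retract_k_rational_def by (elim exE conjE) blast
  interpret j: hom_on K j by fact
  define R where "R = localized_poly_ring m f"
  have \<phi>R: "\<And>s. s \<in> A \<Longrightarrow> \<phi> s \<in> R" and \<psi>A: "\<And>r. r \<in> R \<Longrightarrow> \<psi> r \<in> A"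
    using \<phi> \<psi> unfolding is_k_alg_hom_def R_def by auto
  have kc: "rhom (\<lambda>c. kL (to_ac c))" by (rule rhom_comp[OF kL(1) rhom_to_ac])
  have 1: "(1 :: 'k ratfun) = cst 1" by (simp add: cst_1)
  interpret \<phi>: hom_on A \<phi>
    using \<phi> unfolding is_k_alg_hom_def by unfold_locales (metis 1, auto)
  interpret j\<psi>: hom_on R "\<lambda>r. j (\<psi> r)"
  proof
    show "j (\<psi> 1) = 1" using \<psi> j.hom_one unfolding is_k_alg_hom_def by (metis 1)
    fix a b assume "a \<in> R" "b \<in> R"
    moreover from this have "\<psi> a \<in> K" "\<psi> b \<in> K" using \<psi>A A(1) by auto
    ultimately show "j (\<psi> (a + b)) = j (\<psi> a) + j (\<psi> b)" "j (\<psi> (a * b)) = j (\<psi> a) * j (\<psi> b)"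
      using \<psi> j.hom_add j.hom_mult unfolding is_k_alg_hom_def R_def by auto
  qed
  have RI: "to_fract p / to_fract (f ^ n) \<in> R" if "p \<in> polys_in m" for p n
    unfolding R_def localized_poly_ring_def using that by (auto simp: Fract_conv_to_fract)
  then have R_poly: "to_fract ` mpolys {..<m} \<subseteq> R"
    using RI[of _ 0] by (auto simp: polys_in_eq)
  \<comment> \<open>The generic point of the line: the images of the variables under \<psi>, seen in
    \<open>'l\<close>.\<close>
  define \<tau> where "\<tau> i = j (\<psi> (var i))" for i
  define ev where "ev = mpoly_eval (\<lambda>c. kL (to_ac c)) \<tau>"
  interpret ev: rhom ev unfolding ev_def by (rule rhom_mpoly_eval[OF kc])
  have ev_eq: "j (\<psi> (to_fract p)) = ev p" if "p \<in> polys_in m" for p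
    unfolding ev_def \<tau>_def
  proof (rule hom_on_mpolys_eval[OF j\<psi>.hom_on_axioms R_poly kc])
    show "j (\<psi> (cst c)) = kL (to_ac c)" for c using \<psi> kL(2) unfolding is_k_alg_hom_def by simp
  qed (use that in \<open>simp add: polys_in_eq\<close>)
  have f1: "1 \<in> polys_in m" unfolding polys_in_eq by (rule mpolys_1)
  \<comment> \<open>\<open>f\<close> is a unit of the localization, so its image cannot
    vanish.\<close>
  have ev_f: "ev f \<noteq> 0"
  proof
    assume "ev f = 0"
    then have "j (\<psi> (to_fract f)) = 0" using ev_eq[OF f(1)] by simp
    moreover have "to_fract f \<in> R" "1 / to_fract f \<in> R" using RI[OF f(1), of 0] RI[OF f1, of 1] by simp_all
    ultimately have "j (\<psi> (to_fract f * (1 / to_fract f))) = 0"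
      using j\<psi>.hom_mult[of "to_fract f" "1 / to_fract f"] by (metis mult_zero_left)
    then show False using f(2) j\<psi>.hom_one by simp
  qed
  have ev_frac: "j (\<psi> (to_fract p / to_fract (f ^ n))) = ev p / ev f ^ n" if "p \<in> polys_in m" for p n
  proof -
    have fn: "f ^ n \<in> polys_in m" using f(1) unfolding polys_in_eq by (rule mpolys_power)
    have "to_fract (f ^ n) \<in> R" using R_poly fn by (auto simp: polys_in_eq)
    then have "j (\<psi> (to_fract p / to_fract (f ^ n) * to_fract (f ^ n)))
      = j (\<psi> (to_fract p / to_fract (f ^ n))) * ev (f ^ n)"
      unfolding ev_eq[OF fn, symmetric] by (intro j\<psi>.hom_mult RI that)
    then have "ev p = j (\<psi> (to_fract p / to_fract (f ^ n))) * ev f ^ n"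
      using f(2) ev_eq[OF that] by (simp add: ev.power)
    then show ?thesis using ev_f by simp
  qed
  \<comment> \<open>The element 1 is included so that \<open>P 1\<close> can serve as the common
    denominator of the family.\<close>
  define S where "S = {1, a, d, u1, w1, u2, w2}"
  have "1 \<in> K" using K by (simp add: subfield_set_def)
  then have SK: "S \<subseteq> K" using mem by (simp add: S_def)
  have "finite S" by (simp add: S_def)
  from finite_common_denominator[OF A(2) this SK[unfolded A(3)]]
  obtain D where D: "D \<in> A" "D \<noteq> 0" "\<And>z. z \<in> S \<Longrightarrow> z * D \<in> A" by blast
  have "(\<lambda>z. \<phi> (z * D)) ` S \<subseteq> localized_poly_ring m f" using D(3) \<phi>R by (auto simp: R_def)
  from finite_common_exponent[OF f \<open>finite S\<close> this]
  obtain N where "\<forall>z\<in>S. \<exists>p\<in>polys_in m. \<phi> (z * D) = to_fract p / to_fract (f ^ N)"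
    by blast
  then obtain P where P: "\<And>z. z \<in> S \<Longrightarrow> P z \<in> polys_in m"
    "\<And>z. z \<in> S \<Longrightarrow> \<phi> (z * D) = to_fract (P z) / to_fract (f ^ N)" by metis
  have fN: "to_fract (f ^ N) \<noteq> 0" using f(2) by simp
  have \<phi>P: "to_fract (P z) = \<phi> (z * D) * to_fract (f ^ N)" if "z \<in> S" for z
    using P(2)[OF that] fN by simp
  \<comment> \<open>The retraction property enters here: at the generic point the polynomials
    \<open>P z\<close> are proportional to the elements \<open>j z\<close>, with a factor
    independent of \<open>z\<close>.\<close>
  have evP: "ev (P z) = j z * (j D * ev f ^ N)" if z: "z \<in> S" for z
  proof -
    have "j (\<psi> (\<phi> (z * D))) = ev (P z) / ev f ^ N" unfolding P(2)[OF z] by (rule ev_frac[OF P(1)[OF z]])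
    moreover have "j (\<psi> (\<phi> (z * D))) = j z * j D"
      using \<psi>\<phi>[OF D(3)[OF z]] j.hom_mult z SK D(1) A(1) by auto
    ultimately show ?thesis using ev_f by (simp add: field_simps)
  qed
  define g where "g = to_fract (f ^ N)"
  define e where "e = j D * ev f ^ N"
  have e: "e \<noteq> 0" using hom_on_nz[OF j K] D A(1) ev_f by (auto simp: e_def)
  have S: "1 \<in> S" "a \<in> S" "d \<in> S" "u1 \<in> S" "w1 \<in> S" "u2 \<in> S" "w2 \<in> S" by (simp_all add: S_def)
  note D' = D(3)[OF S(1)] D(3)[OF S(2)] D(3)[OF S(3)] D(3)[OF S(4)] D(3)[OF S(5)] D(3)[OF S(6)] D(3)[OF S(7)]
  have Amult: "x * y \<in> A" and Adiff: "x - y \<in> A" if "x \<in> A" "y \<in> A" for x y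
    using A(2) that unfolding is_k_subalgebra_def by auto
  have \<phi>_rhs: "\<phi> (s * s * p - r * t * t) = \<phi> s * \<phi> s * \<phi> p - \<phi> r * \<phi> t * \<phi> t"
    if "p \<in> A" "r \<in> A" "s \<in> A" "t \<in> A" for p r s t
    using that by (simp add: \<phi>.hom_mult \<phi>.hom_diff Amult Adiff)
  have \<phi>_lhs: "\<phi> ((q - p) * (q - r) * p) = (\<phi> q - \<phi> p) * (\<phi> q - \<phi> r) * \<phi> p"
    if "p \<in> A" "q \<in> A" "r \<in> A" for p q r
    using that by (simp add: \<phi>.hom_mult \<phi>.hom_diff Amult Adiff)
  \<comment> \<open>Since \<phi> is a homomorphism on \<open>A\<close>, the relations hold between
    the polynomials themselves. They can therefore be evaluated along the whole line.\<close>
  have relP1: "P d * P 1 * P 1 = P u1 * P u1 * P 1 - P a * P w1 * P w1"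
  proof -
    have "(d * D) * (1 * D) * (1 * D) = (u1 * D) * (u1 * D) * (1 * D) - (a * D) * (w1 * D) * (w1 * D)"
      by (subst rel1) (simp add: power2_eq_square algebra_simps)
    from arg_cong[OF this, of \<phi>]
    have "\<phi> (d * D) * \<phi> (1 * D) * \<phi> (1 * D) =
      \<phi> (u1 * D) * \<phi> (u1 * D) * \<phi> (1 * D) - \<phi> (a * D) * \<phi> (w1 * D) * \<phi> (w1 * D)"
      unfolding \<phi>_rhs[OF D'(1,2,4,5)]
      by (simp only: \<phi>.hom_mult[OF Amult[OF D'(3,1)] D'(1)] \<phi>.hom_mult[OF D'(3,1)])
    from arg_cong[OF this, of "\<lambda>t. t * (g * g * g)"]
    have "to_fract (P d * P 1 * P 1) = to_fract (P u1 * P u1 * P 1 - P a * P w1 * P w1)"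
      by (simp add: \<phi>P S g_def[symmetric] algebra_simps)
    then show ?thesis by (simp only: to_fract_eq_iff)
  qed
  have relP2: "(P d - P 1) * (P d - P a) * P 1 = P u2 * P u2 * P 1 - P a * P w2 * P w2"
  proof -
    have "(d * D - 1 * D) * (d * D - a * D) * (1 * D) = (d - 1) * (d - a) * (D * D * D)"
      by (simp add: algebra_simps)
    also have "\<dots> = (u2 * D) * (u2 * D) * (1 * D) - (a * D) * (w2 * D) * (w2 * D)"
      unfolding rel2 by (simp add: power2_eq_square algebra_simps)
    finally have eq: "(d * D - 1 * D) * (d * D - a * D) * (1 * D) =
      (u2 * D) * (u2 * D) * (1 * D) - (a * D) * (w2 * D) * (w2 * D)" .
    have "(\<phi> (d * D) - \<phi> (1 * D)) * (\<phi> (d * D) - \<phi> (a * D)) * \<phi> (1 * D) =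
      \<phi> (u2 * D) * \<phi> (u2 * D) * \<phi> (1 * D) - \<phi> (a * D) * \<phi> (w2 * D) * \<phi> (w2 * D)"
      unfolding \<phi>_lhs[OF D'(1,3,2), symmetric] \<phi>_rhs[OF D'(1,2,6,7), symmetric] eq ..
    from arg_cong[OF this, of "\<lambda>t. t * (g * g * g)"]
    have "to_fract ((P d - P 1) * (P d - P a) * P 1) = to_fract (P u2 * P u2 * P 1 - P a * P w2 * P w2)"
      by (simp add: \<phi>P S g_def[symmetric] algebra_simps)
    then show ?thesis by (simp only: to_fract_eq_iff)
  qed
  have jnz: "j a \<noteq> 0" "j d \<noteq> 0" "j d \<noteq> 1" "j d \<noteq> j a"
  proof -
    have "d - 1 \<in> K" "d - a \<in> K" using K mem \<open>1 \<in> K\<close> by (auto simp: subfield_set_def)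
    then show "j a \<noteq> 0" "j d \<noteq> 0" "j d \<noteq> 1" "j d \<noteq> j a"
      using hom_on_nz[OF j K, of a] hom_on_nz[OF j K, of d] hom_on_nz[OF j K, of "d - 1"]
        hom_on_nz[OF j K, of "d - a"] nz mem \<open>1 \<in> K\<close> j.hom_diff j.hom_one by auto
  qed
  have evPs: "ev (P 1) = e" "ev (P a) = j a * e" "ev (P d) = j d * e"
    using evP[OF S(1)] evP[OF S(2)] evP[OF S(3)] j.hom_one unfolding e_def by simp_all
  \<comment> \<open>Where \<open>B\<close> does not vanish, the denominator and the values of a and
    d - 1 are nonzero. Its value at the generic point shows that \<open>B\<close> is not
    zero.\<close>
  define B where "B = P 1 * (P a * (P d - P 1))"
  have "ev B = e * (j a * e * ((j d - 1) * e))"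
    by (simp add: B_def ev.mult ev.diff evPs algebra_simps)
  then have "ev B \<noteq> 0" using e jnz by simp
  then have "B \<noteq> 0" by auto
  have PdP1: "P d - P 1 \<in> polys_in m"
  proof -
    have "P d + mconst (- 1) * P 1 \<in> mpolys {..<m}"
      using P(1)[OF S(1)] P(1)[OF S(3)] unfolding polys_in_eq by (intro mpolys_add mpolys_mult mpolys_const)
    moreover have "mconst (- 1) = (- 1 :: 'k mpoly)" by (simp add: single_uminus)
    ultimately show ?thesis by (simp add: polys_in_eq)
  qed
  then have "B \<in> mpolys {..<m}"
    using P(1)[OF S(1)] P(1)[OF S(2)] unfolding B_def polys_in_eq by (intro mpolys_mult)
  then obtain c where c: "mpoly_eval to_ac c B \<noteq> 0"
    using mpoly_nonroot[OF _ rhom_to_ac, of "{..<m}" B] \<open>B \<noteq> 0\<close> by auto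
  define ev0 where "ev0 = mpoly_eval to_ac c"
  interpret ev0: rhom ev0 unfolding ev0_def by (rule rhom_mpoly_eval[OF rhom_to_ac])
  have c': "ev0 (P 1) \<noteq> 0" "ev0 (P a) \<noteq> 0" "ev0 (P d) \<noteq> ev0 (P 1)"
    using c unfolding ev0_def[symmetric] B_def by (auto simp: ev0.mult ev0.diff)
  \<comment> \<open>Restriction to the line that passes through \<open>c\<close> at parameter 0 and
    through \<tau> at parameter 1.\<close>
  define \<Lambda> where "\<Lambda> = mpoly_eval (\<lambda>k. [:kL (to_ac k):]) (\<lambda>i. [:kL (c i), \<tau> i - kL (c i):])"
  have kcp: "rhom (\<lambda>k. [:kL (to_ac k):])" by (rule rhom_comp[OF rhom_const_poly kc])
  interpret \<Lambda>: rhom \<Lambda> unfolding \<Lambda>_def by (rule rhom_mpoly_eval[OF kcp])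
  interpret kL: rhom kL by fact
  have \<Lambda>1: "poly (\<Lambda> p) 1 = ev p" for p
    unfolding \<Lambda>_def ev_def rhom_mpoly_eval_comp[OF rhom_poly kcp] by simp
  have \<Lambda>0: "poly (\<Lambda> p) 0 = kL (ev0 p)" for p
    unfolding \<Lambda>_def ev0_def rhom_mpoly_eval_comp[OF rhom_poly kcp] rhom_mpoly_eval_comp[OF kL(1) rhom_to_ac]
    by simp
  have kLinj: "kL x = kL y \<longleftrightarrow> x = y" for x y
    using rhom_field_nz[OF kL(1), of "x - y"] kL.diff by auto
  obtain i where i: "i\<^sup>2 = (- 1 :: 'k alg_closure)" using alg_closed_sqrt by blast
  obtain t where t: "t\<^sup>2 = ev0 (P a) / ev0 (P 1)" using alg_closed_sqrt by blast
  let ?fr = "\<lambda>p. to_fract (\<Lambda> p) / to_fract (\<Lambda> (P 1))"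
  have \<Lambda>P1: "\<Lambda> (P 1) \<noteq> 0" using \<Lambda>1[of "P 1"] e evPs(1) by auto
  have "pfister_isotropic (poly (\<Lambda> (P a)) 1 / poly (\<Lambda> (P 1)) 1) (poly (\<Lambda> (P d)) 1 / poly (\<Lambda> (P 1)) 1 - 1)"
  proof (rule pfister_isotropic_specialize[OF two, where i = "kL i" and t = "kL t"])
    show "(kL i)\<^sup>2 = - 1" using i by (simp flip: kL.power add: kL.uminus)
    show "?fr (P d) = (?fr (P u1))\<^sup>2 - ?fr (P a) * (?fr (P w1))\<^sup>2"
      using arg_cong[OF relP1, of "\<lambda>p. to_fract (\<Lambda> p)"] \<Lambda>P1
      by (intro dehomogenize(1)) (simp_all only: \<Lambda>.mult \<Lambda>.diff to_fract_mult to_fract_diff to_fract_eq_0_iff not_False_eq_True)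
    show "(?fr (P d) - 1) * (?fr (P d) - ?fr (P a)) = (?fr (P u2))\<^sup>2 - ?fr (P a) * (?fr (P w2))\<^sup>2"
      using arg_cong[OF relP2, of "\<lambda>p. to_fract (\<Lambda> p)"] \<Lambda>P1
      by (intro dehomogenize(2)) (simp_all only: \<Lambda>.mult \<Lambda>.diff to_fract_mult to_fract_diff to_fract_eq_0_iff not_False_eq_True)
    have "\<Lambda> (P d) \<noteq> 0" using \<Lambda>1[of "P d"] e evPs(3) jnz by auto
    then show "?fr (P d) \<noteq> 0" using \<Lambda>P1 by simp
    have "\<Lambda> (P d) \<noteq> \<Lambda> (P a)" using \<Lambda>1[of "P d"] \<Lambda>1[of "P a"] e evPs jnz by auto
    then show "?fr (P d) \<noteq> ?fr (P a)" using \<Lambda>P1 by simp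
    show "poly (\<Lambda> (P 1)) 0 \<noteq> 0" "poly (\<Lambda> (P d)) 0 \<noteq> poly (\<Lambda> (P 1)) 0"
      unfolding \<Lambda>0 using c' kLinj[of _ 0] kLinj by auto
    show "poly (\<Lambda> (P a)) 0 = (kL t)\<^sup>2 * poly (\<Lambda> (P 1)) 0"
      unfolding \<Lambda>0 using t c' by (simp flip: kL.power kL.mult)
    have "t \<noteq> 0" using t c' by auto
    then show "kL t \<noteq> 0" using kLinj[of t 0] by simp
    show "poly (\<Lambda> (P 1)) 1 \<noteq> 0" "poly (\<Lambda> (P a)) 1 \<noteq> 0" "poly (\<Lambda> (P d)) 1 \<noteq> poly (\<Lambda> (P 1)) 1"
      unfolding \<Lambda>1 evPs using e jnz by auto
  qed
  then show ?thesis unfolding \<Lambda>1 evPs using e by simp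
qed

text \<open>The nesting repeats the shape produced by \<open>mpoly_eval_transcendental_step\<close>,
  so that injectivity follows by unfolding. Indices 0, 3, 1, 2 stand for x, d, y, z in the order of
  adjunction; all others go to 0.\<close>

definition coords :: "nat \<Rightarrow> 'c::field kxdyz" where
  "coords i = (if i = 2 then xfract else cfract (if i = 1 then xfract else cfract
    (if i = 3 then xfract else cfract (if i = 0 then xfract else cfract 0))))"

definition base :: "'k::field \<Rightarrow> 'k alg_closure kxdyz" where
  "base c = cfract (cfract (cfract (cfract (to_ac c))))"

text \<open>Unspecified outside the rational functions in the first four variables.\<close>

definition ratfun_embed :: "'k::field ratfun \<Rightarrow> 'k alg_closure kxdyz" where
  "ratfun_embed z = (SOME w. \<exists>p q. p \<in> polys_in 4 \<and> q \<in> polys_in 4 \<and> q \<noteq> 0 \<and> z = Fract p q \<and>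
     w = mpoly_eval base coords p / mpoly_eval base coords q)"

lemma rhom_cfract4: "rhom (\<lambda>c. cfract (cfract (cfract (cfract c))))"
  by (intro rhom_comp[OF rhom_cfract] rhom_cfract)

lemma rhom_base: "rhom base"
  using rhom_comp[OF rhom_cfract4 rhom_to_ac] unfolding base_def[abs_def] .

lemma mpoly_eval_coords_nz:
  assumes "p \<in> polys_in 4" "p \<noteq> 0" shows "mpoly_eval base coords p \<noteq> 0"
proof -
  \<comment> \<open>Without variables the evaluation does not depend on the point, so the one from
    \<open>mpoly_nonroot\<close> may be replaced by 0.\<close>
  have 0: "mpoly_eval to_ac (\<lambda>i. 0) p \<noteq> 0" if p: "p \<in> mpolys {}" "p \<noteq> 0" for p :: "'a mpoly"
  proof -
    obtain s where "mpoly_eval to_ac s p \<noteq> 0" using mpoly_nonroot[OF _ rhom_to_ac p] by auto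
    moreover have "mpoly_eval to_ac s p = mpoly_eval to_ac (\<lambda>i. 0) p"
      by (rule rhom_mpoly_eqI[OF _ _ _ _ p(1)])
        (simp_all add: rhom_mpoly_eval rhom_to_ac mpoly_eval_const)
    ultimately show ?thesis by simp
  qed
  note h1 = rhom_comp[OF rhom_cfract rhom_to_ac]
  note h2 = rhom_comp[OF rhom_cfract h1]
  note h3 = rhom_comp[OF rhom_cfract h2]
  note step = mpoly_eval_transcendental_step
  have 1: "mpoly_eval (\<lambda>c. cfract (to_ac c)) (\<lambda>i. if i = 0 then xfract else cfract 0) p \<noteq> 0"
    if "p \<in> mpolys {0}" "p \<noteq> 0" for p :: "'a mpoly"
    by (rule step[OF rhom_to_ac 0 that])
  have 2: "mpoly_eval (\<lambda>c. cfract (cfract (to_ac c)))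
      (\<lambda>i. if i = 3 then xfract else cfract (if i = 0 then xfract else cfract 0)) p \<noteq> 0"
    if "p \<in> mpolys {3, 0}" "p \<noteq> 0" for p :: "'a mpoly"
    by (rule step[OF h1 1 that])
  have 3: "mpoly_eval (\<lambda>c. cfract (cfract (cfract (to_ac c))))
      (\<lambda>i. if i = 1 then xfract else cfract (if i = 3 then xfract else cfract (if i = 0 then xfract else cfract 0))) p \<noteq> 0"
    if "p \<in> mpolys {1, 3, 0}" "p \<noteq> 0" for p :: "'a mpoly"
    by (rule step[OF h2 2 that])
  have "{..<4::nat} = {2, 1, 3, 0}" by auto
  then have "p \<in> mpolys {2, 1, 3, 0}" using assms(1) by (simp add: polys_in_eq)
  from step[OF h3 3 this assms(2)] show ?thesis
    unfolding base_def[abs_def] coords_def[abs_def] .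
qed

lemma embed_Fract:
  assumes p: "p \<in> polys_in 4" and q: "q \<in> polys_in 4" "q \<noteq> 0"
  shows "ratfun_embed (Fract p q) = mpoly_eval base coords p / mpoly_eval base coords q"
  unfolding ratfun_embed_def
proof (rule some_equality)
  interpret rhom "mpoly_eval base coords" by (rule rhom_mpoly_eval[OF rhom_base])
  fix w assume "\<exists>p' q'. p' \<in> polys_in 4 \<and> q' \<in> polys_in 4 \<and> q' \<noteq> 0 \<and> Fract p q = Fract p' q' \<and>
     w = mpoly_eval base coords p' / mpoly_eval base coords q'"
  then obtain p' q' where *: "q' \<in> polys_in 4" "q' \<noteq> 0" "Fract p q = Fract p' q'"
    "w = mpoly_eval base coords p' / mpoly_eval base coords q'" by blast
  then have "p * q' = p' * q" using q by (simp add: eq_fract)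
  then have "mpoly_eval base coords p * mpoly_eval base coords q' = mpoly_eval base coords p' * mpoly_eval base coords q"
    by (simp flip: mult)
  then show "w = mpoly_eval base coords p / mpoly_eval base coords q"
    using *(4) mpoly_eval_coords_nz[OF *(1,2)] mpoly_eval_coords_nz[OF q] by (simp add: frac_eq_eq)
qed (use p q in blast)

lemma polys_in_closed:
  fixes p q :: "'a::field mpoly"
  shows "p \<in> polys_in n \<Longrightarrow> q \<in> polys_in n \<Longrightarrow> p + q \<in> polys_in n"
    and "p \<in> polys_in n \<Longrightarrow> q \<in> polys_in n \<Longrightarrow> p * q \<in> polys_in n"
    and "p \<in> polys_in n \<Longrightarrow> - p \<in> polys_in n"
    and "(1 :: 'a mpoly) \<in> polys_in n"
  by (simp_all add: polys_in_eq mpolys_add mpolys_mult mpolys_1) (simp add: mpolys_def)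

lemma subfield_ratfun_field: "subfield_set (ratfun_field n)"
  unfolding subfield_set_def
proof (intro conjI ballI)
  show "1 \<in> ratfun_field n" unfolding ratfun_field_def One_fract_def using polys_in_closed(4) by force
  fix a b :: "'a ratfun" assume "a \<in> ratfun_field n" "b \<in> ratfun_field n"
  then obtain p q r s where a: "a = Fract p q" "p \<in> polys_in n" "q \<in> polys_in n" "q \<noteq> 0"
    and b: "b = Fract r s" "r \<in> polys_in n" "s \<in> polys_in n" "s \<noteq> 0" unfolding ratfun_field_def by blast
  have I: "Fract u v \<in> ratfun_field n" if "u \<in> polys_in n" "v \<in> polys_in n" "v \<noteq> 0" for u v
    using that unfolding ratfun_field_def by blast
  note cl = polys_in_closed
  have neg: "- r \<in> polys_in n" using b cl(3) by blast
  have "a + b = Fract (p * s + r * q) (q * s)" "a - b = Fract (p * s + (- r) * q) (q * s)"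
    "a * b = Fract (p * r) (q * s)" using a b by simp_all
  moreover have "q * s \<noteq> 0" using a b by simp
  ultimately show "a + b \<in> ratfun_field n" "a - b \<in> ratfun_field n" "a * b \<in> ratfun_field n"
    using I a b neg cl(1,2) by metis+
  show "a / b \<in> ratfun_field n"
  proof (cases "r = 0")
    case True
    have "Fract 0 1 \<in> ratfun_field n" using cl(4) by (intro I) (simp_all add: polys_in_def)
    then have "(0 :: 'a ratfun) \<in> ratfun_field n" by (simp only: Zero_fract_def)
    moreover have "b = 0" using True b by (simp add: Zero_fract_def eq_fract)
    ultimately show ?thesis by simp
  next
    case False
    have "a / b = Fract (p * s) (q * r)" using a b by simp
    moreover have "q * r \<noteq> 0" using a False by simp
    ultimately show ?thesis using I a b cl(2) by metis
  qed
qed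

lemma hom_on_embed: "hom_on (ratfun_field 4) ratfun_embed"
proof
  interpret rhom "mpoly_eval base coords" by (rule rhom_mpoly_eval[OF rhom_base])
  have "ratfun_embed (Fract 1 1 :: 'a ratfun) = 1" by (subst embed_Fract) (simp_all add: polys_in_closed)
  then show "ratfun_embed (1 :: 'a ratfun) = 1" by (simp only: One_fract_def[symmetric])
  fix a b :: "'a ratfun" assume "a \<in> ratfun_field 4" "b \<in> ratfun_field 4"
  then obtain p q r s where a: "a = Fract p q" "p \<in> polys_in 4" "q \<in> polys_in 4" "q \<noteq> 0"
    and b: "b = Fract r s" "r \<in> polys_in 4" "s \<in> polys_in 4" "s \<noteq> 0" unfolding ratfun_field_def by blast
  have nz: "mpoly_eval base coords q \<noteq> 0" "mpoly_eval base coords s \<noteq> 0"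
    using mpoly_eval_coords_nz a b by blast+
  have "a + b = Fract (p * s + r * q) (q * s)" "a * b = Fract (p * r) (q * s)" using a b by simp_all
  then show "ratfun_embed (a + b) = ratfun_embed a + ratfun_embed b" "ratfun_embed (a * b) = ratfun_embed a * ratfun_embed b"
    using a b nz by (simp_all add: embed_Fract polys_in_closed add mult add_frac_eq)
qed

lemma embed_to_fract: "p \<in> polys_in 4 \<Longrightarrow> ratfun_embed (to_fract p) = mpoly_eval base coords p"
  using embed_Fract[of p 1] by (simp add: to_fract_def polys_in_closed rhom.one[OF rhom_mpoly_eval[OF rhom_base]])

lemma embed_cst: "ratfun_embed (cst c) = base c"
  unfolding cst_eq_to_fract
  by (subst embed_to_fract) (simp_all add: polys_in_eq mpolys_const mpoly_eval_const[OF rhom_base])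

lemma embed_var: "i < 4 \<Longrightarrow> ratfun_embed (var i) = coords i"
  unfolding var_eq_to_fract
  by (subst embed_to_fract) (simp_all add: polys_in_eq mpolys_var mpoly_eval_var[OF rhom_base])

lemma to_fract_in_ratfun_field: "p \<in> polys_in n \<Longrightarrow> to_fract p \<in> ratfun_field n"
  unfolding ratfun_field_def to_fract_def using polys_in_closed(4) by force

lemma var_in_ratfun_field: "i < n \<Longrightarrow> var i \<in> ratfun_field n"
  unfolding var_eq_to_fract by (rule to_fract_in_ratfun_field) (simp add: polys_in_eq mpolys_var)

lemma cst_in_ratfun_field: "cst c \<in> ratfun_field n"
  unfolding cst_eq_to_fract by (rule to_fract_in_ratfun_field) (simp add: polys_in_eq mpolys_const)

lemma var_nz: "var i \<noteq> 0"
proof -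
  have "mvar i \<noteq> (0 :: 'a mpoly)" unfolding mvar_def
    by (metis lookup_single_eq lookup_zero zero_neq_one)
  then show ?thesis by (simp add: var_eq_to_fract)
qed

lemma invol_const: "invol (cfract (cfract (cfract (cfract c)))) = cfract (cfract (cfract (cfract c)))"
  by (simp add: invol_facts invol3_facts invol2_facts invol1_facts)

definition const_fixfield :: "'c::field \<Rightarrow> 'c fixfield" where
  "const_fixfield c = Abs_fixfield (cfract (cfract (cfract (cfract c))))"

lemma Rep_const_fixfield: "Rep_fixfield (const_fixfield c) = cfract (cfract (cfract (cfract c)))"
  unfolding const_fixfield_def by (rule Abs_fixfield_inverse) (simp add: invol_const)

lemma rhom_const_fixfield: "rhom const_fixfield"
  by unfold_locales (simp_all add: Rep_const_fixfield rhom.one[OF rhom_Rep_fixfield]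
      rhom.add[OF rhom_Rep_fixfield] rhom.mult[OF rhom_Rep_fixfield] rhom.one[OF rhom_cfract4]
      rhom.add[OF rhom_cfract4] rhom.mult[OF rhom_cfract4] flip: Rep_fixfield_inject)

theorem theorem6p3:
  fixes \<rho> :: "'k::field ratfun \<Rightarrow> 'k ratfun"
  assumes char: "(2::'k) \<noteq> 0"
    and hom: "is_k_alg_hom (ratfun_field 4) (ratfun_field 4) \<rho>"
    and bij: "bij_betw \<rho> (ratfun_field 4) (ratfun_field 4)"
    and r1: "\<rho> (var 0) = - var 0"
    and r2: "\<rho> (var 1) = var 3 / var 1"
    and r3: "\<rho> (var 2) = (var 3 - 1) * (var 3 - var 0 ^ 2) / var 2"
    and r4: "\<rho> (var 3) = var 3"
  shows "\<not> retract_k_rational {z \<in> ratfun_field 4. \<rho> z = z}"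
proof
  define F where "F = (ratfun_field 4 :: 'k ratfun set)"
  define K where "K = {z \<in> F. \<rho> z = z}"
  assume "retract_k_rational {z \<in> ratfun_field 4. \<rho> z = z}"
  then have retract: "retract_k_rational K" by (simp only: K_def F_def)
  have F: "subfield_set F" unfolding F_def by (rule subfield_ratfun_field)
  have \<rho>F: "\<rho> z \<in> F" if "z \<in> F" for z using hom that unfolding is_k_alg_hom_def F_def by blast
  have \<rho>c: "\<rho> (cst c) = cst c" for c using hom unfolding is_k_alg_hom_def by blast
  interpret \<rho>: hom_on F \<rho>
    using hom \<rho>c[of 1] unfolding is_k_alg_hom_def F_def cst_1 by unfold_locales auto
  interpret E: hom_on F ratfun_embed unfolding F_def by (rule hom_on_embed)
  interpret I: rhom "invol :: 'k alg_closure kxdyz \<Rightarrow> _" by (rule invol_facts(1))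
  note E_div = hom_on_divide[OF E.hom_on_axioms F]
  note \<rho>_div = hom_on_divide[OF \<rho>.hom_on_axioms F]
  have F_closed: "a + b \<in> F" "a - b \<in> F" "a * b \<in> F" "a / b \<in> F" if "a \<in> F" "b \<in> F" for a b
    using F that by (auto simp: subfield_set_def)
  have F1: "1 \<in> F" using F by (simp add: subfield_set_def)
  have F0: "0 \<in> F" using F_closed(2)[OF F1 F1] by simp
  have \<rho>0: "\<rho> 0 = 0" using \<rho>.hom_diff[OF F0 F0] F0 by simp
  define x y z d where xyzd: "x = (var 0 :: 'k ratfun)" "y = (var 1 :: 'k ratfun)"
    "z = (var 2 :: 'k ratfun)" "d = (var 3 :: 'k ratfun)"
  have xF: "x \<in> F" "y \<in> F" "z \<in> F" "d \<in> F" unfolding xyzd F_def by (simp_all add: var_in_ratfun_field)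
  have nz: "x \<noteq> 0" "y \<noteq> 0" "z \<noteq> 0" "d \<noteq> 0" unfolding xyzd by (rule var_nz)+
  have E_vars: "ratfun_embed x = cfract (cfract (cfract xfract))" "ratfun_embed y = cfract xfract"
    "ratfun_embed z = xfract" "ratfun_embed d = cfract (cfract xfract)"
    unfolding xyzd by (simp_all add: embed_var coords_def)
  have sqF: "x ^ 2 \<in> F" using xF F_closed(3) by (simp add: power2_eq_square)
  have E_a: "ratfun_embed (x ^ 2) = (cfract (cfract (cfract xfract)))\<^sup>2"
    using E.hom_mult[OF xF(1) xF(1)] by (simp add: power2_eq_square E_vars)
  have d1: "d \<noteq> 1"
  proof
    assume "d = 1"
    then have "cfract (cfract xfract) = (cfract (cfract (cfract 1)) :: 'k alg_closure kxdyz)"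
      using E_vars(4) E.hom_one by simp
    then show False using xfract_not_const by (simp only: cfract_eq_iff) blast
  qed
  have da: "d \<noteq> x ^ 2"
  proof
    assume "d = x ^ 2"
    then have "cfract (cfract xfract) = (cfract (cfract (cfract (xfract ^ 2))) :: 'k alg_closure kxdyz)"
      using E_vars(4) E_a by (simp add: cfract.power)
    then show False using xfract_not_const by (simp only: cfract_eq_iff) blast
  qed
  define f where "f = (d - 1) * (d - x ^ 2)"
  have f: "f \<noteq> 0" "f \<in> F" using d1 da F_closed F1 xF sqF by (auto simp: f_def)
  have \<rho>x: "\<rho> x = - x" and \<rho>y: "\<rho> y = d / y" and \<rho>z: "\<rho> z = f / z" and \<rho>d: "\<rho> d = d"
    using r1 r2 r3 r4 unfolding xyzd f_def by simp_all
  have \<rho>a: "\<rho> (x ^ 2) = x ^ 2" using \<rho>.hom_mult[OF xF(1) xF(1)] by (simp add: power2_eq_square \<rho>x)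
  have \<rho>f: "\<rho> f = f"
    unfolding f_def using \<rho>.hom_mult[OF F_closed(2)[OF xF(4) F1] F_closed(2)[OF xF(4) sqF]]
      \<rho>.hom_diff[OF xF(4) F1 F_closed(2)[OF xF(4) F1]] \<rho>.hom_diff[OF xF(4) sqF F_closed(2)[OF xF(4) sqF]]
    by (simp add: \<rho>d \<rho>a \<rho>.hom_one)

  \<comment> \<open>The embedding intertwines \<rho> with the concrete involution: two homomorphisms
    on \<open>F\<close> that agree on constants and variables agree on polynomials, hence on
    fractions. This is why \<open>j\<close> below lands in the fixed field.\<close>
  have E_\<rho>: "ratfun_embed (\<rho> w) = invol (ratfun_embed w)" if "w \<in> F" for w
  proof -
    have h1: "hom_on F (\<lambda>w. ratfun_embed (\<rho> w))"
      by unfold_locales (simp_all add: \<rho>.hom_one E.hom_one \<rho>.hom_add \<rho>.hom_mult E.hom_add E.hom_mult \<rho>F)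
    have h2: "hom_on F (\<lambda>w. invol (ratfun_embed w))"
      by unfold_locales (simp_all add: E.hom_one E.hom_add E.hom_mult I.add I.mult)
    have FF: "to_fract ` mpolys {..<4} \<subseteq> F"
      unfolding F_def using to_fract_in_ratfun_field by (auto simp: polys_in_eq)
    have vars: "ratfun_embed (\<rho> (var i)) = invol (ratfun_embed (var i :: 'k ratfun))" if "i < 4" for i
    proof -
      have "i = 0 \<or> i = 1 \<or> i = 2 \<or> i = 3" using that by linarith
      moreover have "ratfun_embed (\<rho> x) = invol (ratfun_embed x)"
        using E.hom_diff[OF F0 xF(1) F_closed(2)[OF F0 xF(1)]] E.hom_diff[OF F0 F0] F0
        by (simp add: \<rho>x E_vars invol_facts invol3_facts invol2_facts invol1_facts cfract.uminus)
      moreover have "ratfun_embed (\<rho> y) = invol (ratfun_embed y)"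
        using E_div[OF xF(4) xF(2) nz(2)]
        by (simp add: \<rho>y E_vars invol_facts invol3_facts norm_y_def rhom_field_divide[OF rhom_cfract])
      moreover have "ratfun_embed (\<rho> d) = invol (ratfun_embed d)"
        by (simp add: \<rho>d E_vars invol_facts invol3_facts invol2_facts)
      moreover have "ratfun_embed (\<rho> z) = invol (ratfun_embed z)"
        using E_div[OF f(2) xF(3) nz(3)] E.hom_mult[OF F_closed(2)[OF xF(4) F1] F_closed(2)[OF xF(4) sqF]]
          E.hom_diff[OF xF(4) F1 F_closed(2)[OF xF(4) F1]] E.hom_diff[OF xF(4) sqF F_closed(2)[OF xF(4) sqF]]
        by (simp add: \<rho>z f_def[symmetric] E_vars E_a E.hom_one invol_facts norm_z_def
            cfract.mult cfract.diff cfract.power)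
      ultimately show ?thesis unfolding xyzd by auto
    qed
    have polys: "ratfun_embed (\<rho> (to_fract p)) = invol (ratfun_embed (to_fract p))"
      if p: "p \<in> polys_in 4" for p :: "'k mpoly"
    proof -
      have p': "p \<in> mpolys {..<4}" using p by (simp add: polys_in_eq)
      have "ratfun_embed (\<rho> (to_fract p)) = mpoly_eval base (\<lambda>i. ratfun_embed (\<rho> (var i))) p"
        by (rule hom_on_mpolys_eval[OF h1 FF rhom_base _ p']) (simp add: \<rho>c embed_cst)
      also have "\<dots> = mpoly_eval base (\<lambda>i. invol (ratfun_embed (var i))) p"
        by (rule rhom_mpoly_eqI[OF rhom_mpoly_eval[OF rhom_base] rhom_mpoly_eval[OF rhom_base] _ _ p'])
          (simp_all add: mpoly_eval_const[OF rhom_base] mpoly_eval_var[OF rhom_base] vars)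
      also have "\<dots> = invol (ratfun_embed (to_fract p))"
        by (rule hom_on_mpolys_eval[OF h2 FF rhom_base _ p', symmetric])
          (simp add: embed_cst base_def invol_const)
      finally show ?thesis .
    qed
    from that obtain p q where pq: "p \<in> polys_in 4" "q \<in> polys_in 4" "q \<noteq> 0" "w = to_fract p / to_fract q"
      unfolding F_def ratfun_field_def Fract_conv_to_fract by blast
    have "to_fract p \<in> F" "to_fract q \<in> F" "to_fract q \<noteq> 0"
      using pq to_fract_in_ratfun_field unfolding F_def by auto
    then show ?thesis unfolding pq(4) hom_on_divide[OF h1 F \<open>to_fract p \<in> F\<close> \<open>to_fract q \<in> F\<close> \<open>to_fract q \<noteq> 0\<close>]
        hom_on_divide[OF h2 F \<open>to_fract p \<in> F\<close> \<open>to_fract q \<in> F\<close> \<open>to_fract q \<noteq> 0\<close>]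
      using polys pq by simp
  qed

  have K: "subfield_set K"
    unfolding subfield_set_def
  proof (intro conjI ballI)
    show "1 \<in> K" using F1 \<rho>.hom_one by (simp add: K_def)
    fix a b assume "a \<in> K" "b \<in> K"
    then have ab: "a \<in> F" "b \<in> F" "\<rho> a = a" "\<rho> b = b" by (auto simp: K_def)
    show "a + b \<in> K" "a - b \<in> K" "a * b \<in> K"
      using ab F_closed[OF ab(1,2)] \<rho>.hom_add[OF ab(1,2)] \<rho>.hom_mult[OF ab(1,2)] \<rho>.hom_diff[OF ab(1,2)]
      by (simp_all add: K_def)
    show "a / b \<in> K"
      using ab F_closed(4)[OF ab(1,2)] \<rho>_div[OF ab(1,2)] F0 \<rho>0 by (cases "b = 0") (simp_all add: K_def)
  qed
  define j where "j w = Abs_fixfield (ratfun_embed w)" for w :: "'k ratfun"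
  have Rep_j: "Rep_fixfield (j w) = ratfun_embed w" if "w \<in> K" for w
    unfolding j_def using that E_\<rho>[of w] by (intro Abs_fixfield_inverse) (simp add: K_def)
  interpret Rep: rhom "Rep_fixfield :: 'k alg_closure fixfield \<Rightarrow> _" by (rule rhom_Rep_fixfield)
  have j: "hom_on K j"
  proof
    show "j 1 = 1" using Rep_j[of 1] K E.hom_one Rep.one
      by (metis Rep_fixfield_inject subfield_set_def)
    fix a b assume ab: "a \<in> K" "b \<in> K"
    then have "a \<in> F" "b \<in> F" "a + b \<in> K" "a * b \<in> K" using K by (auto simp: K_def subfield_set_def)
    then show "j (a + b) = j a + j b" "j (a * b) = j a * j b"
      using ab by (simp_all add: Rep_j E.hom_add E.hom_mult Rep.add Rep.mult flip: Rep_fixfield_inject)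
  qed
  have cK: "cst c \<in> K" for c by (simp add: K_def F_def cst_in_ratfun_field \<rho>c)
  have j_cst: "j (cst c) = const_fixfield (to_ac c)" for c
    by (simp add: Rep_j[OF cK] Rep_const_fixfield embed_cst base_def flip: Rep_fixfield_inject)
  have two: "(2 :: 'k alg_closure fixfield) \<noteq> 0" "(2 :: 'k ratfun) \<noteq> 0"
  proof -
    interpret c: rhom "const_fixfield :: 'k alg_closure \<Rightarrow> _" by (rule rhom_const_fixfield)
    have "(2 :: 'k alg_closure) \<noteq> 0" using char to_ac_numeral[of "num.Bit0 num.One"] by (metis to_ac_eq_0_iff)
    then have "const_fixfield (1 + 1 :: 'k alg_closure) \<noteq> 0"
      by (simp add: rhom_field_nz[OF rhom_const_fixfield])
    moreover have "const_fixfield (1 + 1 :: 'k alg_closure) = 1 + 1" by (simp only: c.add c.one)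
    ultimately show "(2 :: 'k alg_closure fixfield) \<noteq> 0" by (metis one_add_one)
    have rc: "rhom (cst :: 'k \<Rightarrow> _)"
      using rhom_comp[OF rhom_to_fract rhom_mconst] by (simp add: cst_eq_to_fract[abs_def])
    have "cst (1 + 1 :: 'k) \<noteq> 0" by (rule rhom_field_nz[OF rc]) (use char in simp)
    moreover have "cst (1 + 1 :: 'k) = 1 + 1" by (simp only: rhom.add[OF rc] cst_1)
    ultimately show "(2 :: 'k ratfun) \<noteq> 0" by (metis one_add_one)
  qed
  have two_F: "2 \<in> F" using F_closed(1)[OF F1 F1] by simp
  have \<rho>2: "\<rho> 2 = 2" using \<rho>.hom_add[OF F1 F1] by (simp add: \<rho>.hom_one)
  \<comment> \<open>An element \<open>v\<close> with conjugate g / v has norm \<open>g\<close>; its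
    components along 1 and x turn this into a relation over \<open>K\<close>. It is applied to y
    with g = d and to z with g = (d - 1)(d - a).\<close>
  have norm: "\<exists>u\<in>K. \<exists>w\<in>K. g = u\<^sup>2 - x ^ 2 * w\<^sup>2"
    if v: "v \<in> F" "\<rho> v = g / v" "v \<noteq> 0" and g: "g \<in> F" "\<rho> g = g" "g \<noteq> 0" for v g
  proof -
    define v' where "v' = g / v"
    have v': "v' \<in> F" "\<rho> v' = v"
      using v g F_closed(4)[OF g(1) v(1)] \<rho>_div[OF g(1) v(1,3)] by (simp_all add: v'_def)
    have x2: "2 * x \<in> F" "2 * x \<noteq> 0" "\<rho> (2 * x) = - (2 * x)"
      using F_closed(3)[OF two_F xF(1)] two(2) nz(1) \<rho>.hom_mult[OF two_F xF(1)] by (simp_all add: \<rho>2 \<rho>x)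
    \<comment> \<open>The invariant part of \<open>v\<close>, and its anti-invariant part divided by
      x: thus u + x w = v and u - x w = v'.\<close>
    define u w where "u = (v + v') / 2" and "w = (v - v') / (2 * x)"
    have "\<rho> u = u"
      using \<rho>_div[OF F_closed(1)[OF v(1) v'(1)] two_F two(2)] \<rho>.hom_add[OF v(1) v'(1)]
      unfolding u_def \<rho>2 v(2) v'(2) v'_def[symmetric] by (simp only: add.commute)
    moreover have "\<rho> w = w"
    proof -
      have "\<rho> w = (v' - v) / - (2 * x)"
        using \<rho>_div[OF F_closed(2)[OF v(1) v'(1)] x2(1,2)]
          \<rho>.hom_diff[OF v(1) v'(1) F_closed(2)[OF v(1) v'(1)]]
        unfolding w_def x2(3) v(2) v'(2) v'_def[symmetric] by simp
      also have "\<dots> = w" unfolding w_def by (metis minus_diff_eq minus_divide_divide)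
      finally show ?thesis .
    qed
    moreover have "u \<in> F" "w \<in> F"
      unfolding u_def w_def by (rule F_closed(4)[OF F_closed(1)[OF v(1) v'(1)] two_F],
          rule F_closed(4)[OF F_closed(2)[OF v(1) v'(1)] x2(1)])
    moreover have "g = u\<^sup>2 - x ^ 2 * w\<^sup>2"
    proof -
      have "x * w = (v - v') / 2" using nz(1) two(2) by (simp add: w_def)
      then have "u - x * w = v'" "u + x * w = v"
        using two(2) by (simp_all add: u_def field_simps)
      then have "v' * v = (u - x * w) * (u + x * w)" by simp
      also have "\<dots> = u\<^sup>2 - x ^ 2 * w\<^sup>2" by (simp add: power2_eq_square algebra_simps)
      finally show ?thesis using v(3) by (simp add: v'_def)
    qed
    ultimately show ?thesis unfolding K_def by blast
  qed
  obtain u1 w1 where uw1: "u1 \<in> K" "w1 \<in> K" "d = u1\<^sup>2 - x ^ 2 * w1\<^sup>2"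
    using norm[OF xF(2) \<rho>y nz(2) xF(4) \<rho>d nz(4)] by blast
  obtain u2 w2 where uw2: "u2 \<in> K" "w2 \<in> K" "f = u2\<^sup>2 - x ^ 2 * w2\<^sup>2"
    using norm[OF xF(3) \<rho>z nz(3) f(2) \<rho>f f(1)] by blast
  have aK: "x ^ 2 \<in> K" "d \<in> K" using sqF xF \<rho>a \<rho>d by (simp_all add: K_def)
  have "pfister_isotropic (j (x ^ 2)) (j d - 1)"
    by (rule retract_imp_pfister_isotropic[OF K j retract rhom_const_fixfield j_cst two(1) aK uw1(1,2) uw2(1,2)
          _ nz(4) d1 da uw1(3) uw2(3)[unfolded f_def]]) (use nz in simp)
  moreover have "\<not> pfister_isotropic (j (x ^ 2)) (j d - 1)"
  proof (rule not_pfister_isotropic_fixfield)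
    show "(2 :: 'k alg_closure) \<noteq> 0" using char to_ac_numeral[of "num.Bit0 num.One"] by (metis to_ac_eq_0_iff)
    show "Rep_fixfield (j (x ^ 2)) = (cfract (cfract (cfract xfract)))\<^sup>2" by (simp add: Rep_j aK E_a)
    show "Rep_fixfield (j d - 1) = cfract (cfract (xfract - 1))"
      by (simp add: Rep.diff Rep_j aK E_vars cfract.diff)
  qed
  ultimately show False by blast
qed

end
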